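(* For each integer $k\ge 0$ there is only a finite number of isomorphism classes of non-$S_3$-splittable toric Fano manifolds $X$ (of arbitrary dimension $d=\dim X$) whose Picard number satisfies $\rho_X \ge 2d-k$.
   Context: A toric Fano $d$-fold is a $d$-dimensional smooth projective toric variety whose anticanonical divisor is ample; a point is regarded as the $0$-dimensional toric Fano manifold. Isomorphism classes of toric Fano $d$-folds $X$ correspond one-to-one to lattice equivalence classes of $d$-dimensional smooth Fano polytopes $P$ (full-dimensional lattice polytopes with the origin in the interior such that the vertices of each facet form a lattice basis), with $\rho_X = |\operatorname{Vert}(P)|-d$, and products of varieties correspond to direct sums $Q\oplus Q'=\operatorname{conv}(Q\times\{0\}\cup\{0\}\times Q')$ of polytopes. $S_3$ denotes the toric del Pezzo surface obtained by blowing up $\mathbb{P}^2$ in its three torus-invariant points; it corresponds to the hexagon with vertices $\pm e_1,\pm e_2,\pm(e_1-e_2)$. A toric Fano manifold $X$ is called non-$S_3$-splittable if it is not isomorphic to a product of $S_3$ and a lower-dimensional toric Fano manifold (possibly a point). *)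

theory Defs
  imports "HOL-Analysis.Analysis" "HOL-Analysis.Finite_Function_Topology"
begin

text \<open>
  A toric Fano manifold \<open>X\<close> is represented by its dimension \<open>d\<close> together with the smooth Fano
  polytope \<open>P\<close> in \<open>\<real>\<^sup>d\<close> whose faces span the fan of \<open>X\<close>. Under the standard dictionary,
  isomorphism of varieties is lattice equivalence of polytopes and the product of varieties is the
  direct sum of polytopes.

  As \<open>d\<close> ranges over all natural numbers, the spaces \<open>\<real>\<^sup>d\<close> are realised as the coordinate
  subspaces of the normed space of finitely supported real sequences.
\<close>

type_synonym rvec = "nat \<Rightarrow>\<^sub>0 real"

definition coord_space :: "nat \<Rightarrow> rvec set" where
  "coord_space d = {x. Poly_Mapping.keys x \<subseteq> {..<d}}"

definition int_lattice :: "nat \<Rightarrow> rvec set" where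
  "int_lattice d = {x \<in> coord_space d. \<forall>i. Poly_Mapping.lookup x i \<in> \<int>}"

definition lattice_basis :: "nat \<Rightarrow> rvec set \<Rightarrow> bool" where
  "lattice_basis d B \<longleftrightarrow> finite B \<and> B \<subseteq> int_lattice d \<and>
     (\<forall>x \<in> int_lattice d. \<exists>!c. c \<in> B \<rightarrow>\<^sub>E (UNIV :: int set) \<and> x = (\<Sum>b\<in>B. of_int (c b) *\<^sub>R b))"

definition vertices :: "rvec set \<Rightarrow> rvec set" where
  "vertices P = {v. v extreme_point_of P}"

definition lattice_polytope :: "nat \<Rightarrow> rvec set \<Rightarrow> bool" where
  "lattice_polytope d P \<longleftrightarrow> (\<exists>V. finite V \<and> V \<subseteq> int_lattice d \<and> P = convex hull V)"

text \<open>
  The library's \<open>facet_of\<close> and \<open>aff_dim\<close> are restricted to Euclidean spaces. The affine dimension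
  of a nonempty face is the dimension of the span of its differences; in the following definition
  it equals \<open>d - 1\<close>.
\<close>

definition polytope_facet :: "nat \<Rightarrow> rvec set \<Rightarrow> rvec set \<Rightarrow> bool" where
  "polytope_facet d F P \<longleftrightarrow> F face_of P \<and> F \<noteq> {} \<and> dim {x - y |x y. x \<in> F \<and> y \<in> F} + 1 = d"

text \<open>
  Full-dimensionality is implied by the origin being in the interior relative to \<open>\<real>\<^sup>d\<close>. For
  \<open>d = 0\<close> the only smooth Fano polytope is the origin, which represents a point.
\<close>

definition smooth_fano_polytope :: "nat \<Rightarrow> rvec set \<Rightarrow> bool" where
  "smooth_fano_polytope d P \<longleftrightarrow>
     lattice_polytope d P \<and>
     0 \<in> top_of_set (coord_space d) interior_of P \<and>
     (\<forall>F. polytope_facet d F P \<longrightarrow> lattice_basis d (vertices F))"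

definition lattice_equivalent :: "nat \<Rightarrow> rvec set \<Rightarrow> rvec set \<Rightarrow> bool" where
  "lattice_equivalent d P Q \<longleftrightarrow>
     (\<exists>f. linear f \<and> bij_betw f (int_lattice d) (int_lattice d) \<and> f ` P = Q)"

definition shift_coords :: "nat \<Rightarrow> rvec \<Rightarrow> rvec" where
  "shift_coords m x = (\<Sum>i\<in>Poly_Mapping.keys x. Poly_Mapping.single (m + i) (Poly_Mapping.lookup x i))"

text \<open>Direct sum of \<open>P\<close>, living in \<open>\<real>\<^sup>m\<close>, and \<open>Q\<close>, which is moved to the coordinates from \<open>m\<close> on.\<close>

definition direct_sum :: "nat \<Rightarrow> rvec set \<Rightarrow> rvec set \<Rightarrow> rvec set" where
  "direct_sum m P Q = convex hull (P \<union> shift_coords m ` Q)"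

definition unit_vec :: "nat \<Rightarrow> rvec" where
  "unit_vec i = Poly_Mapping.single i 1"

definition hexagon :: "rvec set" where
  "hexagon = convex hull
     {unit_vec 0, - unit_vec 0, unit_vec 1, - unit_vec 1,
      unit_vec 0 - unit_vec 1, - (unit_vec 0 - unit_vec 1)}"

type_synonym toric = "nat \<times> rvec set"

definition toric_dim :: "toric \<Rightarrow> nat" where
  "toric_dim X = fst X"

definition fano_polytope_of :: "toric \<Rightarrow> rvec set" where
  "fano_polytope_of X = snd X"

definition toric_fano :: "toric \<Rightarrow> bool" where
  "toric_fano X \<longleftrightarrow> smooth_fano_polytope (toric_dim X) (fano_polytope_of X)"

definition toric_isomorphic :: "toric \<Rightarrow> toric \<Rightarrow> bool" where
  "toric_isomorphic X Y \<longleftrightarrow> toric_dim X = toric_dim Y \<and>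
     lattice_equivalent (toric_dim X) (fano_polytope_of X) (fano_polytope_of Y)"

definition toric_fano_iso_rel :: "(toric \<times> toric) set" where
  "toric_fano_iso_rel = {(X, Y). toric_fano X \<and> toric_fano Y \<and> toric_isomorphic X Y}"

text \<open>
  The rays of the fan are spanned by the vertices. In positive dimension the origin is interior and
  hence no vertex; removing it matters only for \<open>d = 0\<close>, where the fan has no rays and the Picard
  number of the point is \<open>0\<close>.
\<close>

definition picard_number :: "toric \<Rightarrow> int" where
  "picard_number X = int (card (vertices (fano_polytope_of X) - {0})) - int (toric_dim X)"

definition toric_product :: "toric \<Rightarrow> toric \<Rightarrow> toric" where
  "toric_product X Y =
     (toric_dim X + toric_dim Y, direct_sum (toric_dim X) (fano_polytope_of X) (fano_polytope_of Y))"

definition S3 :: toric where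
  "S3 = (2, hexagon)"

definition S3_splittable :: "toric \<Rightarrow> bool" where
  "S3_splittable X \<longleftrightarrow> (\<exists>Y. toric_fano Y \<and> toric_dim Y < toric_dim X \<and> toric_isomorphic X (toric_product S3 Y))"

lemma lookup_scaleR_vec: "Poly_Mapping.lookup (r *\<^sub>R (x :: rvec)) i = r * Poly_Mapping.lookup x i"
  by (simp add: scaleR_poly_mapping_def)

lemma lookup_zero_outside: "x \<in> coord_space d \<Longrightarrow> i \<ge> d \<Longrightarrow> Poly_Mapping.lookup x i = 0"
  by (fastforce simp: coord_space_def in_keys_iff)

lemma coord_expand:
  assumes "x \<in> coord_space d"
  shows "x = (\<Sum>i<d. Poly_Mapping.lookup x i *\<^sub>R unit_vec i)"
proof (rule poly_mapping_eqI)
  fix j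
  have "Poly_Mapping.lookup (\<Sum>i<d. Poly_Mapping.lookup x i *\<^sub>R unit_vec i) j
      = (\<Sum>i<d. if i = j then Poly_Mapping.lookup x i else 0)"
    unfolding lookup_sum
    by (intro sum.cong) (auto simp: lookup_scaleR_vec unit_vec_def lookup_single when_def)
  then show "Poly_Mapping.lookup x j = Poly_Mapping.lookup (\<Sum>i<d. Poly_Mapping.lookup x i *\<^sub>R unit_vec i) j"
    using lookup_zero_outside[OF assms, of j] by simp
qed

lemma unit_vec_in_lattice: "i < d \<Longrightarrow> unit_vec i \<in> int_lattice d"
  by (auto simp: int_lattice_def coord_space_def unit_vec_def lookup_single when_def)

lemma int_lattice_add: "x \<in> int_lattice d \<Longrightarrow> y \<in> int_lattice d \<Longrightarrow> x + y \<in> int_lattice d"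
  using keys_add[of x y] by (auto simp: int_lattice_def coord_space_def lookup_add)

lemma int_lattice_scale: "x \<in> int_lattice d \<Longrightarrow> r \<in> \<int> \<Longrightarrow> r *\<^sub>R x \<in> int_lattice d"
  by (auto simp: int_lattice_def coord_space_def lookup_scaleR_vec in_keys_iff subset_iff)

lemma int_lattice_zero: "0 \<in> int_lattice d"
  by (simp add: int_lattice_def coord_space_def)

lemma int_lattice_sum: "(\<And>i. i \<in> A \<Longrightarrow> f i \<in> int_lattice d) \<Longrightarrow> sum f A \<in> int_lattice d"
  by (induction A rule: infinite_finite_induct) (auto simp: int_lattice_zero int_lattice_add)

lemma subspace_coord_space: "subspace (coord_space d)"
proof (rule subspaceI)
  fix x y :: rvec and c :: real
  show "(0 :: rvec) \<in> coord_space d"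
    by (simp add: coord_space_def)
  assume x: "x \<in> coord_space d"
  then show "c *\<^sub>R x \<in> coord_space d"
    by (auto simp: coord_space_def lookup_scaleR_vec in_keys_iff subset_iff)
  assume "y \<in> coord_space d"
  with x show "x + y \<in> coord_space d"
    using keys_add[of x y] by (auto simp: coord_space_def)
qed

lemma lattice_polytope_subset: "lattice_polytope d P \<Longrightarrow> P \<subseteq> coord_space d"
  unfolding lattice_polytope_def
  by (metis (no_types, lifting) hull_minimal int_lattice_def mem_Collect_eq subset_iff
      subspace_coord_space subspace_imp_convex)

lemma lattice_equivalent_sym:
  assumes "lattice_equivalent d P Q" "P \<subseteq> coord_space d"
  shows "lattice_equivalent d Q P"
proof -
  obtain f where f: "linear f" and bij: "bij_betw f (int_lattice d) (int_lattice d)" and PQ: "f ` P = Q"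
    using assms(1) by (auto simp: lattice_equivalent_def)
  interpret f: linear f by (fact f)
  define h where "h i = inv_into (int_lattice d) f (unit_vec i)" for i
  have h: "h i \<in> int_lattice d" "f (h i) = unit_vec i" if "i < d" for i
    using unit_vec_in_lattice[OF that] bij unfolding h_def bij_betw_def
    by (metis inv_into_into, metis f_inv_into_f)
  define g where "g x = (\<Sum>i<d. Poly_Mapping.lookup x i *\<^sub>R h i)" for x :: rvec
  have g: "linear g"
    by (rule linearI)
      (simp_all add: g_def lookup_add lookup_scaleR_vec scaleR_left_distrib sum.distrib scaleR_sum_right)
  interpret g: linear g by (fact g)
  have g_lat: "g x \<in> int_lattice d" if "x \<in> int_lattice d" for x
    unfolding g_def using that
    by (intro int_lattice_sum int_lattice_scale h) (auto simp: int_lattice_def)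
  have fg: "f (g x) = x" if "x \<in> coord_space d" for x
  proof -
    have "f (g x) = (\<Sum>i<d. Poly_Mapping.lookup x i *\<^sub>R unit_vec i)"
      unfolding g_def f.sum f.scaleR by (intro sum.cong) (simp_all add: h)
    then show ?thesis using coord_expand[OF that] by simp
  qed
  have lat_sub: "int_lattice d \<subseteq> coord_space d"
    by (auto simp: int_lattice_def)
  have gf_lat: "g (f x) = x" if "x \<in> int_lattice d" for x
  proof -
    have fx: "f x \<in> int_lattice d" using bij that by (auto simp: bij_betw_def)
    have "f (g (f x)) = f x" using fg fx lat_sub by blast
    with bij that g_lat[OF fx] show ?thesis by (auto simp: bij_betw_def inj_on_def)
  qed
  have gf: "g (f x) = x" if "x \<in> coord_space d" for x
  proof -
    have "g (f x) = (\<Sum>i<d. Poly_Mapping.lookup x i *\<^sub>R g (f (unit_vec i)))"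
      by (subst coord_expand[OF that]) (simp only: f.sum f.scaleR g.sum g.scaleR)
    also have "\<dots> = x"
      using coord_expand[OF that] by (simp add: gf_lat unit_vec_in_lattice)
    finally show ?thesis .
  qed
  have "bij_betw g (int_lattice d) (int_lattice d)"
    by (rule bij_betw_byWitness[where f' = f])
      (use gf_lat fg lat_sub g_lat bij in \<open>auto simp: bij_betw_def\<close>)
  moreover have "g ` Q = P"
    using gf assms(2) unfolding PQ[symmetric] image_image by force
  ultimately show ?thesis using g by (auto simp: lattice_equivalent_def)
qed

lemma lattice_equivalent_trans:
  assumes "lattice_equivalent d P Q" "lattice_equivalent d Q R"
  shows "lattice_equivalent d P R"
proof -
  obtain f g where "linear f" "bij_betw f (int_lattice d) (int_lattice d)" "f ` P = Q"
    "linear g" "bij_betw g (int_lattice d) (int_lattice d)" "g ` Q = R"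
    using assms by (auto simp: lattice_equivalent_def)
  then have "linear (g \<circ> f)" "bij_betw (g \<circ> f) (int_lattice d) (int_lattice d)" "(g \<circ> f) ` P = R"
    by (auto intro: linear_compose bij_betw_trans)
  then show ?thesis unfolding lattice_equivalent_def by blast
qed

lemma lattice_equivalent_refl: "lattice_equivalent d P P"
  unfolding lattice_equivalent_def by (rule exI[of _ "\<lambda>x. x"]) (auto simp: bij_betw_def intro: linearI)

lemma equiv_toric_fano_iso_rel: "equiv {X. toric_fano X} toric_fano_iso_rel"
proof (rule equivI)
  show "toric_fano_iso_rel \<subseteq> {X. toric_fano X} \<times> {X. toric_fano X}"
    by (auto simp: toric_fano_iso_rel_def)
  show "refl_on {X. toric_fano X} toric_fano_iso_rel"
    by (auto simp: refl_on_def toric_fano_iso_rel_def toric_isomorphic_def lattice_equivalent_refl)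
  show "sym toric_fano_iso_rel"
    by (rule symI) (auto simp: toric_fano_iso_rel_def toric_isomorphic_def toric_fano_def
        smooth_fano_polytope_def intro: lattice_equivalent_sym[OF _ lattice_polytope_subset])
  show "trans toric_fano_iso_rel"
    by (rule transI) (auto simp: toric_fano_iso_rel_def toric_isomorphic_def
        intro: lattice_equivalent_trans)
qed

end

theory Submission
  imports Defs
begin

text \<open>
  Let \<open>V\<close> be the set of vertices and \<open>s\<close> their sum. Call a facet special if \<open>s\<close> lies in the cone over
  it; the facet maximising its supporting functional at \<open>s\<close> is special. The functional of a special
  facet \<open>B\<close> sorts \<open>V\<close> into levels \<open>1, 0, -1, \<dots>\<close>. Level \<open>1\<close> is \<open>B\<close>, level \<open>0\<close> has at most \<open>d\<close>
  elements, and the levels add up to a nonnegative number. Hence \<open>|V| \<ge> 3d - k\<close> forces all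
  but boundedly many vertices onto the levels \<open>1, 0, -1\<close>, with about \<open>d\<close> on each. In the coordinates
  of the lattice basis \<open>B\<close> nearly all vertices of level \<open>0\<close> have the form \<open>b' - b\<close>, where \<open>b'\<close> is
  determined by \<open>b\<close>. The remaining vertices have bounded support, so they avoid nearly all coordinates.

  Replacing \<open>b\<close> by \<open>b' - b\<close> for many \<open>b\<close> at once gives another special facet, whose level \<open>0\<close> again
  obeys the same bounds. If \<open>B\<close> has the largest level \<open>0\<close> among all special facets, comparing the two
  shows that nearly all vertices of level \<open>-1\<close> have the form \<open>-b\<close>. Counting then yields, for \<open>d\<close> large
  in terms of \<open>k\<close>, a pair \<open>i, j \<in> B\<close> such that \<open>\<plusminus>i, \<plusminus>j, \<plusminus>(i - j)\<close> are vertices and all other vertices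
  have zero \<open>i\<close>- and \<open>j\<close>-coordinates: a hexagon splits off. So \<open>d\<close> is bounded, and for each \<open>d\<close> the
  coordinates with respect to a special facet are bounded.
\<close>

text \<open>Two facts feed the combinatorics. As 0 is interior, a facet can be tilted over any ridge
  to a neighbour; as both are lattice bases, the exchange coefficient is -1. The obstacle is that
  estimates for single flips cannot be summed: each may leave up to 2k uncontrolled vertices of
  level -1, and there are about d flips. Flipping a whole set I at once leaves only 2k in total, but
  needs that no b in I has its partner b' in I. The partner map is a functional graph, so three
  colours split the elements with a clean partner into such sets; those with a dirty partner form a
  fourth. Maximality of level 0 excludes positive coordinates on level -1, since a flip there would
  enlarge level 0. The pair i, j comes from a double count: the vertices of level -1 with coordinate
  -1 at i are as many as the b with partner i, and these numbers sum to at most d. Nearly all of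
  them are at least 1, hence nearly all equal 1.\<close>

section \<open>Lattice bases and facets\<close>

text \<open>Meaningful only for lattice points \<open>x\<close> and for arguments in the lattice basis \<open>B\<close>.\<close>

definition icoord :: "rvec set \<Rightarrow> rvec \<Rightarrow> rvec \<Rightarrow> int" where
  "icoord B x = (THE c. c \<in> B \<rightarrow>\<^sub>E UNIV \<and> x = (\<Sum>b\<in>B. of_int (c b) *\<^sub>R b))"

text \<open>The functional that is 1 on \<open>B\<close>. If \<open>B\<close> is the vertex set of a
  facet, it is the supporting functional of that facet, with integer values on the lattice.\<close>

definition level :: "rvec set \<Rightarrow> rvec \<Rightarrow> int" where
  "level B x = (\<Sum>b\<in>B. icoord B x b)"

lemma int_lattice_diff: "x \<in> int_lattice d \<Longrightarrow> y \<in> int_lattice d \<Longrightarrow> x - y \<in> int_lattice d"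
  using int_lattice_add[OF _ int_lattice_scale[of y d "-1"], of x] by simp

lemma int_lattice_coord_space: "int_lattice d \<subseteq> coord_space d"
  by (auto simp: int_lattice_def)

context
  fixes d :: nat and B :: "rvec set"
  assumes B: "lattice_basis d B"
begin

lemma lattice_basis_finite: "finite B"
  and lattice_basis_lattice: "B \<subseteq> int_lattice d"
  using B by (auto simp: lattice_basis_def)

lemma icoord_rep:
  assumes "x \<in> int_lattice d"
  shows "x = (\<Sum>b\<in>B. of_int (icoord B x b) *\<^sub>R b)"
proof -
  have "\<exists>!c. c \<in> B \<rightarrow>\<^sub>E (UNIV :: int set) \<and> x = (\<Sum>b\<in>B. of_int (c b) *\<^sub>R b)"
    using B assms by (simp add: lattice_basis_def)
  from theI'[OF this] show ?thesis unfolding icoord_def by blast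
qed

lemma icoord_unique:
  assumes "x = (\<Sum>b\<in>B. of_int (c b) *\<^sub>R b)" "b \<in> B"
  shows "icoord B x b = c b"
proof -
  have x: "x \<in> int_lattice d"
    unfolding assms(1) using lattice_basis_lattice
    by (intro int_lattice_sum int_lattice_scale) auto
  have ex1: "\<exists>!c. c \<in> B \<rightarrow>\<^sub>E (UNIV :: int set) \<and> x = (\<Sum>b\<in>B. of_int (c b) *\<^sub>R b)"
    using B x by (simp add: lattice_basis_def)
  have "(\<Sum>b\<in>B. of_int (restrict c B b) *\<^sub>R b) = x"
    unfolding assms(1) by (intro sum.cong) auto
  then have "icoord B x = restrict c B"
    unfolding icoord_def by (intro the1_equality[OF ex1]) auto
  then show ?thesis using assms(2) by simp
qed

lemma icoord_add:
  assumes "x \<in> int_lattice d" "y \<in> int_lattice d" "b \<in> B"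
  shows "icoord B (x + y) b = icoord B x b + icoord B y b"
proof (rule icoord_unique[OF _ assms(3)])
  show "x + y = (\<Sum>b\<in>B. of_int (icoord B x b + icoord B y b) *\<^sub>R b)"
    by (subst icoord_rep[OF assms(1)], subst icoord_rep[OF assms(2)])
      (simp add: scaleR_left_distrib sum.distrib)
qed

lemma icoord_diff:
  assumes "x \<in> int_lattice d" "y \<in> int_lattice d" "b \<in> B"
  shows "icoord B (x - y) b = icoord B x b - icoord B y b"
  using icoord_add[OF int_lattice_diff[OF assms(1,2)] assms(2,3)] by simp

lemma icoord_zero: "b \<in> B \<Longrightarrow> icoord B 0 b = 0"
  using icoord_diff[OF int_lattice_zero int_lattice_zero] by simp

lemma icoord_uminus:
  assumes "x \<in> int_lattice d" "b \<in> B"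
  shows "icoord B (- x) b = - icoord B x b"
  using icoord_diff[OF int_lattice_zero assms] assms icoord_zero by simp

lemma icoord_sum:
  assumes "\<And>i. i \<in> A \<Longrightarrow> f i \<in> int_lattice d" "b \<in> B"
  shows "icoord B (sum f A) b = (\<Sum>i\<in>A. icoord B (f i) b)"
  using assms
  by (induction A rule: infinite_finite_induct) (auto simp: icoord_zero icoord_add int_lattice_sum)

lemma icoord_basis:
  assumes "b \<in> B" "b' \<in> B"
  shows "icoord B b b' = (if b = b' then 1 else 0)"
proof (rule icoord_unique[OF _ assms(2)])
  have "(\<Sum>b'\<in>B. of_int (if b = b' then 1 else 0) *\<^sub>R b') = (\<Sum>b'\<in>B. if b = b' then b' else 0)"
    by (intro sum.cong) auto
  then show "b = (\<Sum>b'\<in>B. of_int (if b = b' then 1 else 0) *\<^sub>R b')"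
    using assms lattice_basis_finite by simp
qed

lemma icoord_eqI:
  assumes "x \<in> int_lattice d" "y \<in> int_lattice d" "\<And>b. b \<in> B \<Longrightarrow> icoord B x b = icoord B y b"
  shows "x = y"
  by (subst icoord_rep[OF assms(1)], subst icoord_rep[OF assms(2)]) (simp add: assms(3))

lemma level_diff:
  assumes "x \<in> int_lattice d" "y \<in> int_lattice d"
  shows "level B (x - y) = level B x - level B y"
  unfolding level_def sum_subtractf[symmetric] by (intro sum.cong icoord_diff assms refl)

lemma level_uminus: "x \<in> int_lattice d \<Longrightarrow> level B (- x) = - level B x"
  unfolding level_def sum_negf[symmetric] by (intro sum.cong icoord_uminus refl)

lemma level_sum:
  assumes "\<And>i. i \<in> A \<Longrightarrow> f i \<in> int_lattice d"
  shows "level B (sum f A) = (\<Sum>i\<in>A. level B (f i))"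
  unfolding level_def by (simp add: icoord_sum assms sum.swap[of _ B])

lemma level_basis: "b \<in> B \<Longrightarrow> level B b = 1"
  unfolding level_def using lattice_basis_finite by (simp add: icoord_basis)

lemma linear_icoord:
  assumes "linear (u :: rvec \<Rightarrow> 'a :: real_vector)" "x \<in> int_lattice d"
  shows "u x = (\<Sum>b\<in>B. of_int (icoord B x b) *\<^sub>R u b)"
proof -
  interpret u: linear u by fact
  show ?thesis by (subst icoord_rep[OF assms(2)]) (simp add: u.sum u.scaleR)
qed

lemma linear_level:
  assumes "linear (u :: rvec \<Rightarrow> real)" "\<And>b. b \<in> B \<Longrightarrow> u b = 1" "x \<in> int_lattice d"
  shows "u x = of_int (level B x)"
  by (subst linear_icoord[OF assms(1,3)]) (simp add: assms(2) level_def)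

lemma lattice_basis_span: "span B = coord_space d"
proof
  show "span B \<subseteq> coord_space d"
    using lattice_basis_lattice int_lattice_coord_space
    by (intro span_minimal subspace_coord_space) auto
  have unit: "unit_vec i \<in> span B" if "i < d" for i
    by (subst icoord_rep[OF unit_vec_in_lattice[OF that]])
      (intro span_sum span_scale span_base)
  show "coord_space d \<subseteq> span B"
  proof
    fix x assume "x \<in> coord_space d"
    then show "x \<in> span B"
      by (subst coord_expand) (auto intro!: span_sum span_scale unit)
  qed
qed

text \<open>\<open>lattice_basis\<close> speaks of integer combinations only. The integer coordinate
  at \<open>b'\<close> extends to a real functional through its values \<open>c i\<close> on the
  unit vectors; it is 1 at \<open>b'\<close> and 0 on the rest of \<open>B\<close>, so it isolates
  \<open>r b'\<close> in a vanishing real combination.\<close>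

lemma lattice_basis_independent: "independent B"
proof (rule independent_if_scalars_zero[OF lattice_basis_finite])
  fix r b' assume r: "(\<Sum>b\<in>B. r b *\<^sub>R b) = 0" and b': "b' \<in> B"
  define c where "c i = icoord B (unit_vec i) b'" for i
  have key: "(\<Sum>i<d. Poly_Mapping.lookup b i * of_int (c i)) = (if b = b' then 1 else 0)"
    if "b \<in> B" for b
  proof -
    have lat: "b \<in> int_lattice d" using that lattice_basis_lattice by auto
    have fl: "of_int \<lfloor>Poly_Mapping.lookup b i\<rfloor> = Poly_Mapping.lookup b i" for i
      using lat by (auto simp: int_lattice_def elim: Ints_cases)
    have "b = (\<Sum>i<d. of_int \<lfloor>Poly_Mapping.lookup b i\<rfloor> *\<^sub>R unit_vec i)"
      using coord_expand[of b d] lat int_lattice_coord_space by (auto simp: fl)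
    also have "\<dots> = (\<Sum>i<d. \<Sum>j\<in>B. of_int (\<lfloor>Poly_Mapping.lookup b i\<rfloor> * icoord B (unit_vec i) j) *\<^sub>R j)"
      by (intro sum.cong refl, subst icoord_rep[OF unit_vec_in_lattice])
        (simp_all add: scaleR_sum_right)
    also have "\<dots> = (\<Sum>j\<in>B. of_int (\<Sum>i<d. \<lfloor>Poly_Mapping.lookup b i\<rfloor> * icoord B (unit_vec i) j) *\<^sub>R j)"
      by (subst sum.swap) (simp add: scaleR_sum_left)
    finally have "icoord B b b' = (\<Sum>i<d. \<lfloor>Poly_Mapping.lookup b i\<rfloor> * c i)"
      unfolding c_def by (intro icoord_unique b')
    then have "(if b = b' then 1 else 0) = (\<Sum>i<d. \<lfloor>Poly_Mapping.lookup b i\<rfloor> * c i)"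
      using icoord_basis[OF that b'] by simp
    then have "real_of_int (if b = b' then 1 else 0) = of_int (\<Sum>i<d. \<lfloor>Poly_Mapping.lookup b i\<rfloor> * c i)"
      by simp
    then show ?thesis by (auto simp: fl)
  qed
  have "(\<Sum>b\<in>B. r b * Poly_Mapping.lookup b i) = 0" for i
    using arg_cong[OF r, of "\<lambda>x. Poly_Mapping.lookup x i"] by (simp add: lookup_sum lookup_scaleR_vec)
  then have "0 = (\<Sum>i<d. (\<Sum>b\<in>B. r b * Poly_Mapping.lookup b i) * of_int (c i))"
    by simp
  also have "\<dots> = (\<Sum>b\<in>B. r b * (\<Sum>i<d. Poly_Mapping.lookup b i * of_int (c i)))"
    by (simp add: sum_distrib_left sum_distrib_right sum.swap[of _ B] mult.assoc)
  also have "\<dots> = (\<Sum>b\<in>B. if b = b' then r b else 0)"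
    by (intro sum.cong) (auto simp: key)
  also have "\<dots> = r b'" using b' lattice_basis_finite by simp
  finally show "r b' = 0" by simp
qed

end

section \<open>The standard basis and the size of lattice bases\<close>

lemma inj_on_unit_vec: "inj_on unit_vec A"
  by (rule inj_onI) (metis unit_vec_def lookup_single_eq lookup_single_not_eq zero_neq_one)

lemma lattice_basis_unit_vec: "lattice_basis d (unit_vec ` {..<d})"
proof -
  note inj = inj_on_unit_vec[of "{..<d}"]
  have "\<exists>!c. c \<in> unit_vec ` {..<d} \<rightarrow>\<^sub>E (UNIV :: int set) \<and> x = (\<Sum>b\<in>unit_vec ` {..<d}. of_int (c b) *\<^sub>R b)"
    if x: "x \<in> int_lattice d" for x
  proof -
    have eval: "Poly_Mapping.lookup (\<Sum>b\<in>unit_vec ` {..<d}. of_int (c b) *\<^sub>R b) i = of_int (c (unit_vec i))"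
      if "i < d" for c :: "rvec \<Rightarrow> int" and i
    proof -
      have "Poly_Mapping.lookup (\<Sum>b\<in>unit_vec ` {..<d}. of_int (c b) *\<^sub>R b) i
          = (\<Sum>j<d. if i = j then of_int (c (unit_vec i)) else 0)"
        unfolding lookup_sum sum.reindex[OF inj]
        by (intro sum.cong) (auto simp: lookup_scaleR_vec unit_vec_def lookup_single when_def)
      then show ?thesis using that by simp
    qed
    define c where "c = restrict (\<lambda>b. \<lfloor>Poly_Mapping.lookup x (inv_into {..<d} unit_vec b)\<rfloor>) (unit_vec ` {..<d})"
    have c: "of_int (c (unit_vec i)) = Poly_Mapping.lookup x i" if "i < d" for i
      using that inj x by (auto simp: c_def int_lattice_def elim: Ints_cases)
    have "(\<Sum>b\<in>unit_vec ` {..<d}. of_int (c b) *\<^sub>R b) = (\<Sum>i<d. Poly_Mapping.lookup x i *\<^sub>R unit_vec i)"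
      unfolding sum.reindex[OF inj] by (intro sum.cong) (auto simp: c)
    then have eq: "x = (\<Sum>b\<in>unit_vec ` {..<d}. of_int (c b) *\<^sub>R b)"
      using coord_expand x int_lattice_coord_space by (metis subsetD)
    show ?thesis
    proof (rule ex1I[of _ c])
      show "c \<in> unit_vec ` {..<d} \<rightarrow>\<^sub>E UNIV \<and> x = (\<Sum>b\<in>unit_vec ` {..<d}. of_int (c b) *\<^sub>R b)"
        using eq by (auto simp: c_def)
      fix c' assume c': "c' \<in> unit_vec ` {..<d} \<rightarrow>\<^sub>E UNIV \<and> x = (\<Sum>b\<in>unit_vec ` {..<d}. of_int (c' b) *\<^sub>R b)"
      show "c' = c"
      proof (rule PiE_ext[of _ "unit_vec ` {..<d}" "\<lambda>_. UNIV"])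
        show "c' \<in> unit_vec ` {..<d} \<rightarrow>\<^sub>E UNIV" "c \<in> unit_vec ` {..<d} \<rightarrow>\<^sub>E UNIV"
          using c' by (auto simp: c_def)
        fix b assume "b \<in> unit_vec ` {..<d}"
        then obtain i where i: "i < d" "b = unit_vec i" by auto
        have "real_of_int (c' b) = of_int (c b)"
          using eval[OF i(1), of c'] c[OF i(1)] c' i by simp
        then show "c' b = c b" by simp
      qed
    qed
  qed
  then show ?thesis
    unfolding lattice_basis_def using unit_vec_in_lattice by auto
qed

lemma dim_coord_space: "dim (coord_space d) = d"
  using lattice_basis_span[OF lattice_basis_unit_vec[of d]]
    dim_span_eq_card_independent[OF lattice_basis_independent[OF lattice_basis_unit_vec[of d]]]
  by (simp add: card_image inj_on_unit_vec)

lemma lattice_basis_card: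
  assumes "lattice_basis d B" shows "card B = d"
  using lattice_basis_span[OF assms] dim_coord_space[of d]
    dim_span_eq_card_independent[OF lattice_basis_independent[OF assms]] by simp

text \<open>As \<open>n\<close> has coefficient -1 at \<open>b\<close>, the vector \<open>b\<close>
  is \<open>- n\<close> plus an integer combination of the rest of \<open>B\<close>; substituting
  this into an expansion over \<open>B\<close> gives the new coordinates.\<close>

lemma flip_coords:
  assumes B: "lattice_basis d B" and B': "lattice_basis d (insert n (B - {b}))"
    and b: "b \<in> B" and n: "n \<notin> B - {b}" "icoord B n b = -1" and x: "x \<in> int_lattice d"
  shows icoord_flip_new: "icoord (insert n (B - {b})) x n = - icoord B x b"
    and icoord_flip: "\<And>j. j \<in> B - {b} \<Longrightarrow>
        icoord (insert n (B - {b})) x j = icoord B x j + icoord B x b * icoord B n j"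
    and level_flip: "level (insert n (B - {b})) x = level B x + icoord B x b * (level B n - 1)"
proof -
  note fin = lattice_basis_finite[OF B]
  have nl: "n \<in> int_lattice d" using lattice_basis_lattice[OF B'] by auto
  define c where "c j = (if j = n then - icoord B x b else icoord B x j + icoord B x b * icoord B n j)" for j
  have "n = of_int (icoord B n b) *\<^sub>R b + (\<Sum>j\<in>B - {b}. of_int (icoord B n j) *\<^sub>R j)"
    by (subst icoord_rep[OF B nl], subst sum.remove[OF fin b]) simp
  then have beq: "b = - n + (\<Sum>j\<in>B - {b}. of_int (icoord B n j) *\<^sub>R j)"
    using n(2) by (simp add: algebra_simps)
  have "x = of_int (icoord B x b) *\<^sub>R b + (\<Sum>j\<in>B - {b}. of_int (icoord B x j) *\<^sub>R j)"
    by (subst icoord_rep[OF B x], subst sum.remove[OF fin b]) simp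
  also have "\<dots> = of_int (- icoord B x b) *\<^sub>R n + (\<Sum>j\<in>B - {b}. of_int (icoord B x j + icoord B x b * icoord B n j) *\<^sub>R j)"
    by (subst (2) beq) (simp add: scaleR_right_diff_distrib scaleR_right_distrib scaleR_sum_right scaleR_left_distrib sum.distrib)
  also have "\<dots> = of_int (c n) *\<^sub>R n + (\<Sum>j\<in>B - {b}. of_int (c j) *\<^sub>R j)"
    using n(1) by (intro arg_cong2[of _ _ _ _ "(+)"] sum.cong) (auto simp: c_def)
  also have "\<dots> = (\<Sum>j\<in>insert n (B - {b}). of_int (c j) *\<^sub>R j)"
    using fin n(1) by simp
  finally have ic: "icoord (insert n (B - {b})) x j = c j" if "j \<in> insert n (B - {b})" for j
    using icoord_unique[OF B' _ that] by blast
  show "icoord (insert n (B - {b})) x n = - icoord B x b"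
    using ic[of n] by (simp add: c_def)
  show icj: "icoord (insert n (B - {b})) x j = icoord B x j + icoord B x b * icoord B n j"
    if "j \<in> B - {b}" for j
    using ic[of j] that n(1) by (auto simp: c_def)
  have "level (insert n (B - {b})) x = - icoord B x b + (\<Sum>j\<in>B - {b}. icoord B x j + icoord B x b * icoord B n j)"
    unfolding level_def using fin n(1) ic[of n] by (simp add: icj c_def)
  also have "\<dots> = - icoord B x b + (level B x - icoord B x b) + icoord B x b * (level B n - icoord B n b)"
    unfolding level_def using fin b by (simp add: sum.distrib sum_distrib_left[symmetric] sum_diff1)
  finally show "level (insert n (B - {b})) x = level B x + icoord B x b * (level B n - 1)"
    using n(2) by (simp add: algebra_simps)
qed

text \<open>The ratio test of the simplex method: \<open>t\<close> grows until the first inequality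
  with \<open>f v > 0\<close> becomes tight. The smallest ratio is nonnegative because all
  inequalities hold at \<open>t = 0\<close>.\<close>

lemma pivot:
  fixes u f :: "'a \<Rightarrow> real"
  assumes "finite V" "\<And>v. v \<in> V \<Longrightarrow> u v \<le> 1" "\<exists>v\<in>V. f v > 0"
  shows "\<exists>t\<ge>0. (\<forall>v\<in>V. u v + t * f v \<le> 1) \<and> (\<exists>v\<in>V. f v > 0 \<and> u v + t * f v = 1)"
proof -
  define g where "g v = (1 - u v) / f v" for v
  define W where "W = {v\<in>V. f v > 0}"
  have W: "finite W" "W \<noteq> {}" using assms by (auto simp: W_def)
  obtain w where w: "w \<in> W" "g w = Min (g ` W)"
    using Min_in[of "g ` W"] W by fastforce
  have min: "g w \<le> g v" if "v \<in> W" for v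
    using w W that by simp
  have g0: "g w \<ge> 0" using w(1) assms(2) by (simp add: g_def W_def)
  have le: "u v + g w * f v \<le> 1" if v: "v \<in> V" for v
  proof (cases "f v > 0")
    case True
    then have "g w * f v \<le> g v * f v" using min[of v] v by (simp add: W_def)
    then show ?thesis using True by (simp add: g_def)
  next
    case False
    then have "g w * f v \<le> 0" using g0 by (simp add: mult_nonneg_nonpos)
    then show ?thesis using assms(2)[OF v] by simp
  qed
  have "u w + g w * f w = 1" using w(1) by (simp add: g_def W_def)
  then show ?thesis using g0 le w by (auto simp: W_def)
qed

text \<open>The polytope seen through linear functionals only: \<open>positive\<close> expresses
  that 0 is interior, \<open>smooth\<close> is the condition on the facet where \<open>f\<close> is
  1. The point is excluded because its polytope has 0 as a vertex.\<close>

locale fano_vertices =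
  fixes d :: nat and V :: "rvec set"
  assumes dpos: "d > 0"
    and finite_V: "finite V"
    and V_lattice: "V \<subseteq> int_lattice d"
    and zero_notin: "0 \<notin> V"
    and positive: "\<And>f :: rvec \<Rightarrow> real. linear f \<Longrightarrow> \<exists>x\<in>coord_space d. f x \<noteq> 0 \<Longrightarrow> \<exists>v\<in>V. f v > 0"
    and smooth: "\<And>f :: rvec \<Rightarrow> real. linear f \<Longrightarrow> (\<And>v. v \<in> V \<Longrightarrow> f v \<le> 1) \<Longrightarrow>
        coord_space d \<subseteq> span {v\<in>V. f v = 1} \<Longrightarrow> lattice_basis d {v\<in>V. f v = 1}"
begin

text \<open>A facet is represented by its vertex set, with \<open>level B\<close> as supporting
  functional, so that faces of convex sets do not occur in the combinatorial part.\<close>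

definition facet :: "rvec set \<Rightarrow> bool" where
  "facet B \<longleftrightarrow> lattice_basis d B \<and> B \<subseteq> V \<and> (\<forall>v\<in>V. level B v \<le> 1 \<and> (level B v = 1 \<longrightarrow> v \<in> B))"

lemma facetI:
  fixes f :: "rvec \<Rightarrow> real"
  assumes "linear f" "\<And>v. v \<in> V \<Longrightarrow> f v \<le> 1" "coord_space d \<subseteq> span {v\<in>V. f v = 1}"
  shows "facet {v\<in>V. f v = 1}"
proof -
  have lb: "lattice_basis d {v\<in>V. f v = 1}" by (rule smooth[OF assms])
  have "f v = of_int (level {v\<in>V. f v = 1} v)" if "v \<in> V" for v
    using linear_level[OF lb assms(1)] that V_lattice by auto
  then show ?thesis unfolding facet_def using lb assms(2) by fastforce
qed

text \<open>A supporting functional with the largest number of tight vertices is tight on a spanning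
  set. Otherwise some functional vanishes on the tight vertices but not on the whole space, and
  adding a multiple of it makes one more vertex tight.\<close>

lemma facet_exists: "\<exists>B. facet B"
proof -
  define good where "good f \<longleftrightarrow> linear f \<and> (\<forall>v\<in>V. f v \<le> 1)" for f :: "rvec \<Rightarrow> real"
  define N where "N f = card {v\<in>V. f v = 1}" for f :: "rvec \<Rightarrow> real"
  have "good (\<lambda>_. 0)" by (simp add: good_def linear_zero)
  moreover have "\<forall>f. good f \<longrightarrow> N f < Suc (card V)"
    using finite_V by (auto simp: N_def less_Suc_eq_le intro: card_mono)
  ultimately have "\<exists>f. good f \<and> (\<forall>g. good g \<longrightarrow> N g \<le> N f)"
    by (rule ex_has_greatest_nat)
  then obtain f where f: "good f" and max: "\<And>g. good g \<Longrightarrow> N g \<le> N f" by blast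
  define W where "W = {v\<in>V. f v = 1}"
  have "coord_space d \<subseteq> span W"
  proof (rule ccontr)
    assume "\<not> ?thesis"
    then obtain w where w: "w \<in> coord_space d" "w \<notin> span W" by auto
    obtain C where C: "C \<subseteq> W" "independent C" "span C = span W"
      using maximal_independent_subset[of W] by (metis span_eq_iff span_mono subspace_span subset_antisym)
    have ind: "independent (insert w C)"
      using C w by (simp add: independent_insertI)
    obtain h :: "rvec \<Rightarrow> real" where h: "linear h" "\<forall>x\<in>insert w C. h x = (if x = w then 1 else 0)"
      using linear_independent_extend[OF ind, of "\<lambda>x. if x = w then 1 else (0 :: real)"] by auto
    have h0: "h x = 0" if "x \<in> C" for x
      using h(2) that C(1) w(2) span_base by auto
    have "h x = 0" if "x \<in> span C" for x
      by (rule linear_eq_0_on_span[OF h(1) h0 that])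
    then have hW: "h x = 0" if "x \<in> W" for x using span_base[OF that] C(3) by simp
    have "\<exists>x\<in>coord_space d. h x \<noteq> 0" using h(2) w(1) by (intro bexI[of _ w]) auto
    then have "\<exists>v\<in>V. h v > 0" by (rule positive[OF h(1)])
    then obtain t v where t: "t \<ge> 0" "\<And>v. v \<in> V \<Longrightarrow> f v + t * h v \<le> 1" and v: "v \<in> V" "h v > 0" "f v + t * h v = 1"
      using pivot[OF finite_V, of f h] f by (auto simp: good_def)
    have "linear (\<lambda>x. t * h x)"
      using linear_compose_scale_right[OF h(1), of t] by simp
    then have "good (\<lambda>x. f x + t * h x)"
      using t f by (auto simp: good_def intro: linear_compose_add)
    moreover have "insert v W \<subseteq> {v\<in>V. f v + t * h v = 1}" using hW v by (auto simp: W_def)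
    then have "card (insert v W) \<le> N (\<lambda>x. f x + t * h x)"
      unfolding N_def using finite_V by (intro card_mono) auto
    moreover have "card (insert v W) = Suc (N f)"
    proof -
      have "finite W" "v \<notin> W" using finite_V hW[of v] v by (auto simp: W_def)
      then show ?thesis by (simp add: N_def W_def[symmetric])
    qed
    ultimately show False using max by fastforce
  qed
  then show ?thesis using facetI[of f] f by (auto simp: good_def W_def)
qed

context
  fixes B assumes B: "facet B"
begin

lemma facet_basis: "lattice_basis d B"
  and facet_subset: "B \<subseteq> V"
  and level_le_1: "\<And>v. v \<in> V \<Longrightarrow> level B v \<le> 1"
  and level_eq_1: "\<And>v. v \<in> V \<Longrightarrow> level B v = 1 \<longleftrightarrow> v \<in> B"
  using B level_basis by (auto simp: facet_def)

lemma facet_finite: "finite B" and facet_card: "card B = d"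
  using lattice_basis_finite lattice_basis_card facet_basis by auto

text \<open>The supporting functional \<open>u\<close> is tilted by minus the coordinate at
  \<open>b\<close>, which keeps it 1 on \<open>B - {b}\<close>, until some \<open>n\<close> becomes
  tight. The tight set spans, so it is a lattice basis with \<open>d\<close> elements, and
  unimodularity of the exchange makes the coefficient of \<open>n\<close> at \<open>b\<close> a
  unit.\<close>

lemma facet_flip:
  assumes b: "b \<in> B"
  shows "\<exists>n\<in>V. icoord B n b = -1 \<and> facet (insert n (B - {b}))"
proof -
  note ind = lattice_basis_independent[OF facet_basis]
  obtain u :: "rvec \<Rightarrow> real" where u: "linear u" "\<forall>x\<in>B. u x = 1"
    using linear_independent_extend[OF ind, of "\<lambda>_. 1"] by auto
  obtain f :: "rvec \<Rightarrow> real" where f: "linear f" "\<forall>x\<in>B. f x = (if x = b then -1 else 0)"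
    using linear_independent_extend[OF ind, of "\<lambda>x. if x = b then -1 else 0"] by auto
  have uv: "u v = of_int (level B v)" if "v \<in> V" for v
    using linear_level[OF facet_basis u(1)] u(2) that V_lattice by auto
  have fv: "f v = - of_int (icoord B v b)" if "v \<in> int_lattice d" for v
  proof -
    have "f v = (\<Sum>x\<in>B. if x = b then - of_int (icoord B v b) else 0)"
      unfolding linear_icoord[OF facet_basis f(1) that] using f(2) by (intro sum.cong) auto
    then show ?thesis using b facet_finite by simp
  qed
  have "b \<in> coord_space d" using b facet_subset V_lattice int_lattice_coord_space by auto
  then have "\<exists>v\<in>V. f v > 0" using positive[OF f(1)] f(2) b by (metis neg_equal_0_iff_equal one_neq_zero)
  moreover have "u v \<le> 1" if "v \<in> V" for v
    using uv[OF that] level_le_1[OF that] by simp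
  ultimately obtain t n where t: "\<And>v. v \<in> V \<Longrightarrow> u v + t * f v \<le> 1" and n: "n \<in> V" "f n > 0" "u n + t * f n = 1"
    using pivot[OF finite_V, of u f] by auto
  define W where "W = {v\<in>V. u v + t * f v = 1}"
  have sub: "insert n (B - {b}) \<subseteq> W"
    using n f u facet_subset by (auto simp: W_def)
  have nl: "n \<in> int_lattice d" using n V_lattice by auto
  have nb: "icoord B n b < 0" using fv[OF nl] n by simp
  have "n = of_int (icoord B n b) *\<^sub>R b + (\<Sum>j\<in>B - {b}. of_int (icoord B n j) *\<^sub>R j)"
    by (subst icoord_rep[OF facet_basis nl], subst sum.remove[OF facet_finite b]) simp
  then have neq: "of_int (icoord B n b) *\<^sub>R b = n - (\<Sum>j\<in>B - {b}. of_int (icoord B n j) *\<^sub>R j)"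
    unfolding eq_diff_eq by (rule sym)
  have "of_int (icoord B n b) *\<^sub>R b \<in> span W"
    unfolding neq using sub by (intro span_diff span_sum span_scale span_base) auto
  then have "(1 / of_int (icoord B n b)) *\<^sub>R of_int (icoord B n b) *\<^sub>R b \<in> span W"
    by (rule span_scale)
  then have "b \<in> span W" using nb by simp
  then have "B \<subseteq> span W" using sub span_base by blast
  then have span: "coord_space d \<subseteq> span W"
    using lattice_basis_span[OF facet_basis] span_minimal subspace_span by metis
  have lin: "linear (\<lambda>x. u x + t * f x)"
    using linear_compose_add[OF u(1) linear_compose_scale_right[OF f(1), of t]] by simp
  have fW: "facet W" unfolding W_def using facetI[OF lin] t span by (simp add: W_def)
  then have lW: "lattice_basis d W" by (simp add: facet_def)
  have nB: "n \<notin> B - {b}" using n(2) f(2) by (auto split: if_splits)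
  have "card (insert n (B - {b})) = d"
    using nB facet_finite facet_card b dpos by (simp add: card_Diff_singleton)
  then have W: "insert n (B - {b}) = W"
    using card_subset_eq[OF lattice_basis_finite[OF lW] sub] lattice_basis_card[OF lW] by simp
  have bl: "b \<in> int_lattice d" using b facet_subset V_lattice by auto
  have nW: "n \<in> W" using sub by simp
  \<comment> \<open>With \<open>b\<close> rewritten in the basis \<open>W\<close>, comparing
    coefficients at \<open>n\<close> shows that \<open>icoord B n b\<close> divides 1.\<close>
  have "n = (\<Sum>j\<in>W. of_int (icoord B n b * icoord W b j + (if j \<in> B - {b} then icoord B n j else 0)) *\<^sub>R j)"
  proof -
    have "(\<Sum>j\<in>W. of_int (icoord B n b * icoord W b j + (if j \<in> B - {b} then icoord B n j else 0)) *\<^sub>R j)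
      = of_int (icoord B n b) *\<^sub>R (\<Sum>j\<in>W. of_int (icoord W b j) *\<^sub>R j) + (\<Sum>j\<in>W. if j \<in> B - {b} then of_int (icoord B n j) *\<^sub>R j else 0)"
      unfolding scaleR_sum_right sum.distrib[symmetric]
      by (intro sum.cong) (auto simp: scaleR_left_distrib)
    also have "(\<Sum>j\<in>W. if j \<in> B - {b} then of_int (icoord B n j) *\<^sub>R j else 0) = (\<Sum>j\<in>B - {b}. of_int (icoord B n j) *\<^sub>R j)"
      using sub lattice_basis_finite[OF lW] by (intro sum.mono_neutral_cong_right) auto
    also have "(\<Sum>j\<in>W. of_int (icoord W b j) *\<^sub>R j) = b" using icoord_rep[OF lW bl] by simp
    finally show ?thesis unfolding neq by simp
  qed
  from icoord_unique[OF lW this nW] have "icoord W n n = icoord B n b * icoord W b n"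
    using nB by auto
  then have "icoord B n b * icoord W b n = 1" using icoord_basis[OF lW nW nW] by simp
  then have "icoord B n b = -1" using nb by (auto simp: zmult_eq_1_iff)
  then show ?thesis using n(1) fW W by auto
qed

end

end

section \<open>Special facets\<close>

context fano_vertices
begin

definition level0 :: "rvec set \<Rightarrow> rvec set" where
  "level0 B = {v\<in>V. level B v = 0}"

definition level_neg1 :: "rvec set \<Rightarrow> rvec set" where
  "level_neg1 B = {v\<in>V. level B v = -1}"

definition low :: "rvec set \<Rightarrow> rvec set" where
  "low B = {v\<in>V. level B v \<le> -2}"

definition neg :: "rvec set \<Rightarrow> rvec \<Rightarrow> rvec set" where
  "neg B v = {b\<in>B. icoord B v b < 0}"

definition special :: "rvec set \<Rightarrow> bool" where
  "special B \<longleftrightarrow> facet B \<and> (\<forall>b\<in>B. icoord B (\<Sum>V) b \<ge> 0)"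

lemma V_lat: "v \<in> V \<Longrightarrow> v \<in> int_lattice d"
  using V_lattice by auto

lemma sum_V_lat: "\<Sum>V \<in> int_lattice d"
  by (intro int_lattice_sum V_lat)

lemma finite_levels [simp]: "finite (level0 B)" "finite (level_neg1 B)" "finite (low B)"
  using finite_V by (auto simp: level0_def level_neg1_def low_def)

context
  fixes B assumes B: "facet B"
begin

lemma facet_lat: "b \<in> B \<Longrightarrow> b \<in> int_lattice d"
  using facet_subset[OF B] V_lat by auto

lemma flip_ex:
  assumes b: "b \<in> B"
  obtains n where "n \<in> V" "n \<notin> B" "icoord B n b = -1" "level B n \<le> 0" "facet (insert n (B - {b}))"
    "\<And>x. x \<in> int_lattice d \<Longrightarrow> level (insert n (B - {b})) x = level B x + icoord B x b * (level B n - 1)"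
proof -
  obtain n where n: "n \<in> V" "icoord B n b = -1" "facet (insert n (B - {b}))"
    using facet_flip[OF B b] by auto
  have nB: "n \<notin> B"
    using n(2) icoord_basis[OF facet_basis[OF B] _ b, of n] by (auto split: if_splits)
  then have "level B n \<le> 0"
    using level_le_1[OF B n(1)] level_eq_1[OF B n(1)] by linarith
  moreover have "level (insert n (B - {b})) x = level B x + icoord B x b * (level B n - 1)"
    if "x \<in> int_lattice d" for x
    using level_flip[OF facet_basis[OF B] facet_basis[OF n(3)] b _ n(2) that] nB by auto
  ultimately show thesis using that[OF n(1) nB n(2) _ n(3)] by blast
qed

text \<open>A flip at \<open>b\<close> raises the level of a vertex with negative coordinate there
  by at least the absolute value of that coordinate, and the result is still at most 1.\<close>

lemma icoord_ge:
  assumes v: "v \<in> V" and b: "b \<in> B"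
  shows "icoord B v b \<ge> level B v - 1"
proof (cases "icoord B v b \<ge> 0")
  case True
  then show ?thesis using level_le_1[OF B v] by linarith
next
  case False
  obtain n where n: "level B n \<le> 0" "facet (insert n (B - {b}))"
    "level (insert n (B - {b})) v = level B v + icoord B v b * (level B n - 1)"
    using flip_ex[OF b] V_lat[OF v] by metis
  have "level B v + icoord B v b * (level B n - 1) \<le> 1"
    using level_le_1[OF n(2) v] n(3) by simp
  moreover have "icoord B v b * (level B n - 1) \<ge> icoord B v b * (-1)"
    using False n(1) by (intro mult_left_mono_neg) auto
  ultimately show ?thesis by linarith
qed

text \<open>The flip at \<open>b\<close> lifts \<open>v\<close> to level
  \<open>1 - level B n\<close>, which is at most 1 only if the entering \<open>n\<close> has level
  0. Then \<open>v\<close> reaches level 1, hence belongs to the new facet, and must be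
  \<open>n\<close> itself.\<close>

lemma level0_flip:
  assumes v: "v \<in> level0 B" and b: "b \<in> B" and neg: "icoord B v b < 0"
  shows "icoord B v b = -1" "facet (insert v (B - {b}))" "v \<notin> B"
    "\<And>x. x \<in> int_lattice d \<Longrightarrow> level (insert v (B - {b})) x = level B x - icoord B x b"
proof -
  have vV: "v \<in> V" and lv: "level B v = 0" using v by (auto simp: level0_def)
  show vb: "icoord B v b = -1" using icoord_ge[OF vV b] lv neg by linarith
  show vB: "v \<notin> B" using level_eq_1[OF B vV] lv by simp
  obtain n where n: "n \<notin> B" "level B n \<le> 0" "facet (insert n (B - {b}))"
    "\<And>x. x \<in> int_lattice d \<Longrightarrow> level (insert n (B - {b})) x = level B x + icoord B x b * (level B n - 1)"
    using flip_ex[OF b] by metis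
  have lv': "level (insert n (B - {b})) v = 1 - level B n"
    using n(4)[OF V_lat[OF vV]] lv vb by simp
  then have ln: "level B n = 0" using level_le_1[OF n(3) vV] n(2) by linarith
  then have "v \<in> insert n (B - {b})" using level_eq_1[OF n(3) vV] lv' by simp
  then have "v = n" using vB by auto
  then show "facet (insert v (B - {b}))"
    "\<And>x. x \<in> int_lattice d \<Longrightarrow> level (insert v (B - {b})) x = level B x - icoord B x b"
    using n(3,4) ln by auto
qed

text \<open>Both vertices are the one that enters when \<open>b\<close> is flipped.\<close>

lemma level0_unique:
  assumes v: "v \<in> level0 B" and w: "w \<in> level0 B" and b: "b \<in> B"
    and neg: "icoord B v b < 0" "icoord B w b < 0"
  shows "w = v"
proof -
  have wV: "w \<in> V" and lw: "level B w = 0" using w by (auto simp: level0_def)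
  have "level (insert v (B - {b})) w = 1"
    using level0_flip(4)[OF v b neg(1) V_lat[OF wV]] level0_flip(1)[OF w b neg(2)] lw by simp
  then have "w \<in> insert v (B - {b})"
    using level_eq_1[OF level0_flip(2)[OF v b neg(1)] wV] by simp
  then show ?thesis using level0_flip(3)[OF w b neg(2)] by auto
qed

text \<open>Improves \<open>icoord_ge\<close> by one: equality there would lift \<open>x\<close>
  into the flipped facet, whose elements all have level 0 or 1 with respect to
  \<open>B\<close>.\<close>

lemma icoord_ge_level:
  assumes v: "v \<in> level0 B" and b: "b \<in> B" and neg: "icoord B v b < 0"
    and x: "x \<in> V" "level B x < 0"
  shows "icoord B x b \<ge> level B x"
proof -
  have "x \<notin> insert v (B - {b})"
    using level_eq_1[OF B x(1)] x(2) v by (auto simp: level0_def)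
  then have "level (insert v (B - {b})) x \<noteq> 1"
    using level_eq_1[OF level0_flip(2)[OF v b neg] x(1)] by simp
  then show ?thesis
    using level0_flip(4)[OF v b neg V_lat[OF x(1)]] icoord_ge[OF x(1) b]
      level_le_1[OF level0_flip(2)[OF v b neg] x(1)] by linarith
qed

lemma finite_neg [simp]: "finite (neg B v)"
  using facet_finite[OF B] by (auto simp: neg_def)

lemma neg_level0_nonempty:
  assumes v: "v \<in> level0 B" shows "neg B v \<noteq> {}"
proof
  assume "neg B v = {}"
  then have nn: "\<And>b. b \<in> B \<Longrightarrow> icoord B v b \<ge> 0" by (force simp: neg_def)
  have "(\<Sum>b\<in>B. icoord B v b) = 0" using v by (simp add: level0_def level_def)
  then have "\<forall>b\<in>B. icoord B v b = 0"
    using sum_nonneg_eq_0_iff[OF facet_finite[OF B] nn] by simp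
  then have "v = 0"
    using v by (intro icoord_eqI[OF facet_basis[OF B]])
      (auto simp: level0_def V_lat int_lattice_zero icoord_zero[OF facet_basis[OF B]])
  then show False using v zero_notin by (auto simp: level0_def)
qed

lemma sum_card_neg_le: "(\<Sum>v\<in>level0 B. card (neg B v)) \<le> d"
proof -
  have "(\<Sum>v\<in>level0 B. card (neg B v)) = card (\<Union>v\<in>level0 B. neg B v)"
    using level0_unique facet_finite[OF B] by (intro card_UN_disjoint[symmetric]) (auto simp: neg_def)
  also have "\<dots> \<le> card B"
    by (intro card_mono facet_finite[OF B]) (auto simp: neg_def)
  finally show ?thesis by (simp add: facet_card[OF B])
qed

text \<open>The sets \<open>neg B v\<close> are disjoint. None is empty, as the coordinates of a
  nonzero vertex of level 0 sum to 0, and a non-simple vertex uses up at least two elements of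
  \<open>B\<close>.\<close>

lemma card_level0_nonsimple: "card (level0 B) + card {v\<in>level0 B. card (neg B v) \<noteq> 1} \<le> d"
proof -
  have "card (level0 B) + card {v\<in>level0 B. card (neg B v) \<noteq> 1}
      = (\<Sum>v\<in>level0 B. 1 + (if card (neg B v) \<noteq> 1 then 1 else 0))"
    unfolding sum.distrib by (simp add: sum.inter_filter[symmetric])
  also have "\<dots> \<le> (\<Sum>v\<in>level0 B. card (neg B v))"
  proof (rule sum_mono)
    fix v assume "v \<in> level0 B"
    then have "card (neg B v) \<noteq> 0" using neg_level0_nonempty by simp
    moreover have "1 + (if c \<noteq> 1 then 1 else 0) \<le> c" if "c \<noteq> 0" for c :: nat
      using that by auto
    ultimately show "1 + (if card (neg B v) \<noteq> 1 then 1 else 0) \<le> card (neg B v)" by blast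
  qed
  finally show ?thesis using sum_card_neg_le by linarith
qed

text \<open>The only negative coordinate is -1 and all coordinates sum to 0, so the positive part is
  a single 1.\<close>

lemma simple_rep:
  assumes v: "v \<in> level0 B" and c: "card (neg B v) = 1"
  obtains b b' where "b \<in> B" "b' \<in> B" "b' \<noteq> b" "v = b' - b"
proof -
  obtain b where nb: "neg B v = {b}" using c card_1_singletonE by blast
  have b: "b \<in> B" "icoord B v b < 0" using nb by (auto simp: neg_def)
  have vb: "icoord B v b = -1" by (rule level0_flip(1)[OF v b])
  have nn: "icoord B v j \<ge> 0" if "j \<in> B - {b}" for j using nb that by (force simp: neg_def)
  have fin: "finite (B - {b})" using facet_finite[OF B] by simp
  have s1: "(\<Sum>j\<in>B - {b}. icoord B v j) = 1"
    using v vb b facet_finite[OF B] by (simp add: level0_def level_def sum_diff1)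
  then obtain b' where b': "b' \<in> B - {b}" "icoord B v b' \<noteq> 0"
    by (metis (no_types, lifting) sum.neutral zero_neq_one)
  have s2: "(\<Sum>j\<in>B - {b} - {b'}. icoord B v j) = 1 - icoord B v b'"
    using s1 sum_diff1[OF fin, of "icoord B v" b'] b' by simp
  moreover have nn2: "(\<Sum>j\<in>B - {b} - {b'}. icoord B v j) \<ge> 0"
    using nn by (intro sum_nonneg) auto
  ultimately have vb': "icoord B v b' = 1" using nn[OF b'(1)] b'(2) by linarith
  then have z: "\<forall>j\<in>B - {b} - {b'}. icoord B v j = 0"
    using s2 sum_nonneg_eq_0_iff[of "B - {b} - {b'}" "icoord B v"] nn fin by simp
  have "v = b' - b"
  proof (rule icoord_eqI[OF facet_basis[OF B]])
    show "v \<in> int_lattice d" using v V_lat by (auto simp: level0_def)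
    show "b' - b \<in> int_lattice d" using b b' facet_lat by (auto intro: int_lattice_diff)
    fix j assume j: "j \<in> B"
    show "icoord B v j = icoord B (b' - b) j"
      using icoord_diff[OF facet_basis[OF B] facet_lat facet_lat j, of b' b]
        icoord_basis[OF facet_basis[OF B] _ j, of b'] icoord_basis[OF facet_basis[OF B] _ j, of b]
        b b' j vb vb' z by (auto split: if_splits)
  qed
  then show thesis using that b b' by auto
qed

lemma diff_coord:
  assumes "b \<in> B" "b' \<in> B" "j \<in> B"
  shows "icoord B (b' - b) j = (if j = b' then 1 else 0) - (if j = b then 1 else 0)"
  using assms icoord_diff[OF facet_basis[OF B] facet_lat facet_lat, of b' b j]
    icoord_basis[OF facet_basis[OF B]] by simp

lemma simple_props:
  assumes "b \<in> B" "b' \<in> B" "b' \<noteq> b" "b' - b \<in> V"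
  shows "b' - b \<in> level0 B" "neg B (b' - b) = {b}" "icoord B (b' - b) b < 0"
  using assms level_diff[OF facet_basis[OF B] facet_lat facet_lat, of b' b]
    level_basis[OF facet_basis[OF B]] diff_coord
  by (auto simp: level0_def neg_def split: if_splits)

lemma simple_flip:
  assumes b: "b \<in> B" "b' \<in> B" "b' \<noteq> b" "b' - b \<in> V"
  defines "B' \<equiv> insert (b' - b) (B - {b})"
  shows "facet B'" "b' - b \<notin> B"
    "\<And>x. x \<in> int_lattice d \<Longrightarrow> level B' x = level B x - icoord B x b"
    "\<And>x. x \<in> int_lattice d \<Longrightarrow> icoord B' x (b' - b) = - icoord B x b"
    "\<And>x j. x \<in> int_lattice d \<Longrightarrow> j \<in> B - {b} \<Longrightarrow>
       icoord B' x j = icoord B x j + (if j = b' then icoord B x b else 0)"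
proof -
  note l0 = simple_props[OF b]
  note fl = level0_flip[OF l0(1) b(1) l0(3)]
  show f: "facet B'" "b' - b \<notin> B"
    "\<And>x. x \<in> int_lattice d \<Longrightarrow> level B' x = level B x - icoord B x b"
    unfolding B'_def by (rule fl; assumption)+
  have nb: "b' - b \<notin> B - {b}" using f(2) by simp
  fix x assume x: "x \<in> int_lattice d"
  show "icoord B' x (b' - b) = - icoord B x b"
    unfolding B'_def
    by (rule icoord_flip_new[OF facet_basis[OF B] facet_basis[OF f(1)[unfolded B'_def]] b(1) nb fl(1) x])
  fix j assume j: "j \<in> B - {b}"
  show "icoord B' x j = icoord B x j + (if j = b' then icoord B x b else 0)"
    unfolding B'_def
    using icoord_flip[OF facet_basis[OF B] facet_basis[OF f(1)[unfolded B'_def]] b(1) nb fl(1) x j] diff_coord[of b b' j] b j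
    by auto
qed

end

text \<open>The flip alters coordinates only by the coordinate at \<open>b\<close>, and that of the
  vertex sum is 0.\<close>

lemma simple_flip_special:
  assumes S: "special B" and b: "b \<in> B" "b' \<in> B" "b' \<noteq> b" "b' - b \<in> V"
    and s: "icoord B (\<Sum>V) b = 0"
  shows "special (insert (b' - b) (B - {b}))"
proof -
  have B: "facet B" using S by (simp add: special_def)
  note fl = simple_flip[OF B b]
  have "icoord (insert (b' - b) (B - {b})) (\<Sum>V) j \<ge> 0" if "j \<in> insert (b' - b) (B - {b})" for j
    using that fl(4)[OF sum_V_lat] fl(5)[OF sum_V_lat, of j] s S by (auto simp: special_def)
  then show ?thesis using fl(1) by (simp add: special_def)
qed

text \<open>If the vertex sum had a negative coordinate at \<open>b\<close>, the flip at
  \<open>b\<close> would yield a facet with a larger functional at the sum.\<close>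

lemma special_exists: "\<exists>B. special B"
proof -
  have fin: "finite {B. facet B}"
    by (rule finite_subset[of _ "Pow V"]) (use facet_subset finite_V in blast)+
  have ne: "{B. facet B} \<noteq> {}" using facet_exists by auto
  define M where "M = Max ((\<lambda>B. level B (\<Sum>V)) ` {B. facet B})"
  have "M \<in> (\<lambda>B. level B (\<Sum>V)) ` {B. facet B}"
    unfolding M_def by (intro Max_in) (use fin ne in auto)
  then obtain B where B: "facet B" "M = level B (\<Sum>V)" by auto
  have max: "level B' (\<Sum>V) \<le> level B (\<Sum>V)" if "facet B'" for B'
    unfolding B(2)[symmetric] M_def using that fin by (intro Max_ge) auto
  have "icoord B (\<Sum>V) b \<ge> 0" if b: "b \<in> B" for b
  proof -
    obtain n where n: "level B n \<le> 0" "facet (insert n (B - {b}))"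
      "level (insert n (B - {b})) (\<Sum>V) = level B (\<Sum>V) + icoord B (\<Sum>V) b * (level B n - 1)"
      using flip_ex[OF B(1) b] sum_V_lat by metis
    have "icoord B (\<Sum>V) b * (level B n - 1) \<le> 0" using max[OF n(2)] n(3) by simp
    then show ?thesis using n(1) by (auto simp: mult_le_0_iff)
  qed
  then show ?thesis using B(1) by (auto simp: special_def)
qed

context
  fixes B assumes S: "special B"
begin

lemma special_facet: "facet B"
  using S by (simp add: special_def)

lemma level_sum_nonneg: "level B (\<Sum>V) \<ge> 0"
  using S unfolding special_def level_def by (auto intro: sum_nonneg)

lemma partition_V: "V = B \<union> level0 B \<union> level_neg1 B \<union> low B"
  and partition_disjoint: "B \<inter> level0 B = {}" "B \<inter> level_neg1 B = {}" "B \<inter> low B = {}"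
    "level0 B \<inter> level_neg1 B = {}" "level0 B \<inter> low B = {}" "level_neg1 B \<inter> low B = {}"
proof -
  have l: "level B v = 1 \<or> level B v = 0 \<or> level B v = -1 \<or> level B v \<le> -2" if "v \<in> V" for v
    using level_le_1[OF special_facet that] by linarith
  show "V = B \<union> level0 B \<union> level_neg1 B \<union> low B"
    using l level_eq_1[OF special_facet] facet_subset[OF special_facet]
    by (auto simp: level0_def level_neg1_def low_def)
  show "B \<inter> level0 B = {}" "B \<inter> level_neg1 B = {}" "B \<inter> low B = {}"
    "level0 B \<inter> level_neg1 B = {}" "level0 B \<inter> low B = {}" "level_neg1 B \<inter> low B = {}"
    using level_basis[OF facet_basis[OF special_facet]] by (auto simp: level0_def level_neg1_def low_def)
qed

lemma sum_partition:
  "sum f V = sum f B + sum f (level0 B) + sum f (level_neg1 B) + sum f (low B)"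
  for f :: "rvec \<Rightarrow> 'c :: comm_monoid_add"
proof -
  have fin: "finite B" by (rule facet_finite[OF special_facet])
  show ?thesis
    apply (subst partition_V)
    apply (subst sum.union_disjoint)
    subgoal using fin by simp
    subgoal by simp
    subgoal using partition_disjoint by blast
    apply (subst sum.union_disjoint)
    subgoal using fin by simp
    subgoal by simp
    subgoal using partition_disjoint by blast
    apply (subst sum.union_disjoint)
    using fin partition_disjoint by auto
qed

text \<open>The levels of all vertices add up to a nonnegative number, to which \<open>B\<close>
  contributes \<open>d\<close> and every other vertex at most 0.\<close>

lemma level_ge:
  assumes v: "v \<in> V" shows "level B v \<ge> - int d"
proof -
  have l: "level B x \<le> 0" if "x \<in> V - B" for x
    using that level_le_1[OF special_facet, of x] level_eq_1[OF special_facet, of x] by force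
  have "level B (\<Sum>V) = (\<Sum>x\<in>V. level B x)"
    by (rule level_sum[OF facet_basis[OF special_facet] V_lat])
  also have "\<dots> = (\<Sum>x\<in>V - B. level B x) + (\<Sum>x\<in>B. level B x)"
    by (rule sum.subset_diff[OF facet_subset[OF special_facet] finite_V])
  also have "(\<Sum>x\<in>B. level B x) = int d"
    using level_basis[OF facet_basis[OF special_facet]] facet_card[OF special_facet] by simp
  finally have eq: "(\<Sum>x\<in>V - B. level B x) \<ge> - int d" using level_sum_nonneg by linarith
  show ?thesis
  proof (cases "v \<in> B")
    case True
    then show ?thesis using level_basis[OF facet_basis[OF special_facet]] by simp
  next
    case False
    then have "(\<Sum>x\<in>V - B. level B x) \<le> level B v"
      using finite_V v l sum_nonpos[of "V - B - {v}" "level B"]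
      by (subst sum.remove[of _ v]) (auto)
    then show ?thesis using eq by linarith
  qed
qed

end

end

section \<open>Bounds that follow from a large number of vertices\<close>

locale many_vertices = fano_vertices +
  fixes k :: nat
  assumes many: "3 * d \<le> card V + k"
begin

definition simple0 :: "rvec set \<Rightarrow> rvec set" where
  "simple0 B = {v\<in>level0 B. card (neg B v) = 1}"

definition exceptional :: "rvec set \<Rightarrow> rvec set" where
  "exceptional B = low B \<union> {v\<in>level0 B. card (neg B v) \<noteq> 1}"

definition succs :: "rvec set \<Rightarrow> rvec \<Rightarrow> rvec \<Rightarrow> bool" where
  "succs B b b' \<longleftrightarrow> b' \<in> B \<and> b' \<noteq> b \<and> b' - b \<in> V"

text \<open>By \<open>succs_unique\<close> the choice is unique whenever a successor exists, as it
  does on \<open>null_good B\<close>; elsewhere the value is arbitrary.\<close>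

definition succ :: "rvec set \<Rightarrow> rvec \<Rightarrow> rvec" where
  "succ B b = (SOME b'. succs B b b')"

definition null_good :: "rvec set \<Rightarrow> rvec set" where
  "null_good B = {b\<in>B. icoord B (\<Sum>V) b = 0 \<and> (\<exists>b'. succs B b b')}"

text \<open>
  Flipping at a clean \<open>b\<close> keeps the facet special, and the only vertices with a nonzero
  \<open>b\<close>-coordinate are \<open>b\<close>, differences of elements of \<open>B\<close>, and vertices of level \<open>-1\<close>.
\<close>

definition clean :: "rvec set \<Rightarrow> rvec set" where
  "clean B = {b\<in>null_good B. \<forall>v\<in>exceptional B. icoord B v b = 0}"

text \<open>With respect to a special facet a vertex has at most \<open>5 * k + 3\<close> negative
  coordinates (\<open>neg_bound\<close> with \<open>m = k + 1\<close>), each at least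
  \<open>- (k + 2)\<close>, and level at most 1. So this bounds the sum of the absolute values of
  its coordinates.\<close>

definition supp_bound :: nat where "supp_bound = 1 + 2 * ((5 * k + 3) * (k + 2))"

text \<open>At most \<open>3 * k\<close> elements are not null good, and each of at most
  \<open>2 * k\<close> exceptional vertices spoils at most \<open>supp_bound\<close> further
  ones.\<close>

definition dirty_bound :: nat where "dirty_bound = 3 * k + 2 * k * supp_bound"

lemma succ_succs: "\<exists>b'. succs B b b' \<Longrightarrow> succs B b (succ B b)"
  unfolding succ_def by (rule someI_ex)

context
  fixes B assumes S: "special B"
  notes B = special_facet[OF S]
  notes basis = facet_basis[OF B]
  notes fin = facet_finite[OF B]
begin

lemma succs_unique:
  assumes "b \<in> B" "succs B b b'" "succs B b b''" shows "b' = b''"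
proof -
  have "b' - b = b'' - b"
    using assms simple_props[OF B, of b b'] simple_props[OF B, of b b'']
    by (intro level0_unique[OF B _ _ assms(1)]) (auto simp: succs_def)
  then show ?thesis by simp
qed

lemma succ_eq: "b \<in> B \<Longrightarrow> succs B b b' \<Longrightarrow> succ B b = b'"
  using succs_unique succ_succs by blast

text \<open>All bounds come from one identity: \<open>level B (\<Sum>V)\<close> plus the excess
  \<open>w\<close> of the low vertices equals \<open>2 * d + card (level0 B) - card V\<close>. Both
  terms on the left are nonnegative, and the right side is at most \<open>k\<close> since level 0
  has at most \<open>d\<close> elements.\<close>

lemma level_bound: "v \<in> V \<Longrightarrow> level B v \<ge> - int k - 1"
    and level_sum_le: "level B (\<Sum>V) \<le> int k"
    and card_low: "card (low B) \<le> k"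
    and card_level0: "d \<le> card (level0 B) + k"
    and card_level_neg1: "d \<le> card (level_neg1 B) + 2 * k"
    and card_level0_le: "card (level0 B) \<le> d"
proof -
  define w where "w = (\<Sum>v\<in>low B. - level B v - 1)"
  have V: "card V = d + card (level0 B) + card (level_neg1 B) + card (low B)"
    using sum_partition[OF S, of "\<lambda>_. 1 :: nat"] facet_card[OF B] by simp
  have "level B (\<Sum>V) = (\<Sum>x\<in>V. level B x)"
    by (rule level_sum[OF basis V_lat])
  also have "\<dots> = (\<Sum>x\<in>B. level B x) + (\<Sum>x\<in>level0 B. level B x) + (\<Sum>x\<in>level_neg1 B. level B x) + (\<Sum>x\<in>low B. level B x)"
    by (rule sum_partition[OF S])
  also have "(\<Sum>x\<in>B. level B x) = int d"
    using level_basis[OF basis] facet_card[OF B] by simp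
  also have "(\<Sum>x\<in>level0 B. level B x) = 0"
    by (rule sum.neutral) (auto simp: level0_def)
  also have "(\<Sum>x\<in>level_neg1 B. level B x) = (\<Sum>x\<in>level_neg1 B. -1)"
    by (rule sum.cong) (auto simp: level_neg1_def)
  also have "(\<Sum>x\<in>low B. level B x) = - w - int (card (low B))"
    by (simp add: w_def sum_subtractf sum_negf)
  finally have ls: "level B (\<Sum>V) = int d - int (card (level_neg1 B)) - w - int (card (low B))" by simp
  have w1: "int (card (low B)) \<le> w"
  proof -
    have "int (card (low B)) = (\<Sum>v\<in>low B. 1)" by simp
    also have "\<dots> \<le> w" unfolding w_def by (intro sum_mono) (auto simp: low_def)
    finally show ?thesis .
  qed
  show c0: "card (level0 B) \<le> d" using card_level0_nonsimple[OF B] by linarith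
  have wk: "w + level B (\<Sum>V) \<le> int k" using V ls many c0 by linarith
  show "level B (\<Sum>V) \<le> int k" using wk w1 by linarith
  show cl: "card (low B) \<le> k" using wk w1 level_sum_nonneg[OF S] by linarith
  show c0: "d \<le> card (level0 B) + k" using V ls w1 many level_sum_nonneg[OF S] by linarith
  show "d \<le> card (level_neg1 B) + 2 * k" using V many c0 \<open>card (level0 B) \<le> d\<close> cl by linarith
  assume v: "v \<in> V"
  show "level B v \<ge> - int k - 1"
  proof (cases "v \<in> low B")
    case True
    have "- level B v - 1 \<le> w"
      unfolding w_def using True finite_levels(3)[of B] by (intro member_le_sum) (simp_all add: low_def)
    then show ?thesis using wk level_sum_nonneg[OF S] by linarith
  next
    case False
    then have "level B v \<ge> -1" using v by (auto simp: low_def)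
    then show ?thesis by linarith
  qed
qed

lemma card_nonsimple: "card {v\<in>level0 B. card (neg B v) \<noteq> 1} \<le> k"
  using card_level0_nonsimple[OF B] card_level0 by linarith

lemma card_exceptional: "card (exceptional B) \<le> 2 * k"
  unfolding exceptional_def
  using card_Un_le[of "low B" "{v\<in>level0 B. card (neg B v) \<noteq> 1}"] card_low card_nonsimple by linarith

lemma simple0_rep:
  assumes "v \<in> simple0 B"
  obtains b b' where "b \<in> B" "succs B b b'" "v = b' - b"
proof -
  have "v \<in> level0 B" "card (neg B v) = 1" using assms by (auto simp: simple0_def)
  then obtain b b' where "b \<in> B" "b' \<in> B" "b' \<noteq> b" "v = b' - b" by (rule simple_rep[OF B])
  moreover have "v \<in> V" using assms by (auto simp: simple0_def level0_def)
  ultimately show thesis using that[of b b'] by (simp add: succs_def)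
qed

text \<open>A simple vertex of level 0 is determined by the element at which it is negative, so at
  most \<open>2 * k\<close> elements lack a successor. The coordinates of the vertex sum are
  nonnegative integers of total at most \<open>k\<close>, so at most \<open>k\<close> of them are
  nonzero.\<close>

lemma card_not_null_good: "card (B - null_good B) \<le> 3 * k"
proof -
  define G where "G = {b\<in>B. \<exists>b'. succs B b b'}"
  define N where "N = {b\<in>B. icoord B (\<Sum>V) b \<noteq> 0}"
  have "simple0 B \<subseteq> (\<lambda>b. succ B b - b) ` G"
  proof
    fix v assume "v \<in> simple0 B"
    then obtain b b' where "b \<in> B" "succs B b b'" "v = b' - b" by (rule simple0_rep)
    then show "v \<in> (\<lambda>b. succ B b - b) ` G" using succ_eq by (force simp: G_def)
  qed
  then have "card (simple0 B) \<le> card G"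
    by (rule surj_card_le[rotated]) (use fin in \<open>simp add: G_def\<close>)
  moreover have "card (level0 B) = card (simple0 B) + card {v\<in>level0 B. card (neg B v) \<noteq> 1}"
    unfolding simple0_def by (subst card_Un_disjoint[symmetric]) (auto intro: arg_cong[of _ _ card])
  ultimately have G: "d \<le> card G + 2 * k"
    using card_nonsimple card_level0 by linarith
  have "int (card N) = (\<Sum>b\<in>N. 1)" by simp
  also have "\<dots> \<le> (\<Sum>b\<in>N. icoord B (\<Sum>V) b)"
    using S by (intro sum_mono) (force simp: N_def special_def)
  also have "\<dots> \<le> level B (\<Sum>V)"
    unfolding level_def using S fin by (intro sum_mono2) (auto simp: N_def special_def)
  finally have N: "card N \<le> k" using level_sum_le by linarith
  have "B - null_good B \<subseteq> (B - G) \<union> N"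
    by (auto simp: null_good_def G_def N_def)
  then have "card (B - null_good B) \<le> card ((B - G) \<union> N)"
    using fin by (intro card_mono) (auto simp: N_def)
  also have "\<dots> \<le> card (B - G) + card N" by (rule card_Un_le)
  also have "card (B - G) = d - card G"
    using fin facet_card[OF B] by (subst card_Diff_subset) (auto simp: G_def)
  finally show ?thesis using G N by linarith
qed

end

text \<open>
  A flip at a null good \<open>b\<close> with a negative coordinate of \<open>v\<close> raises the level of \<open>v\<close> and loses at most
  two negative coordinates.
\<close>

lemma neg_bound:
  assumes "special B" "v \<in> V" "level B v \<ge> - int m"
  shows "card (neg B v) \<le> 3 * k + 1 + 2 * m"
  using assms
proof (induction m arbitrary: B)
  case (0 B)
  note B = special_facet[OF 0(1)]
  show ?case
  proof (cases "neg B v \<subseteq> B - null_good B")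
    case True
    then have "card (neg B v) \<le> card (B - null_good B)"
      by (rule card_mono[rotated]) (simp add: facet_finite[OF B])
    then show ?thesis using card_not_null_good[OF 0(1)] by linarith
  next
    case False
    then obtain b where b: "b \<in> neg B v" "b \<in> null_good B" by (auto simp: neg_def)
    then obtain b' where b': "b \<in> B" "succs B b b'" by (auto simp: null_good_def)
    have "v \<notin> B"
    proof
      assume "v \<in> B"
      then have "icoord B v b \<ge> 0" using icoord_basis[OF facet_basis[OF B] _ b'(1)] by simp
      then show False using b(1) by (simp add: neg_def)
    qed
    then have "level B v = 0"
      using level_le_1[OF B 0(2)] level_eq_1[OF B 0(2)] 0(3) by linarith
    then have v0: "v \<in> level0 B" using 0(2) by (simp add: level0_def)
    have b'': "b' \<in> B" "b' \<noteq> b" "b' - b \<in> V" using b'(2) by (auto simp: succs_def)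
    note p = simple_props[OF B b'(1) b'']
    \<comment> \<open>Only one vertex of level 0 is negative at \<open>b\<close>, and it has a
      single negative coordinate.\<close>
    have "v = b' - b"
      by (rule level0_unique[OF B p(1) v0 b'(1) p(3)]) (use b(1) in \<open>simp add: neg_def\<close>)
    then show ?thesis using p(2) by simp
  qed
next
  case (Suc m B)
  note B = special_facet[OF Suc.prems(1)]
  show ?case
  proof (cases "level B v \<ge> - int m")
    case True
    then show ?thesis using Suc.IH[OF Suc.prems(1,2) True] by simp
  next
    case F: False
    show ?thesis
    proof (cases "neg B v \<subseteq> B - null_good B")
      case True
      then have "card (neg B v) \<le> card (B - null_good B)"
        by (rule card_mono[rotated]) (simp add: facet_finite[OF B])
      then show ?thesis using card_not_null_good[OF Suc.prems(1)] by linarith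
    next
      case False
      then obtain b where b: "b \<in> neg B v" "b \<in> null_good B" by (auto simp: neg_def)
      then obtain b' where b': "b \<in> B" "b' \<in> B" "b' \<noteq> b" "b' - b \<in> V" "icoord B (\<Sum>V) b = 0"
        by (auto simp: null_good_def succs_def)
      note fl = simple_flip[OF B b'(1-4)]
      have vl: "v \<in> int_lattice d" by (rule V_lat[OF Suc.prems(2)])
      define B' where "B' = insert (b' - b) (B - {b})"
      have S': "special B'" unfolding B'_def by (rule simple_flip_special[OF Suc.prems(1) b'])
      have "level B' v \<ge> - int m"
        using fl(3)[OF vl] b(1) Suc.prems(3) by (simp add: B'_def neg_def)
      then have IH: "card (neg B' v) \<le> 3 * k + 1 + 2 * m" by (rule Suc.IH[OF S' Suc.prems(2)])
      have "neg B v \<subseteq> insert b (insert b' (neg B' v))"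
      proof
        fix j assume j: "j \<in> neg B v"
        show "j \<in> insert b (insert b' (neg B' v))"
        proof (cases "j = b \<or> j = b'")
          case False
          then have "icoord B' v j = icoord B v j"
            using j fl(5)[OF vl, of j] unfolding neg_def B'_def by simp
          then show ?thesis using j False by (simp add: neg_def B'_def)
        qed auto
      qed
      then have "card (neg B v) \<le> card (insert b (insert b' (neg B' v)))"
        by (rule card_mono[rotated]) (simp add: finite_neg[OF special_facet[OF S']])
      also have "\<dots> \<le> 2 + card (neg B' v)"
        using finite_neg[OF special_facet[OF S'], of v] by (simp add: card_insert_if)
      finally show ?thesis using IH by simp
    qed
  qed
qed

lemma card_support:
  assumes S: "special B" and v: "v \<in> V"
  shows "card {b\<in>B. icoord B v b \<noteq> 0} \<le> supp_bound"
proof -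
  note B = special_facet[OF S]
  have fin: "finite B" by (rule facet_finite[OF B])
  have lv: "level B v \<ge> - int (k + 1)" using level_bound[OF S v] by simp
  have "card (neg B v) \<le> 5 * k + 3" using neg_bound[OF S v lv] by simp
  moreover have "(\<Sum>b\<in>neg B v. - icoord B v b) \<le> (\<Sum>b\<in>neg B v. int (k + 2))"
    using icoord_ge[OF B v] lv by (intro sum_mono) (fastforce simp: neg_def)
  moreover have "(\<Sum>b\<in>neg B v. int (k + 2)) = int (card (neg B v) * (k + 2))"
    by (simp add: algebra_simps)
  moreover have "int (card (neg B v) * (k + 2)) \<le> int ((5 * k + 3) * (k + 2))" if "card (neg B v) \<le> 5 * k + 3"
    unfolding of_nat_le_iff by (rule mult_right_mono[OF that]) simp
  ultimately have n: "(\<Sum>b\<in>neg B v. - icoord B v b) \<le> int ((5 * k + 3) * (k + 2))"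
    by linarith
  have "int (card {b\<in>B. icoord B v b \<noteq> 0}) = (\<Sum>b\<in>B. if icoord B v b \<noteq> 0 then 1 else 0)"
    using fin by (simp add: sum.inter_filter[symmetric])
  \<comment> \<open>A nonzero integer counts for at most its absolute value, written as the number
    plus twice its negative part.\<close>
  also have "\<dots> \<le> (\<Sum>b\<in>B. icoord B v b + 2 * (if icoord B v b < 0 then - icoord B v b else 0))"
    by (intro sum_mono) auto
  also have "\<dots> = level B v + 2 * (\<Sum>b\<in>neg B v. - icoord B v b)"
    unfolding sum.distrib level_def sum_distrib_left[symmetric] neg_def
    using fin by (simp add: sum.inter_filter)
  finally show ?thesis using n level_le_1[OF B v] unfolding supp_bound_def by linarith
qed

lemma card_dirty:
  assumes S: "special B"
  shows "card (B - clean B) \<le> dirty_bound"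
proof -
  note B = special_facet[OF S]
  have fin: "finite B" by (rule facet_finite[OF B])
  have finE: "finite (exceptional B)" by (simp add: exceptional_def)
  have EV: "exceptional B \<subseteq> V" by (auto simp: exceptional_def low_def level0_def)
  have "B - clean B \<subseteq> (B - null_good B) \<union> (\<Union>v\<in>exceptional B. {b\<in>B. icoord B v b \<noteq> 0})"
    by (auto simp: clean_def)
  then have "card (B - clean B) \<le> card ((B - null_good B) \<union> (\<Union>v\<in>exceptional B. {b\<in>B. icoord B v b \<noteq> 0}))"
    by (rule card_mono[rotated]) (intro finite_UnI finite_Diff fin finite_UN_I finE finite_subset[OF _ fin] Collect_restrict)
  also have "\<dots> \<le> card (B - null_good B) + card (\<Union>v\<in>exceptional B. {b\<in>B. icoord B v b \<noteq> 0})"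
    by (rule card_Un_le)
  also have "card (\<Union>v\<in>exceptional B. {b\<in>B. icoord B v b \<noteq> 0}) \<le> (\<Sum>v\<in>exceptional B. card {b\<in>B. icoord B v b \<noteq> 0})"
    by (rule card_UN_le[OF finE])
  also have "\<dots> \<le> card (exceptional B) * supp_bound"
  proof -
    have "(\<Sum>v\<in>exceptional B. card {b\<in>B. icoord B v b \<noteq> 0}) \<le> of_nat (card (exceptional B)) * supp_bound"
      by (rule sum_bounded_above) (use EV card_support[OF S] in blast)
    then show ?thesis by (simp only: of_nat_id)
  qed
  also have "\<dots> \<le> 2 * k * supp_bound"
    using card_exceptional[OF S] by (rule mult_right_mono) simp
  finally show ?thesis using card_not_null_good[OF S] unfolding dirty_bound_def by linarith
qed

end

section \<open>Simultaneous flips\<close>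

text \<open>The graph with edges from \<open>i\<close> to \<open>f i\<close> has at most as many
  edges as vertices, so some vertex has at most one incoming edge. With its outgoing edge it has at
  most two neighbours and can be coloured last.\<close>

lemma three_coloring:
  assumes "finite T" "\<And>i. i \<in> T \<Longrightarrow> f i \<noteq> i"
  shows "\<exists>c :: 'a \<Rightarrow> nat. \<forall>i\<in>T. c i < 3 \<and> (f i \<in> T \<longrightarrow> c (f i) \<noteq> c i)"
  using assms
proof (induction "card T" arbitrary: T)
  case 0
  then show ?case by simp
next
  case (Suc n T)
  have "\<exists>i\<in>T. card {j\<in>T. f j = i} \<le> 1"
  proof (rule ccontr)
    assume "\<not> ?thesis"
    then have "(\<Sum>i\<in>T. 2) \<le> (\<Sum>i\<in>T. card {j\<in>T. f j = i})" by (intro sum_mono) force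
    also have "\<dots> = card (\<Union>i\<in>T. {j\<in>T. f j = i})"
      using Suc.prems(1) by (intro card_UN_disjoint[symmetric]) auto
    also have "\<dots> \<le> card T" using Suc.prems(1) by (intro card_mono) auto
    finally show False using Suc.hyps(2) by simp
  qed
  then obtain i where i: "i \<in> T" "card {j\<in>T. f j = i} \<le> 1" by auto
  have "n = card (T - {i})" using Suc.hyps(2) i(1) Suc.prems(1) by simp
  from Suc.hyps(1)[OF this] Suc.prems obtain c :: "'a \<Rightarrow> nat"
    where c: "\<And>j. j \<in> T - {i} \<Longrightarrow> c j < 3 \<and> (f j \<in> T - {i} \<longrightarrow> c (f j) \<noteq> c j)"
    by auto
  define N where "N = insert (c (f i)) (c ` {j\<in>T. f j = i})"
  have fin: "finite {j\<in>T. f j = i}" using Suc.prems(1) by simp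
  have "card N \<le> Suc (card (c ` {j\<in>T. f j = i}))"
    unfolding N_def using fin by (simp add: card_insert_if)
  also have "\<dots> \<le> 2" using card_image_le[OF fin, of c] i(2) by linarith
  finally have "card N < card {..<3 :: nat}" by simp
  moreover have "finite N" unfolding N_def using fin by simp
  ultimately have "\<not> {..<3} \<subseteq> N" using card_mono by (metis not_le)
  then obtain q where q: "q < 3" "q \<notin> N" by auto
  have "\<forall>j\<in>T. (c(i := q)) j < 3 \<and> (f j \<in> T \<longrightarrow> (c(i := q)) (f j) \<noteq> (c(i := q)) j)"
    using c q i(1) Suc.prems(2) by (auto simp: N_def)
  then show ?case by blast
qed

section \<open>Effect of a simultaneous flip on level 0\<close>

context many_vertices
begin

definition flipped :: "rvec set \<Rightarrow> rvec set \<Rightarrow> rvec set" where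
  "flipped B I = (B - I) \<union> (\<lambda>i. succ B i - i) ` I"

definition weight :: "rvec set \<Rightarrow> rvec set \<Rightarrow> rvec \<Rightarrow> int" where
  "weight B I x = (\<Sum>i\<in>I. icoord B x i)"

definition preds :: "rvec set \<Rightarrow> rvec \<Rightarrow> rvec set" where
  "preds B i = {j\<in>B. succs B j i}"

text \<open>As no flipped element is the successor of a flipped element, each flip leaves the
  coordinates at the other elements of \<open>I\<close> unchanged and keeps their successors in the
  basis, so the flips can be made one after another.\<close>

definition flippable :: "rvec set \<Rightarrow> rvec set \<Rightarrow> bool" where
  "flippable B I \<longleftrightarrow> I \<subseteq> clean B \<and> (\<forall>i\<in>I. succ B i \<notin> I)"

text \<open>A vertex of level -1 and weight -1 reaches level 0 after the flips, where nearly every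
  vertex is a difference of two basis elements. The excluded form is such a difference expressed in
  \<open>B\<close>.\<close>

definition irregular :: "rvec set \<Rightarrow> rvec set \<Rightarrow> rvec set" where
  "irregular B I = {x\<in>level_neg1 B. weight B I x < 0 \<and> \<not> (\<exists>i\<in>I. \<exists>j\<in>B - I. x = succ B i - i - j)}"

context
  fixes B assumes S: "special B"
  notes B = special_facet[OF S]
  notes basis = facet_basis[OF B]
  notes fin = facet_finite[OF B]
  notes lat = facet_lat[OF B]
begin

lemma cleanD:
  assumes "i \<in> clean B"
  shows "i \<in> B" "icoord B (\<Sum>V) i = 0" "succs B i (succ B i)" "succ B i \<in> B" "succ B i \<noteq> i"
    "succ B i - i \<in> V" "\<And>v. v \<in> exceptional B \<Longrightarrow> icoord B v i = 0"
  using assms succ_succs[of B i] by (auto simp: clean_def null_good_def succs_def)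

lemma clean_subset: "clean B \<subseteq> B"
  using cleanD(1) by auto

text \<open>The third conjunct carries the induction: the next \<open>i\<close> is neither in
  \<open>F\<close> nor a successor of an element of \<open>F\<close>, so its coordinate is still the
  one in \<open>B\<close>.\<close>

lemma flipped_props:
  assumes "flippable B I"
  shows "special (flipped B I) \<and> (\<forall>x\<in>int_lattice d. level (flipped B I) x = level B x - weight B I x) \<and>
    (\<forall>x\<in>int_lattice d. \<forall>j\<in>B - I. j \<notin> succ B ` I \<longrightarrow> icoord (flipped B I) x j = icoord B x j)"
proof -
  have "finite I" using assms clean_subset fin by (meson finite_subset flippable_def)
  then show ?thesis using assms
  proof (induction I)
    case empty
    then show ?case using S by (simp add: flipped_def weight_def)
  next
    case (insert i F)
    have flF: "flippable B F" using insert.prems by (auto simp: flippable_def)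
    note IH = insert.IH[OF flF]
    have i: "i \<in> clean B" using insert.prems by (auto simp: flippable_def)
    note ci = cleanD[OF i]
    have nF: "succ B i \<notin> F" "i \<notin> succ B ` F" using insert.prems by (auto simp: flippable_def)
    define B1 where "B1 = flipped B F"
    have S1: "special B1" using IH by (simp add: B1_def)
    note B1 = special_facet[OF S1]
    have m: "i \<in> B1" "succ B i \<in> B1" using ci nF insert.hyps by (auto simp: B1_def flipped_def)
    have ic: "icoord B1 x i = icoord B x i" if "x \<in> int_lattice d" for x
      using IH that nF ci insert.hyps by (simp add: B1_def)
    note fl = simple_flip[OF B1 m ci(5,6)]
    have s0: "icoord B1 (\<Sum>V) i = 0" using ic[OF sum_V_lat] ci(2) by simp
    have "succ B j - j \<noteq> i" if "j \<in> F" for j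
    proof -
      have j: "j \<in> clean B" using insert.prems that by (auto simp: flippable_def)
      show ?thesis using simple_flip(2)[OF B cleanD(1,4,5,6)[OF j]] ci(1) by auto
    qed
    then have eq: "insert (succ B i - i) (B1 - {i}) = flipped B (insert i F)"
      by (auto simp: B1_def flipped_def)
    have "special (flipped B (insert i F))"
      using simple_flip_special[OF S1 m ci(5,6) s0] by (simp add: eq)
    moreover have "level (flipped B (insert i F)) x = level B x - weight B (insert i F) x"
      if x: "x \<in> int_lattice d" for x
    proof -
      have "level (flipped B (insert i F)) x = level B1 x - icoord B1 x i"
        using fl(3)[OF x] unfolding eq .
      moreover have "level B1 x = level B x - weight B F x" using IH x by (simp add: B1_def)
      ultimately show ?thesis using ic[OF x] insert.hyps by (simp add: weight_def)
    qed
    moreover have "icoord (flipped B (insert i F)) x j = icoord B x j"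
      if x: "x \<in> int_lattice d" and j: "j \<in> B - insert i F" "j \<notin> succ B ` insert i F" for x j
    proof -
      have "j \<in> B1 - {i}" "j \<noteq> succ B i" using j by (simp_all add: B1_def flipped_def)
      then have "icoord (flipped B (insert i F)) x j = icoord B1 x j"
        using fl(5)[OF x, of j] unfolding eq by simp
      also have "\<dots> = icoord B x j" using IH x j by (simp add: B1_def)
      finally show ?thesis .
    qed
    ultimately show ?case by blast
  qed
qed

lemma weight_basis:
  assumes "I \<subseteq> B" "v \<in> B" shows "weight B I v = (if v \<in> I then 1 else 0)"
proof -
  have "weight B I v = (\<Sum>i\<in>I. if v = i then 1 else 0)"
    unfolding weight_def using assms by (intro sum.cong) (auto simp: icoord_basis[OF basis])
  then show ?thesis using finite_subset[OF assms(1) fin] by simp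
qed

lemma weight_diff:
  assumes "I \<subseteq> B" "x \<in> int_lattice d" "y \<in> int_lattice d"
  shows "weight B I (x - y) = weight B I x - weight B I y"
  unfolding weight_def sum_subtractf[symmetric]
  using assms by (intro sum.cong) (auto simp: icoord_diff[OF basis])

text \<open>
  The weights of all vertices add up to \<open>0\<close>, since the sum of the vertices has vanishing coordinates
  on \<open>I\<close>; adding the weights makes the contributions of \<open>B\<close> and of level \<open>0\<close> cancel.
\<close>

lemma card_level0_flipped:
  assumes I: "flippable B I"
  shows "int (card (level0 (flipped B I))) = int (card (level0 B)) +
    (\<Sum>x\<in>level_neg1 B. (if weight B I x = -1 then 1 else 0) + weight B I x)"
proof -
  have IB: "I \<subseteq> B" and IT: "I \<subseteq> clean B" and ind: "\<And>i. i \<in> I \<Longrightarrow> succ B i \<notin> I"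
    using I clean_subset by (auto simp: flippable_def)
  have finI: "finite I" using finite_subset[OF IB fin] .
  define X where "X = weight B I"
  \<comment> \<open>The first two terms record membership in level 0 after and before the flips. On
    \<open>B\<close> the value is 2 at elements of \<open>I\<close> and 0 elsewhere; on level 0 it
    is -2 at the entering vertices and 0 elsewhere.\<close>
  define f where "f v = (if level B v = X v then 1 else 0) - (if level B v = 0 then 1 else 0) + X v" for v
  have "(\<Sum>v\<in>V. X v) = (\<Sum>i\<in>I. \<Sum>v\<in>V. icoord B v i)"
    unfolding X_def weight_def by (rule sum.swap)
  also have "\<dots> = (\<Sum>i\<in>I. icoord B (\<Sum>V) i)"
    using IB by (intro sum.cong refl icoord_sum[OF basis, symmetric]) (auto simp: V_lat)
  also have "\<dots> = 0" using IT cleanD(2) by (intro sum.neutral) auto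
  finally have X0: "(\<Sum>v\<in>V. X v) = 0" .
  have l0: "level0 (flipped B I) = {v\<in>V. level B v = X v}"
    using flipped_props[OF I] V_lat by (auto simp: level0_def X_def)
  have "(\<Sum>v\<in>V. f v) = int (card {v\<in>V. level B v = X v}) - int (card (level0 B)) + (\<Sum>v\<in>V. X v)"
    unfolding f_def sum.distrib sum_subtractf level0_def using finite_V by (simp add: sum.inter_filter[symmetric])
  then have 1: "(\<Sum>v\<in>V. f v) = int (card (level0 (flipped B I))) - int (card (level0 B))"
    by (simp add: X0 l0)
  have "(\<Sum>v\<in>B. f v) = (\<Sum>v\<in>B. if v \<in> I then 2 else 0)"
    using weight_basis[OF IB] level_basis[OF basis] by (intro sum.cong) (auto simp: f_def X_def)
  also have "\<dots> = 2 * int (card I)"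
    using fin IB by (simp add: sum.If_cases Int_absorb1)
  finally have 2: "(\<Sum>v\<in>B. f v) = 2 * int (card I)" .
  have Xexc: "X v = 0" if "v \<in> exceptional B" for v
    unfolding X_def weight_def using that IT cleanD(7) by (intro sum.neutral) auto
  have 3: "(\<Sum>v\<in>low B. f v) = 0"
    using Xexc by (intro sum.neutral) (auto simp: f_def exceptional_def low_def)
  define J where "J = (\<lambda>i. succ B i - i) ` I"
  have nJ: "neg B (succ B i - i) = {i}" "succ B i - i \<in> level0 B" if "i \<in> I" for i
    using simple_props[OF B] cleanD(1,4,5,6)[of i] that IT by auto
  have inj: "inj_on (\<lambda>i. succ B i - i) I"
    by (rule inj_onI) (metis nJ(1) singleton_inject)
  have "f v = (if v \<in> J then -2 else 0)" if v: "v \<in> level0 B" for v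
  proof (cases "card (neg B v) = 1")
    case False
    then have "v \<notin> J" using nJ by (auto simp: J_def)
    moreover have "X v = 0" using Xexc v False by (simp add: exceptional_def)
    ultimately show ?thesis using v by (simp add: f_def level0_def)
  next
    case True
    then obtain b b' where b: "b \<in> B" "succs B b b'" "v = b' - b"
      using simple0_rep[OF S, of v] v by (auto simp: simple0_def)
    have b': "b' \<in> B" "b' \<noteq> b" "b' - b \<in> V" using b(2) by (auto simp: succs_def)
    have Xv: "X v = (if b' \<in> I then 1 else 0) - (if b \<in> I then 1 else 0)"
      unfolding X_def b(3) using weight_diff[OF IB lat lat] weight_basis[OF IB] b b' by simp
    have sb: "succ B b = b'" by (rule succ_eq[OF S b(1,2)])
    have "v \<in> J \<longleftrightarrow> b \<in> I"
    proof
      assume "v \<in> J"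
      then obtain i where "i \<in> I" "v = succ B i - i" by (auto simp: J_def)
      then have "{b} = {i}" using nJ(1) simple_props(2)[OF B b(1) b'] b(3) by simp
      then show "b \<in> I" using \<open>i \<in> I\<close> by simp
    qed (use sb b(3) in \<open>auto simp: J_def\<close>)
    moreover have "b' \<notin> I" if "b \<in> I" using ind[OF that] sb by simp
    ultimately show ?thesis using v Xv by (auto simp: f_def level0_def)
  qed
  then have "(\<Sum>v\<in>level0 B. f v) = (\<Sum>v\<in>level0 B. if v \<in> J then -2 else 0)" by (intro sum.cong) auto
  also have "\<dots> = -2 * int (card J)"
  proof -
    have "J \<subseteq> level0 B" using nJ by (auto simp: J_def)
    then show ?thesis by (simp add: sum.If_cases Int_absorb1)
  qed
  also have "card J = card I" unfolding J_def by (rule card_image[OF inj])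
  finally have 4: "(\<Sum>v\<in>level0 B. f v) = -2 * int (card I)" .
  have 5: "(\<Sum>v\<in>level_neg1 B. f v) = (\<Sum>x\<in>level_neg1 B. (if X x = -1 then 1 else 0) + X x)"
    by (intro sum.cong) (auto simp: f_def level_neg1_def)
  show ?thesis
    using 1 2 3 4 5 sum_partition[OF S, of f] by (simp add: X_def)
qed

lemma clean_level_neg1_ge:
  assumes "i \<in> clean B" "x \<in> level_neg1 B" shows "icoord B x i \<ge> -1"
  using icoord_ge_level[OF B simple_props(1)[OF B cleanD(1,4,5,6)[OF assms(1)]] cleanD(1)[OF assms(1)]
    simple_props(3)[OF B cleanD(1,4,5,6)[OF assms(1)]], of x] assms(2)
  by (auto simp: level_neg1_def)

section \<open>Consequences of a largest level 0\<close>

context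
  assumes max: "\<forall>B'. special B' \<longrightarrow> card (level0 B') \<le> card (level0 B)"
begin

text \<open>In the flip at \<open>i\<close> alone, each vertex of level -1 contributes a nonnegative
  amount to the growth of level 0, positive exactly if its coordinate at \<open>i\<close> is
  positive. Maximality makes all contributions vanish.\<close>

lemma clean_level_neg1_le:
  assumes i: "i \<in> clean B" and x: "x \<in> level_neg1 B" shows "icoord B x i \<le> 0"
proof -
  define f where "f x = (if icoord B x i = -1 then 1 else 0) + icoord B x i" for x
  have fl: "flippable B {i}" using i cleanD(5)[OF i] by (auto simp: flippable_def)
  have w: "weight B {i} y = icoord B y i" for y by (simp add: weight_def)
  have "card (level0 (flipped B {i})) \<le> card (level0 B)"
    using max flipped_props[OF fl] by blast
  then have "(\<Sum>x\<in>level_neg1 B. f x) \<le> 0"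
    using card_level0_flipped[OF fl] by (simp add: w f_def)
  moreover have nn: "f y \<ge> 0" if "y \<in> level_neg1 B" for y
    using clean_level_neg1_ge[OF i that] by (auto simp: f_def)
  ultimately have "(\<Sum>x\<in>level_neg1 B. f x) = 0" using sum_nonneg[of "level_neg1 B" f] by force
  then have "f x = 0" using sum_nonneg_eq_0_iff[of "level_neg1 B" f] nn x by simp
  then show ?thesis by (auto simp: f_def split: if_splits)
qed

lemma clean_level_neg1_cases:
  assumes i: "i \<in> clean B" and x: "x \<in> level_neg1 B" shows "icoord B x i = 0 \<or> icoord B x i = -1"
  using clean_level_neg1_ge[OF assms] clean_level_neg1_le[OF assms] by linarith

text \<open>The coordinates at \<open>i\<close> of all vertices sum to 0. Here \<open>i\<close> and
  \<open>succ B i - i\<close> cancel, each predecessor \<open>j\<close> contributes 1 through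
  \<open>i - j\<close>, and vertices of level -1 contribute only 0 or -1.\<close>

lemma card_preds:
  assumes i: "i \<in> clean B"
  shows "card {x\<in>level_neg1 B. icoord B x i = -1} = card (preds B i)"
proof -
  note ci = cleanD[OF i]
  define P where "P = (\<lambda>j. i - j) ` preds B i"
  have cP: "card P = card (preds B i)"
    unfolding P_def by (rule card_image) (auto simp: inj_on_def)
  have Pp: "i - j \<in> level0 B" "neg B (i - j) = {j}" "icoord B (i - j) i = 1" if "j \<in> preds B i" for j
    using that simple_props[OF B, of j i] diff_coord[OF B, of j i i] by (auto simp: preds_def succs_def)
  note si = simple_props[OF B ci(1,4,5,6)]
  have siv: "icoord B (succ B i - i) i = -1" using level0_flip(1)[OF B si(1) ci(1) si(3)] .
  have "icoord B v i = (if v \<in> P then 1 else 0) - (if v = succ B i - i then 1 else 0)"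
    if v: "v \<in> level0 B" for v
  proof (cases "card (neg B v) = 1")
    case False
    then have "v \<notin> P" "v \<noteq> succ B i - i" using Pp si by (auto simp: P_def)
    moreover have "icoord B v i = 0" using ci(7) v False by (simp add: exceptional_def)
    ultimately show ?thesis by simp
  next
    case True
    then obtain b b' where b: "b \<in> B" "succs B b b'" "v = b' - b"
      using simple0_rep[OF S, of v] v by (auto simp: simple0_def)
    have b': "b' \<in> B" "b' \<noteq> b" "b' - b \<in> V" using b(2) by (auto simp: succs_def)
    have vi: "icoord B v i = (if i = b' then 1 else 0) - (if i = b then 1 else 0)"
      using diff_coord[OF B b(1) b'(1) ci(1)] b(3) by simp
    have nb: "neg B v = {b}" using simple_props(2)[OF B b(1) b'] b(3) by simp
    have "v \<in> P \<longleftrightarrow> i = b'"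
    proof
      assume "v \<in> P"
      then have "icoord B v i = 1" using Pp by (auto simp: P_def)
      then show "i = b'" using vi by (auto split: if_splits)
    qed (use b in \<open>auto simp: P_def preds_def\<close>)
    moreover have "v = succ B i - i \<longleftrightarrow> i = b"
    proof
      assume "v = succ B i - i"
      then show "i = b" using nb si(2) by simp
    qed (use b(3) succ_eq[OF S b(1,2)] in simp)
    ultimately show ?thesis using vi by simp
  qed
  then have "(\<Sum>v\<in>level0 B. icoord B v i) = (\<Sum>v\<in>level0 B. (if v \<in> P then 1 else 0) - (if v = succ B i - i then 1 else 0))"
    by (intro sum.cong) auto
  also have "\<dots> = int (card P) - 1"
  proof -
    have "P \<subseteq> level0 B" using Pp by (auto simp: P_def)
    then have "(\<Sum>v\<in>level0 B. if v \<in> P then 1 else 0) = int (card P)"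
      by (simp add: sum.If_cases Int_absorb1)
    moreover have "(\<Sum>v\<in>level0 B. if v = succ B i - i then 1 else (0 :: int)) = 1"
      using si(1) by simp
    ultimately show ?thesis by (simp add: sum_subtractf)
  qed
  finally have 0: "(\<Sum>v\<in>level0 B. icoord B v i) = int (card P) - 1" .
  have "(\<Sum>v\<in>level_neg1 B. icoord B v i) = (\<Sum>v\<in>level_neg1 B. if icoord B v i = -1 then -1 else 0)"
    using clean_level_neg1_cases[OF i] by (intro sum.cong) auto
  also have "\<dots> = - int (card {x\<in>level_neg1 B. icoord B x i = -1})"
    by (simp add: sum.inter_filter[symmetric])
  finally have 1: "(\<Sum>v\<in>level_neg1 B. icoord B v i) = - int (card {x\<in>level_neg1 B. icoord B x i = -1})" .
  have 2: "(\<Sum>v\<in>low B. icoord B v i) = 0"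
    using ci(7) by (intro sum.neutral) (auto simp: exceptional_def)
  have "(\<Sum>v\<in>B. icoord B v i) = (\<Sum>v\<in>B. if v = i then 1 else 0)"
    using ci(1) by (intro sum.cong) (auto simp: icoord_basis[OF basis])
  then have 3: "(\<Sum>v\<in>B. icoord B v i) = 1" using ci(1) fin by simp
  have "icoord B (\<Sum>V) i = (\<Sum>v\<in>V. icoord B v i)"
    by (rule icoord_sum[OF basis _ ci(1)]) (rule V_lat)
  then show ?thesis using ci(2) sum_partition[OF S, of "\<lambda>v. icoord B v i"] 0 1 2 3 cP by simp
qed

lemma weight_nonpos:
  assumes "I \<subseteq> clean B" "x \<in> level_neg1 B" shows "weight B I x \<le> 0"
  unfolding weight_def using assms clean_level_neg1_le by (intro sum_nonpos) auto

text \<open>Each vertex of weight at most -2 costs level 0 at least one element, and level 0 can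
  shrink by at most \<open>k\<close>. A vertex of weight -1 reaches level 0 of the flipped facet,
  where at most \<open>k\<close> vertices are non-simple; a simple one is regular.\<close>

lemma card_irregular:
  assumes I: "flippable B I"
  shows "card (irregular B I) \<le> 2 * k"
proof -
  have IB: "I \<subseteq> B" and IT: "I \<subseteq> clean B" and ind: "\<And>i. i \<in> I \<Longrightarrow> succ B i \<notin> I"
    using I clean_subset by (auto simp: flippable_def)
  have S': "special (flipped B I)" using flipped_props[OF I] by simp
  note B' = special_facet[OF S']
  define M where "M = {x\<in>level_neg1 B. weight B I x \<le> -2}"
  define f where "f x = (if weight B I x = -1 then 1 else 0) + weight B I x" for x
  have "(\<Sum>x\<in>level_neg1 B. f x) \<ge> - int k"
    using card_level0_flipped[OF I] card_level0_le[OF S] card_level0[OF S'] unfolding f_def by linarith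
  moreover have "(\<Sum>x\<in>level_neg1 B. f x) \<le> (\<Sum>x\<in>level_neg1 B. if x \<in> M then -1 else 0)"
    using weight_nonpos[OF IT] by (intro sum_mono) (force simp: f_def M_def)
  moreover have "(\<Sum>x\<in>level_neg1 B. if x \<in> M then -1 else 0) = - int (card M)"
  proof -
    have "M \<subseteq> level_neg1 B" by (auto simp: M_def)
    then show ?thesis by (simp add: sum.If_cases Int_absorb1)
  qed
  ultimately have M: "card M \<le> k" by linarith
  have "irregular B I \<subseteq> M \<union> {v\<in>level0 (flipped B I). card (neg (flipped B I) v) \<noteq> 1}"
  proof
    fix x assume x: "x \<in> irregular B I"
    then have x1: "x \<in> level_neg1 B" "weight B I x < 0" and nx: "\<not> (\<exists>i\<in>I. \<exists>j\<in>B - I. x = succ B i - i - j)"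
      by (auto simp: irregular_def)
    have xV: "x \<in> V" and lx: "level B x = -1" using x1 by (auto simp: level_neg1_def)
    show "x \<in> M \<union> {v\<in>level0 (flipped B I). card (neg (flipped B I) v) \<noteq> 1}"
    proof (cases "weight B I x = -1")
      case False
      then show ?thesis using x1 by (auto simp: M_def)
    next
      case True
      then have x0: "x \<in> level0 (flipped B I)"
        using flipped_props[OF I] xV V_lat lx by (auto simp: level0_def)
      have "card (neg (flipped B I) x) \<noteq> 1"
      proof
        assume "card (neg (flipped B I) x) = 1"
        then obtain g g' where g: "g \<in> flipped B I" "g' \<in> flipped B I" "x = g' - g"
          by (rule simple_rep[OF B' x0])
        have lv: "(h \<in> B - I \<and> level B h = 1) \<or> (\<exists>i\<in>I. h = succ B i - i \<and> level B h = 0)" "h \<in> int_lattice d"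
          if h: "h \<in> flipped B I" for h
        proof -
          show "h \<in> int_lattice d" using h facet_lat[OF B'] by simp
          consider "h \<in> B - I" | i where "i \<in> I" "h = succ B i - i"
            using h by (auto simp: flipped_def)
          then show "(h \<in> B - I \<and> level B h = 1) \<or> (\<exists>i\<in>I. h = succ B i - i \<and> level B h = 0)"
          proof cases
            case 1
            then show ?thesis using level_basis[OF basis] by simp
          next
            case 2
            then have "i \<in> clean B" using IT by auto
            then have "level B h = 0"
              using simple_props(1)[OF B cleanD(1,4,5,6)] 2 by (simp add: level0_def)
            then show ?thesis using 2 by blast
          qed
        qed
        \<comment> \<open>Elements of the flipped facet have level 0 or 1 in \<open>B\<close>, so a
          difference of level -1 is an entering element minus an old one.\<close>
        have "level B g' - level B g = -1"
          using level_diff[OF basis lv(2)[OF g(2)] lv(2)[OF g(1)]] lx g(3) by simp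
        moreover have "level B g' = 0 \<or> level B g' = 1" "level B g = 0 \<or> level B g = 1"
          using lv(1)[OF g(1)] lv(1)[OF g(2)] by blast+
        ultimately have "level B g' = 0" "level B g = 1" by auto
        then have "g \<in> B - I" "\<exists>i\<in>I. g' = succ B i - i"
          using lv(1)[OF g(1)] lv(1)[OF g(2)] by simp_all
        then show False using nx g(3) by blast
      qed
      then show ?thesis using x0 by simp
    qed
  qed
  then have "card (irregular B I) \<le> card (M \<union> {v\<in>level0 (flipped B I). card (neg (flipped B I) v) \<noteq> 1})"
    by (rule card_mono[rotated]) (simp add: M_def)
  also have "\<dots> \<le> card M + card {v\<in>level0 (flipped B I). card (neg (flipped B I) v) \<noteq> 1}"
    by (rule card_Un_le)
  finally show ?thesis using M card_nonsimple[OF S'] by linarith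
qed

end

end

end

section \<open>The counting argument that produces a hexagon\<close>

context many_vertices
begin

text \<open>Bounds the number of integer vectors on the dirty coordinates with entries from -2 to
  \<open>2 * dirty_bound\<close>. The lower limit is \<open>icoord_ge\<close> at level -1; the upper
  one follows as the entries sum to -1.\<close>

definition dirty_level_neg1_bound :: nat where
  "dirty_level_neg1_bound = (2 * dirty_bound + 3) ^ dirty_bound"

text \<open>Four irregular sets of at most \<open>2 * k\<close> vertices, the vertices of level -1
  vanishing on all clean elements, and the \<open>2 * k\<close> by which level -1 may fall short of
  \<open>d\<close>.\<close>

definition loss :: nat where "loss = 8 * k + dirty_level_neg1_bound + 2 * k"

text \<open>The extra term bounds the vertices \<open>succ B i - i - j\<close> with \<open>j\<close>
  dirty and \<open>i\<close> one of the at most \<open>loss\<close> clean elements with dirty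
  successor.\<close>

definition total_loss :: nat where "total_loss = loss + loss * dirty_bound"

context
  fixes B assumes S: "special B"
    and max: "\<forall>B'. special B' \<longrightarrow> card (level0 B') \<le> card (level0 B)"
  notes B = special_facet[OF S]
  notes basis = facet_basis[OF B]
  notes fin = facet_finite[OF B]
  notes lat = facet_lat[OF B]
  notes clean = cleanD[OF S]
  notes cases1 = clean_level_neg1_cases[OF S max]
begin

lemma card_dirty_level_neg1:
  "card {x\<in>level_neg1 B. \<forall>i\<in>clean B. icoord B x i = 0} \<le> dirty_level_neg1_bound"
proof -
  define K where "K = B - clean B"
  define D where "D = {x\<in>level_neg1 B. \<forall>i\<in>clean B. icoord B x i = 0}"
  define N where "N = {-2 .. 2 * int dirty_bound}"
  have finK: "finite K" using fin by (simp add: K_def)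
  have cK: "card K \<le> dirty_bound" unfolding K_def by (rule card_dirty[OF S])
  have DV: "x \<in> V" "level B x = -1" if "x \<in> D" for x using that by (auto simp: D_def level_neg1_def)
  have inj: "inj_on (\<lambda>x. restrict (icoord B x) K) D"
  proof (rule inj_onI)
    fix x y assume xy: "x \<in> D" "y \<in> D" and eq: "restrict (icoord B x) K = restrict (icoord B y) K"
    show "x = y"
    proof (rule icoord_eqI[OF basis V_lat V_lat])
      show "x \<in> V" "y \<in> V" using xy DV by auto
      fix b assume "b \<in> B"
      then show "icoord B x b = icoord B y b"
        using xy fun_cong[OF eq, of b] by (cases "b \<in> K") (auto simp: D_def K_def)
    qed
  qed
  have im: "(\<lambda>x. restrict (icoord B x) K) ` D \<subseteq> K \<rightarrow>\<^sub>E N"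
  proof -
    have "icoord B x b \<in> N" if x: "x \<in> D" and b: "b \<in> K" for x b
    proof -
      have ge: "icoord B x j \<ge> -2" if "j \<in> B" for j
        using icoord_ge[OF B DV(1)[OF x] that] DV(2)[OF x] by simp
      have "-1 = (\<Sum>j\<in>B. icoord B x j)" using DV(2)[OF x] by (simp add: level_def)
      also have "\<dots> = (\<Sum>j\<in>K. icoord B x j)"
        using fin x by (intro sum.mono_neutral_right) (auto simp: K_def D_def)
      also have "\<dots> = icoord B x b + (\<Sum>j\<in>K - {b}. icoord B x j)"
        by (rule sum.remove[OF finK b])
      finally have eq: "icoord B x b = -1 - (\<Sum>j\<in>K - {b}. icoord B x j)" by simp
      have "(\<Sum>j\<in>K - {b}. icoord B x j) \<ge> (\<Sum>j\<in>K - {b}. -2)"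
        using ge by (intro sum_mono) (auto simp: K_def)
      moreover have "(\<Sum>j\<in>K - {b}. -2 :: int) = -2 * int (card (K - {b}))" by simp
      moreover have "card (K - {b}) \<le> dirty_bound"
        using cK card_Diff1_le[of K b] by linarith
      ultimately have "icoord B x b \<le> 2 * int dirty_bound" using eq by linarith
      then show ?thesis using ge[of b] b by (simp add: N_def K_def)
    qed
    then show ?thesis by auto
  qed
  have "card D = card ((\<lambda>x. restrict (icoord B x) K) ` D)" by (rule card_image[OF inj, symmetric])
  also have "\<dots> \<le> card (K \<rightarrow>\<^sub>E N)"
    by (rule card_mono[OF _ im]) (simp add: finK finite_PiE N_def)
  also have "\<dots> = (2 * dirty_bound + 3) ^ card K"
  proof -
    have "card N = 2 * dirty_bound + 3" unfolding N_def by simp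
    then show ?thesis using finK by (simp add: card_PiE)
  qed
  also have "\<dots> \<le> dirty_level_neg1_bound"
    unfolding dirty_level_neg1_bound_def using cK by (intro power_increasing) auto
  finally show ?thesis by (simp add: D_def)
qed

lemma sum_card_preds:
  assumes "A \<subseteq> B"
  shows "(\<Sum>i\<in>A. card (preds B i)) = card {j\<in>B. \<exists>i\<in>A. succs B j i}"
proof -
  have "(\<Sum>i\<in>A. card (preds B i)) = card (\<Union>i\<in>A. preds B i)"
    using succs_unique[OF S] finite_subset[OF assms fin] fin
    by (intro card_UN_disjoint[symmetric]) (auto simp: preds_def)
  also have "(\<Union>i\<in>A. preds B i) = {j\<in>B. \<exists>i\<in>A. succs B j i}"
    by (auto simp: preds_def)
  finally show ?thesis .
qed

text \<open>Up to \<open>total_loss\<close> exceptions, \<open>- i\<close> is a vertex, so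
  \<open>i\<close> has at least one predecessor; the numbers of predecessors sum to at most
  \<open>d\<close>, so all but \<open>2 * total_loss\<close> elements have exactly one. These
  elements and their predecessors are two sets of equal size, together exceeding \<open>d\<close>,
  so they meet. This is the origin of the factor 4.\<close>

lemma good_pair:
  assumes large: "4 * total_loss < d"
  shows "\<exists>i\<in>clean B. succ B i \<in> clean B \<and> - i \<in> V \<and> - succ B i \<in> V \<and>
    card (preds B i) = 1 \<and> card (preds B (succ B i)) = 1"
proof -
  define T where "T = clean B"
  define K where "K = B - T"
  define T2 where "T2 = {i\<in>T. succ B i \<in> T}"
  define R where "R = T - T2"
  define Y where "Y = {i\<in>T2. - i \<in> V}"
  define a where "a i = card (preds B i)" for i
  have TB: "T \<subseteq> B" unfolding T_def by (rule clean_subset[OF S])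
  have finT: "finite T" using finite_subset[OF TB fin] .
  have finT2: "finite T2" "finite R" "finite K" "finite Y"
    using finT fin by (auto simp: T2_def R_def K_def Y_def)
  have cK: "card K \<le> dirty_bound" unfolding K_def T_def by (rule card_dirty[OF S])
  have "\<And>i. i \<in> T2 \<Longrightarrow> succ B i \<noteq> i" using clean(5) by (auto simp: T2_def T_def)
  from three_coloring[OF finT2(1) this] obtain col :: "rvec \<Rightarrow> nat"
    where col: "\<And>i. i \<in> T2 \<Longrightarrow> col i < 3 \<and> (succ B i \<in> T2 \<longrightarrow> col (succ B i) \<noteq> col i)"
    by blast
  define I where "I q = {i\<in>T2. col i = q}" for q
  have flI: "flippable B (I q)" for q
    using col by (auto simp: flippable_def I_def T2_def T_def)
  \<comment> \<open>Successors of elements of \<open>R\<close> are dirty, hence outside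
    \<open>R\<close>.\<close>
  have flR: "flippable B R"
    by (auto simp: flippable_def R_def T2_def T_def)
  define Exc where "Exc = irregular B (I 0) \<union> irregular B (I 1) \<union> irregular B (I 2) \<union> irregular B R"
  have cExc: "card Exc \<le> 8 * k"
  proof -
    have "card Exc \<le> card (irregular B (I 0)) + card (irregular B (I 1)) + card (irregular B (I 2)) + card (irregular B R)"
      unfolding Exc_def
      using card_Un_le[of "irregular B (I 0)" "irregular B (I 1)"]
        card_Un_le[of "irregular B (I 0) \<union> irregular B (I 1)" "irregular B (I 2)"]
        card_Un_le[of "irregular B (I 0) \<union> irregular B (I 1) \<union> irregular B (I 2)" "irregular B R"]
      by linarith
    then show ?thesis
      using card_irregular[OF S max flI[of 0]] card_irregular[OF S max flI[of 1]]
        card_irregular[OF S max flI[of 2]] card_irregular[OF S max flR]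
      by linarith
  qed
  define D where "D = {x\<in>level_neg1 B. \<forall>i\<in>T. icoord B x i = 0}"
  have cD: "card D \<le> dirty_level_neg1_bound" unfolding D_def T_def by (rule card_dirty_level_neg1)
  define W where "W = {x\<in>level_neg1 B. \<exists>i\<in>R. \<exists>j\<in>K. x = succ B i - i - j}"
  have coord3: "icoord B (succ B i - i - j) l = (if l = succ B i then 1 else 0) - (if l = i then 1 else 0) - (if l = j then 1 else 0)"
    if "i \<in> T" "j \<in> B" "l \<in> B" for i j l
  proof -
    have i: "i \<in> B" "succ B i \<in> B" using clean(1,4) that(1) by (auto simp: T_def)
    have "icoord B (succ B i - i - j) l = icoord B (succ B i - i) l - icoord B j l"
      by (rule icoord_diff[OF basis int_lattice_diff[OF lat[OF i(2)] lat[OF i(1)]] lat[OF that(2)] that(3)])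
    then show ?thesis
      using diff_coord[OF B i that(3)] icoord_basis[OF basis that(2,3)] by auto
  qed
  have cover: "level_neg1 B \<subseteq> Exc \<union> D \<union> uminus ` Y \<union> W"
  proof
    fix x assume x: "x \<in> level_neg1 B"
    have xV: "x \<in> V" using x by (simp add: level_neg1_def)
    have c: "icoord B x i = 0 \<or> icoord B x i = -1" if "i \<in> T" for i
      using cases1 x that by (auto simp: T_def)
    have wneg: "weight B J x < 0" if "J \<subseteq> T" "i \<in> J" "icoord B x i \<noteq> 0" for i J
    proof -
      have "weight B J x = icoord B x i + (\<Sum>j\<in>J - {i}. icoord B x j)"
        unfolding weight_def using finite_subset[OF that(1) finT] that(2) by (rule sum.remove)
      moreover have "(\<Sum>j\<in>J - {i}. icoord B x j) \<le> 0"
        using c that(1) by (intro sum_nonpos) force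
      moreover have "icoord B x i = -1" using c that by auto
      ultimately show ?thesis by linarith
    qed
    have inT2: "x \<in> uminus ` Y" if i: "i \<in> T2" "icoord B x i \<noteq> 0" and nE: "x \<notin> Exc" for i
    proof -
      define q where "q = col i"
      have "q < 3" using col[OF i(1)] by (simp add: q_def)
      then have "q \<in> {0, 1, 2}" by auto
      then have "x \<notin> irregular B (I q)" using nE by (auto simp: Exc_def)
      moreover have "weight B (I q) x < 0"
        using i by (intro wneg[of _ i]) (auto simp: I_def q_def T2_def)
      ultimately obtain i' j where ij: "i' \<in> I q" "j \<in> B" "x = succ B i' - i' - j"
        using x by (auto simp: irregular_def)
      have i': "i' \<in> T" "succ B i' \<in> T" using ij(1) by (auto simp: I_def T2_def)
      have "succ B i' \<noteq> i'" using clean(5) i' by (auto simp: T_def)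
      then have "icoord B x (succ B i') = 1 - (if succ B i' = j then 1 else 0)"
        using coord3[OF i'(1) ij(2), of "succ B i'"] i' TB ij(3) by auto
      \<comment> \<open>The coordinate at the clean element \<open>succ B i'\<close> cannot be
        1.\<close>
      then have "j = succ B i'" using c[OF i'(2)] by (auto split: if_splits)
      then have "x = - i'" using ij(3) by simp
      then show ?thesis using xV ij(1) by (auto simp: Y_def I_def)
    qed
    show "x \<in> Exc \<union> D \<union> uminus ` Y \<union> W"
    proof (cases "x \<in> Exc \<or> x \<in> D \<or> x \<in> uminus ` Y")
      case True
      then show ?thesis by auto
    next
      case False
      then have z: "icoord B x i = 0" if "i \<in> T2" for i using inT2[OF that] by auto
      obtain i where i: "i \<in> T" "icoord B x i \<noteq> 0" using False x by (auto simp: D_def)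
      have iR: "i \<in> R" using i z by (auto simp: R_def)
      have "weight B R x < 0" using iR i by (intro wneg[of _ i]) (auto simp: R_def)
      then obtain i' j where ij: "i' \<in> R" "j \<in> B" "j \<notin> R" "x = succ B i' - i' - j"
        using x False by (auto simp: irregular_def Exc_def)
      have i': "i' \<in> T" "succ B i' \<notin> T" using ij(1) by (auto simp: R_def T2_def)
      have "j \<notin> T"
      proof
        assume "j \<in> T"
        then have jT2: "j \<in> T2" using ij(3) by (auto simp: R_def)
        then have "j \<noteq> succ B i'" "j \<noteq> i'" using i' \<open>j \<in> T\<close> ij by auto
        then have "icoord B x j = -1" using coord3[OF i'(1) ij(2) ij(2)] ij(4) by simp
        then show False using z[OF jT2] by simp
      qed
      then show ?thesis using ij x by (auto simp: W_def K_def)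
    qed
  qed
  have finW: "finite W" "finite D" "finite Exc" by (auto simp: W_def D_def Exc_def irregular_def)
  have "card (level_neg1 B) \<le> card (Exc \<union> D \<union> uminus ` Y \<union> W)"
    using cover by (rule card_mono[rotated]) (use finW finT2 in simp)
  also have "\<dots> \<le> card (Exc \<union> D \<union> uminus ` Y) + card W" by (rule card_Un_le)
  also have "card (Exc \<union> D \<union> uminus ` Y) \<le> card (Exc \<union> D) + card (uminus ` Y)" by (rule card_Un_le)
  also have "card (Exc \<union> D) \<le> card Exc + card D" by (rule card_Un_le)
  also have "card (uminus ` Y) \<le> card Y" by (rule card_image_le[OF finT2(4)])
  finally have "card (level_neg1 B) \<le> 8 * k + dirty_level_neg1_bound + card Y + card W"
    using cExc cD by linarith
  then have main: "d \<le> loss + card Y + card W"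
    using card_level_neg1[OF S] unfolding loss_def by linarith
  have a_eq: "card {x\<in>level_neg1 B. icoord B x i = -1} = a i" if "i \<in> T" for i
    unfolding a_def using card_preds[OF S max] that by (simp add: T_def)
  have Wa: "card W \<le> (\<Sum>i\<in>R. a i)"
  proof -
    have "W \<subseteq> (\<Union>i\<in>R. {x\<in>level_neg1 B. icoord B x i = -1})"
    proof
      fix x assume "x \<in> W"
      then obtain i j where ij: "x \<in> level_neg1 B" "i \<in> R" "j \<in> K" "x = succ B i - i - j" by (auto simp: W_def)
      have i: "i \<in> T" using ij(2) by (simp add: R_def)
      then have "i \<noteq> succ B i" using clean(5)[of i] by (auto simp: T_def)
      then have "icoord B x i = -1"
        using coord3[OF i, of j i] ij i TB by (auto simp: K_def)
      then show "x \<in> (\<Union>i\<in>R. {x\<in>level_neg1 B. icoord B x i = -1})" using ij by auto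
    qed
    then have "card W \<le> card (\<Union>i\<in>R. {x\<in>level_neg1 B. icoord B x i = -1})"
      by (rule card_mono[rotated]) (use finT2 in auto)
    also have "\<dots> \<le> (\<Sum>i\<in>R. card {x\<in>level_neg1 B. icoord B x i = -1})"
      by (rule card_UN_le[OF finT2(2)])
    also have "\<dots> = (\<Sum>i\<in>R. a i)" by (intro sum.cong) (auto simp: a_eq R_def)
    finally show ?thesis .
  qed
  have Ya: "a i \<ge> 1" if i: "i \<in> Y" for i
  proof -
    have iT: "i \<in> T" "i \<in> B" using i TB by (auto simp: Y_def T2_def)
    have "- i \<in> level_neg1 B"
      using i level_uminus[OF basis lat[OF iT(2)]] level_basis[OF basis iT(2)] by (auto simp: Y_def level_neg1_def)
    moreover have "icoord B (- i) i = -1"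
      using icoord_uminus[OF basis lat[OF iT(2)] iT(2)] icoord_basis[OF basis iT(2) iT(2)] by simp
    ultimately have "card {x\<in>level_neg1 B. icoord B x i = -1} \<noteq> 0" by auto
    then show ?thesis using a_eq[OF iT(1)] by simp
  qed
  have YT: "Y \<subseteq> T" "Y \<inter> R = {}" "R \<subseteq> T" by (auto simp: Y_def T2_def R_def)
  have YA: "card Y \<le> (\<Sum>i\<in>Y. a i)"
    using sum_mono[of Y "\<lambda>_. 1" a] Ya by simp
  have "(\<Sum>i\<in>Y. a i) + (\<Sum>i\<in>R. a i) = (\<Sum>i\<in>Y \<union> R. a i)"
    using YT finT2 by (intro sum.union_disjoint[symmetric]) auto
  also have "\<dots> \<le> (\<Sum>i\<in>T. a i)" using YT finT by (intro sum_mono2) auto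
  also have "(\<Sum>i\<in>T. a i) = card {j\<in>B. \<exists>i\<in>T. succs B j i}"
    unfolding a_def by (rule sum_card_preds[OF TB])
  \<comment> \<open>The successor of an element of \<open>R\<close> is not clean, so that element
    precedes nothing in \<open>T\<close>.\<close>
  also have "\<dots> \<le> card (B - R)"
  proof (rule card_mono)
    show "{j\<in>B. \<exists>i\<in>T. succs B j i} \<subseteq> B - R"
      using succ_eq[OF S] by (fastforce simp: R_def T2_def)
  qed (use fin in simp)
  also have "\<dots> = d - card R"
    using finT2 YT TB facet_card[OF B] by (subst card_Diff_subset) auto
  finally have aT: "(\<Sum>i\<in>Y. a i) + (\<Sum>i\<in>R. a i) \<le> d - card R" .
  have cRB: "card R \<le> d" using card_mono[OF fin, of R] YT TB facet_card[OF B] by auto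
  \<comment> \<open>In \<open>main\<close> the sizes of \<open>Y\<close> and \<open>W\<close> are
    bounded by the two sums, which total at most \<open>d - card R\<close>; then \<open>d\<close>
    cancels.\<close>
  have cR: "card R \<le> loss" using main Wa YA aT cRB by linarith
  have "W \<subseteq> (\<lambda>(i, j). succ B i - i - j) ` (R \<times> K)" by (auto simp: W_def)
  then have "card W \<le> card (R \<times> K)" using finT2 by (intro surj_card_le) auto
  also have "\<dots> = card R * card K" by (rule card_cartesian_product)
  also have "\<dots> \<le> loss * dirty_bound" using cR cK by (rule mult_le_mono)
  finally have cY: "d \<le> total_loss + card Y" using main unfolding total_loss_def by linarith
  define Y1 where "Y1 = {i\<in>Y. a i = 1}"
  have finY1: "finite Y1" "Y1 \<subseteq> B" using finT2 YT TB by (auto simp: Y1_def)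
  have "card Y + card (Y - Y1) \<le> (\<Sum>i\<in>Y. a i)"
  proof -
    have "card Y + card (Y - Y1) = (\<Sum>i\<in>Y. 1 + (if i \<in> Y - Y1 then 1 else 0))"
      unfolding sum.distrib using finT2 by (simp add: sum.If_cases Int_absorb1 Diff_subset del: Diff_iff)
    also have "\<dots> \<le> (\<Sum>i\<in>Y. a i)"
      using Ya by (intro sum_mono) (force simp: Y1_def)
    finally show ?thesis .
  qed
  moreover have "card (Y - Y1) = card Y - card Y1"
    using finY1 by (intro card_Diff_subset) (auto simp: Y1_def)
  moreover have "card Y1 \<le> card Y" using finT2 by (intro card_mono) (auto simp: Y1_def)
  ultimately have cY1: "d \<le> 2 * total_loss + card Y1" using aT cY by linarith
  define Q where "Q = {j\<in>B. \<exists>i\<in>Y1. succs B j i}"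
  have "card Q = (\<Sum>i\<in>Y1. a i)" unfolding Q_def a_def using sum_card_preds finY1 by simp
  also have "\<dots> = card Y1" by (simp add: Y1_def)
  finally have cQ: "card Q = card Y1" .
  have "Q \<inter> Y1 \<noteq> {}"
  proof
    assume "Q \<inter> Y1 = {}"
    then have "card (Q \<union> Y1) = card Q + card Y1"
      using fin finY1 by (intro card_Un_disjoint) (auto simp: Q_def)
    moreover have "card (Q \<union> Y1) \<le> d"
      using card_mono[OF fin, of "Q \<union> Y1"] finY1 facet_card[OF B] by (auto simp: Q_def)
    ultimately show False using cQ cY1 large by linarith
  qed
  then obtain i j where i: "i \<in> Y1" "i \<in> B" "j \<in> Y1" "succs B i j" by (auto simp: Q_def)
  have "succ B i = j" using succ_eq[OF S i(2,4)] .
  then show ?thesis using i by (auto simp: Y1_def Y_def T2_def T_def a_def)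
qed

text \<open>A single predecessor leaves one vertex of level -1 with nonzero coordinate at the
  element, namely its negative. So the vertices touching \<open>i\<close> are \<open>i\<close>,
  \<open>- i\<close>, \<open>j - i\<close> and \<open>i - p\<close> with \<open>p\<close> the
  predecessor, and likewise for \<open>j\<close>. Once \<open>succ B j = i\<close>, the elements
  \<open>i\<close> and \<open>j\<close> are each other's predecessors.\<close>

lemma hexagon_pair:
  assumes i: "i \<in> clean B" "- i \<in> V" "card (preds B i) = 1"
    and j: "succ B i \<in> clean B" "- succ B i \<in> V" "card (preds B (succ B i)) = 1"
  defines "j \<equiv> succ B i"
  shows "succ B j = i"
    and "\<And>v. v \<in> V - {i, j, - i, - j, i - j, j - i} \<Longrightarrow> icoord B v i = 0 \<and> icoord B v j = 0"
proof -
  note ci = clean[OF i(1)] and cj = clean[OF j(1), folded j_def]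
  have minus1: "x = - l" if l: "l \<in> clean B" "- l \<in> V" "card (preds B l) = 1" and x: "x \<in> level_neg1 B" "icoord B x l \<noteq> 0" for x l
  proof -
    note lB = clean(1)[OF l(1)]
    have "card {y\<in>level_neg1 B. icoord B y l = -1} = 1" using card_preds[OF S max l(1)] l(3) by simp
    then obtain z where z: "{y\<in>level_neg1 B. icoord B y l = -1} = {z}" by (auto simp: card_1_singleton_iff)
    have "- l \<in> level_neg1 B" "icoord B (- l) l = -1"
      using l(2) level_uminus[OF basis lat[OF lB]] level_basis[OF basis lB]
        icoord_uminus[OF basis lat[OF lB] lB] icoord_basis[OF basis lB lB] by (auto simp: level_neg1_def)
    moreover have "icoord B x l = -1" using cases1[OF l(1) x(1)] x(2) by simp
    ultimately have "- l \<in> {y\<in>level_neg1 B. icoord B y l = -1}" "x \<in> {y\<in>level_neg1 B. icoord B y l = -1}"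
      using x(1) by auto
    then show ?thesis unfolding z by simp
  qed
  have part: "v = l \<or> v = - l \<or> v = succ B l - l \<or> (\<exists>p\<in>preds B l. v = l - p)"
    if l: "l \<in> clean B" "- l \<in> V" "card (preds B l) = 1" and v: "v \<in> V" "icoord B v l \<noteq> 0" for v l
  proof -
    note cl = clean[OF l(1)]
    consider "v \<in> B" | "v \<in> level_neg1 B" | "v \<in> exceptional B" | "v \<in> simple0 B"
      using partition_V[OF S] v(1) by (auto simp: exceptional_def simple0_def)
    then show ?thesis
    proof cases
      case 1
      then show ?thesis using icoord_basis[OF basis 1 cl(1)] v(2) by (auto split: if_splits)
    next
      case 2
      then show ?thesis using minus1[OF l] v(2) by blast
    next
      case 3
      then show ?thesis using cl(7) v(2) by blast
    next
      case 4
      then obtain b b' where b: "b \<in> B" "succs B b b'" "v = b' - b" by (rule simple0_rep[OF S])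
      have "b' \<in> B" using b(2) by (simp add: succs_def)
      then have "l = b' \<or> l = b" using diff_coord[OF B b(1) _ cl(1)] v(2) b(3) by (auto split: if_splits)
      then show ?thesis using b succ_eq[OF S b(1,2)] by (auto simp: preds_def)
    qed
  qed
  have ij: "i \<in> B" "j \<in> B" "i \<noteq> j" "j - i \<in> V" using ci cj by (auto simp: j_def)
  show hi: "succ B j = i"
    \<comment> \<open>Otherwise flip at \<open>j\<close>, then at \<open>i\<close>: both \<open>j - i\<close> and \<open>- i\<close> would have to be the new vertex.\<close>
  proof (rule ccontr)
    assume h: "succ B j \<noteq> i"
    define B' where "B' = insert (succ B j - j) (B - {j})"
    note fl = simple_flip[OF B cj(1,4,5,6), folded B'_def]
    have iB': "i \<in> B'" using ij by (simp add: B'_def)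
    have ic: "icoord B' x i = icoord B x i" if "x \<in> int_lattice d" for x
      using fl(5)[OF that, of i] ij h by simp
    obtain n where n: "n \<in> V" "icoord B' n i = -1" "facet (insert n (B' - {i}))"
      "\<And>x. x \<in> int_lattice d \<Longrightarrow> level (insert n (B' - {i})) x = level B' x + icoord B' x i * (level B' n - 1)"
      using flip_ex[OF fl(1) iB'] by metis
    have l1: "level B' (j - i) = -1" "icoord B' (j - i) i = -1"
      using fl(3)[OF V_lat[OF ij(4)]] simple_props(1)[OF B ij(1,2)] diff_coord[OF B ij(1,2)] ic[OF V_lat[OF ij(4)]] ij
      by (auto simp: level0_def)
    have l2: "level B' (- i) = -1" "icoord B' (- i) i = -1"
      using fl(3)[OF V_lat[OF i(2)]] ic[OF V_lat[OF i(2)]] level_uminus[OF basis lat[OF ij(1)]] level_basis[OF basis ij(1)]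
        icoord_uminus[OF basis lat[OF ij(1)]] icoord_basis[OF basis] ij by auto
    have "icoord B n i = -1" using n(2) ic[OF V_lat[OF n(1)]] by simp
    then have "n = i \<or> n = - i \<or> n = j - i \<or> (\<exists>p\<in>preds B i. n = i - p)"
      using part[OF i n(1)] by (simp add: j_def)
    moreover have "n \<noteq> i" using \<open>icoord B n i = -1\<close> icoord_basis[OF basis ij(1) ij(1)] by auto
    moreover have "n \<noteq> i - p" if "p \<in> preds B i" for p
      using \<open>icoord B n i = -1\<close> diff_coord[OF B _ ij(1) ij(1), of p] that by (auto simp: preds_def succs_def)
    ultimately have "n = - i \<or> n = j - i" by blast
    then have ln: "level B' n = -1" using l1 l2 by auto
    have "level (insert n (B' - {i})) (j - i) = 1" "level (insert n (B' - {i})) (- i) = 1"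
      using n(4)[OF V_lat[OF ij(4)]] n(4)[OF V_lat[OF i(2)]] l1 l2 ln by simp_all
    then have m: "j - i \<in> insert n (B' - {i})" "- i \<in> insert n (B' - {i})"
      using level_eq_1[OF n(3)] ij(4) i(2) by auto
    have "j - i \<notin> B'" "- i \<notin> B'"
      using level_basis[OF facet_basis[OF fl(1)]] l1(1) l2(1) by fastforce+
    then have "j - i = - i" using m by auto
    then have "j = 0" by simp
    then show False using ij(2) facet_subset[OF B] zero_notin by auto
  qed
  have pi: "preds B i = {j}"
  proof -
    have "j \<in> preds B i" using cj(1,3) hi by (simp add: preds_def)
    then show ?thesis using i(3) by (auto simp: card_1_singleton_iff)
  qed
  have pj: "preds B j = {i}"
  proof -
    have "i \<in> preds B j" using ci(1,3) by (simp add: preds_def j_def)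
    then show ?thesis using j(3) by (auto simp: card_1_singleton_iff j_def)
  qed
  fix v assume v: "v \<in> V - {i, j, - i, - j, i - j, j - i}"
  show "icoord B v i = 0 \<and> icoord B v j = 0"
    using part[OF i, of v] part[OF j[folded j_def], of v] v pi pj hi by (auto simp: j_def)
qed

end

theorem hexagon_exists:
  assumes large: "4 * total_loss < d"
  shows "\<exists>B i j. facet B \<and> i \<in> B \<and> j \<in> B \<and> i \<noteq> j \<and> {- i, - j, i - j, j - i} \<subseteq> V \<and>
    (\<forall>v \<in> V - {i, j, - i, - j, i - j, j - i}. icoord B v i = 0 \<and> icoord B v j = 0)"
proof -
  obtain B0 where "special B0" using special_exists by blast
  moreover have "\<forall>B. special B \<longrightarrow> card (level0 B) < Suc d"
    using card_level0_le by (auto simp: less_Suc_eq_le)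
  ultimately have "\<exists>B. special B \<and> (\<forall>B'. special B' \<longrightarrow> card (level0 B') \<le> card (level0 B))"
    by (rule ex_has_greatest_nat)
  then obtain B where S: "special B" and max: "\<forall>B'. special B' \<longrightarrow> card (level0 B') \<le> card (level0 B)"
    by blast
  obtain i where i: "i \<in> clean B" "succ B i \<in> clean B" "- i \<in> V" "- succ B i \<in> V"
    "card (preds B i) = 1" "card (preds B (succ B i)) = 1"
    using good_pair[OF S max large] by blast
  define j where "j = succ B i"
  have h: "succ B j = i" "\<And>v. v \<in> V - {i, j, - i, - j, i - j, j - i} \<Longrightarrow> icoord B v i = 0 \<and> icoord B v j = 0"
    unfolding j_def by (rule hexagon_pair[OF S max i(1,3,5) i(2,4,6)]; assumption)+
  note ci = cleanD[OF S i(1)] and cj = cleanD[OF S i(2), folded j_def]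
  have "i \<noteq> j" "{- i, - j, i - j, j - i} \<subseteq> V"
    using ci(5,6) cj(6) h(1) i(3,4) by (auto simp: j_def)
  then show ?thesis using special_facet[OF S] ci(1) cj(1) h(2) by blast
qed

end

section \<open>Facets and supporting functionals\<close>

text \<open>A smallest generating subset \<open>W\<close> consists of extreme points, because no
  element of it lies in the hull of the others.\<close>

lemma finite_convex_hull_vertices:
  assumes "finite V"
  shows "vertices (convex hull V) \<subseteq> V" "convex hull V = convex hull (vertices (convex hull V))"
proof -
  show 1: "vertices (convex hull V) \<subseteq> V"
    by (auto simp: vertices_def extreme_point_of_convex_hull)
  define Q where "Q W \<longleftrightarrow> W \<subseteq> V \<and> convex hull W = convex hull V" for W
  obtain W where W: "Q W" and min: "\<And>W'. Q W' \<Longrightarrow> card W \<le> card W'"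
    using ex_has_least_nat[of Q V card] by (auto simp: Q_def)
  have finW: "finite W" using W assms finite_subset by (auto simp: Q_def)
  have "w \<in> vertices (convex hull V)" if w: "w \<in> W" for w
  proof -
    have iw: "insert w (W - {w}) = W" using w by auto
    have "w \<notin> convex hull (W - {w})"
    proof
      assume "w \<in> convex hull (W - {w})"
      from hull_redundant[OF this] have "Q (W - {w})" using W iw by (auto simp: Q_def)
      from min[OF this] show False
        using w finW card_gt_0_iff[of W] by (auto simp: card_Diff_singleton)
    qed
    from extreme_point_of_convex_hull_insert[OF _ this] have "w extreme_point_of convex hull W"
      using finW iw by simp
    then show ?thesis using W by (simp add: vertices_def Q_def)
  qed
  then have "convex hull V \<subseteq> convex hull (vertices (convex hull V))"
    using W hull_mono[of W "vertices (convex hull V)" convex] by (auto simp: Q_def)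
  moreover have "convex hull (vertices (convex hull V)) \<subseteq> convex hull V"
    by (rule hull_mono[OF 1])
  ultimately show "convex hull V = convex hull (vertices (convex hull V))" by auto
qed

lemma linear_le_on_hull:
  fixes f :: "'a :: real_vector \<Rightarrow> real"
  assumes "linear f" "\<And>v. v \<in> V \<Longrightarrow> f v \<le> c" "x \<in> convex hull V"
  shows "f x \<le> c"
proof -
  interpret f: linear f by fact
  have "convex {x. f x \<le> c}"
  proof (rule convexI)
    fix x y u v assume "x \<in> {x. f x \<le> c}" "y \<in> {x. f x \<le> c}" and uv: "(0::real) \<le> u" "0 \<le> v" "u + v = 1"
    then have "u * f x + v * f y \<le> u * c + v * c" by (intro add_mono mult_left_mono) auto
    also have "\<dots> = c" using uv by (simp flip: distrib_right)
    finally show "u *\<^sub>R x + v *\<^sub>R y \<in> {x. f x \<le> c}" by (simp add: f.add f.scaleR)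
  qed
  then have "convex hull V \<subseteq> {x. f x \<le> c}" using assms(2) by (intro hull_minimal) auto
  then show ?thesis using assms(3) by auto
qed

text \<open>The nonnegative terms \<open>u v * (c - f v)\<close> sum to 0, so the weights vanish off
  the tight points.\<close>

lemma convex_hull_tight:
  fixes f :: "'a :: real_vector \<Rightarrow> real"
  assumes f: "linear f" and fin: "finite V" and le: "\<And>v. v \<in> V \<Longrightarrow> f v \<le> c"
    and x: "x \<in> convex hull V" "f x = c"
  shows "x \<in> convex hull {v\<in>V. f v = c}"
proof -
  interpret f: linear f by fact
  obtain u where u: "\<And>v. v \<in> V \<Longrightarrow> u v \<ge> 0" "sum u V = 1" "(\<Sum>v\<in>V. u v *\<^sub>R v) = x"
    using x(1) unfolding convex_hull_finite[OF fin] by auto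
  have "(\<Sum>v\<in>V. u v * (c - f v)) = c * sum u V - (\<Sum>v\<in>V. u v * f v)"
    by (simp add: algebra_simps sum_subtractf sum_distrib_left)
  also have "(\<Sum>v\<in>V. u v * f v) = f x"
    unfolding u(3)[symmetric] by (simp add: f.sum f.scaleR)
  finally have "(\<Sum>v\<in>V. u v * (c - f v)) = 0" using u(2) x(2) by simp
  then have z: "u v * (c - f v) = 0" if "v \<in> V" for v
    using sum_nonneg_eq_0_iff[OF fin, of "\<lambda>v. u v * (c - f v)"] u(1) le that by simp
  have z': "u v = 0" if "v \<in> V - {v\<in>V. f v = c}" for v
    using z[of v] that by auto
  have s: "sum u {v\<in>V. f v = c} = 1"
    using u(2) sum.mono_neutral_left[OF fin, of "{v\<in>V. f v = c}" u] z' by auto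
  have "(\<Sum>v\<in>{v\<in>V. f v = c}. u v *\<^sub>R v) = x"
    using u(3) sum.mono_neutral_left[OF fin, of "{v\<in>V. f v = c}" "\<lambda>v. u v *\<^sub>R v"] z' by auto
  moreover have "finite {v\<in>V. f v = c}" using fin by simp
  ultimately show ?thesis unfolding convex_hull_finite[OF \<open>finite {v\<in>V. f v = c}\<close>] using s u(1) by auto
qed

lemma face_of_tight:
  fixes f :: "'a :: real_vector \<Rightarrow> real"
  assumes f: "linear f" and "convex P" and le: "\<And>x. x \<in> P \<Longrightarrow> f x \<le> c"
  shows "{x\<in>P. f x = c} face_of P"
  unfolding face_of_def
proof (intro conjI ballI impI)
  interpret f: linear f by fact
  show "{x\<in>P. f x = c} \<subseteq> P" by auto
  show "convex {x\<in>P. f x = c}"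
    using \<open>convex P\<close> by (auto simp: convex_def f.add f.scaleR simp flip: distrib_right)
  fix a b x assume ab: "a \<in> P" "b \<in> P" and x: "x \<in> {x\<in>P. f x = c}" "x \<in> open_segment a b"
  then obtain u where u: "0 < u" "u < 1" "x = (1 - u) *\<^sub>R a + u *\<^sub>R b"
    by (auto simp: in_segment)
  have "(1 - u) * f a + u * f b = c"
    using x(1) unfolding u(3) by (simp add: f.add f.scaleR)
  then have "(1 - u) * (c - f a) + u * (c - f b) = 0" by (simp add: algebra_simps)
  moreover have "(1 - u) * (c - f a) \<ge> 0" "u * (c - f b) \<ge> 0"
    using u le[OF ab(1)] le[OF ab(2)] by simp_all
  ultimately have "(1 - u) * (c - f a) = 0" "u * (c - f b) = 0" by linarith+
  then show "a \<in> {x\<in>P. f x = c}" "b \<in> {x\<in>P. f x = c}" using u ab by auto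
qed

section \<open>Dimension and interior in the coordinate subspaces\<close>

lemma coord_space_finite_span: "coord_space d = span (unit_vec ` {..<d})"
  using lattice_basis_span[OF lattice_basis_unit_vec] by simp

lemma independent_coord_space:
  assumes "independent C" "C \<subseteq> coord_space d"
  shows "finite C" "card C \<le> d"
  using independent_span_bound[OF _ assms(1), of "unit_vec ` {..<d}"] assms(2)
  by (auto simp: coord_space_finite_span card_image inj_on_unit_vec)

lemma independent_span_coord_space:
  assumes "independent C" "C \<subseteq> coord_space d" "card C = d"
  shows "span C = coord_space d"
proof
  show "span C \<subseteq> coord_space d" by (intro span_minimal assms subspace_coord_space)
  show "coord_space d \<subseteq> span C"
  proof (rule ccontr)
    assume "\<not> ?thesis"
    then obtain x where x: "x \<in> coord_space d" "x \<notin> span C" by auto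
    then have "independent (insert x C)" using assms(1) by (simp add: independent_insertI)
    from independent_coord_space(2)[OF this] have "card (insert x C) \<le> d" using x assms by auto
    moreover have "x \<notin> C" using x span_base by blast
    ultimately show False using independent_coord_space(1)[OF assms(1,2)] assms(3) by simp
  qed
qed

lemma norm_coord_space:
  assumes "x \<in> coord_space d"
  shows "norm x = (\<Sum>i<d. \<bar>Poly_Mapping.lookup x i\<bar>)"
proof -
  have "norm x = (\<Sum>i\<in>Poly_Mapping.keys x. \<bar>Poly_Mapping.lookup x i\<bar>)"
    by (simp add: norm_poly_mapping_def dist_poly_mapping_def)
  also have "\<dots> = (\<Sum>i<d. \<bar>Poly_Mapping.lookup x i\<bar>)"
    using assms by (intro sum.mono_neutral_left) (auto simp: coord_space_def in_keys_iff)
  finally show ?thesis .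
qed

text \<open>The algebraic form of 0 being interior relative to the coordinate space. It is
  equivalent for convex subsets and passes easily through linear maps.\<close>

definition absorbing :: "nat \<Rightarrow> rvec set \<Rightarrow> bool" where
  "absorbing d P \<longleftrightarrow> (\<forall>x\<in>coord_space d. \<exists>e>0. \<forall>t. \<bar>t\<bar> \<le> e \<longrightarrow> t *\<^sub>R x \<in> P)"

lemma interior_absorbing:
  assumes "0 \<in> top_of_set (coord_space d) interior_of P"
  shows "absorbing d P"
proof -
  obtain U where "openin (top_of_set (coord_space d)) U" "0 \<in> U" "U \<subseteq> P"
    using assms by (auto simp: interior_of_def)
  then obtain T where T: "open T" "0 \<in> T" "T \<inter> coord_space d \<subseteq> P"
    by (auto simp: openin_subtopology)
  then obtain r where r: "r > 0" "ball 0 r \<subseteq> T" using openE by blast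
  show ?thesis unfolding absorbing_def
  proof
    fix x assume x: "x \<in> coord_space d"
    have "t *\<^sub>R x \<in> P" if t: "\<bar>t\<bar> \<le> r / (1 + norm x)" for t
    proof -
      have "\<bar>t\<bar> * norm x \<le> r / (1 + norm x) * norm x" using t by (rule mult_right_mono) simp
      also have "\<dots> < r" using r(1) by (simp add: field_simps add_pos_nonneg)
      finally have "t *\<^sub>R x \<in> T" using r(2) by auto
      moreover have "t *\<^sub>R x \<in> coord_space d" using x subspace_coord_space by (simp add: subspace_scale)
      ultimately show ?thesis using T(3) by auto
    qed
    moreover have "r / (1 + norm x) > 0" using r(1) by (simp add: add_pos_nonneg)
    ultimately show "\<exists>e>0. \<forall>t. \<bar>t\<bar> \<le> e \<longrightarrow> t *\<^sub>R x \<in> P" by blast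
  qed
qed

text \<open>The norm is the sum of the absolute coordinates, so a small ball lies in a
  cross-polytope whose vertices belong to \<open>P\<close>.\<close>

lemma absorbing_interior:
  assumes "absorbing d P" "convex P" "P \<subseteq> coord_space d"
  shows "0 \<in> top_of_set (coord_space d) interior_of P"
proof -
  have "\<exists>e>0. \<forall>t. \<bar>t\<bar> \<le> e \<longrightarrow> t *\<^sub>R unit_vec i \<in> P" if "i < d" for i
    using assms(1) unit_vec_in_lattice[OF that] int_lattice_coord_space by (auto simp: absorbing_def)
  then obtain e where e: "\<And>i. i < d \<Longrightarrow> e i > 0" "\<And>i t. i < d \<Longrightarrow> \<bar>t\<bar> \<le> e i \<Longrightarrow> t *\<^sub>R unit_vec i \<in> P"
    by metis
  have zero: "0 \<in> P"
  proof -
    have "0 \<in> coord_space d" using int_lattice_zero int_lattice_coord_space by blast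
    then obtain e where "e > 0" "\<forall>t. \<bar>t\<bar> \<le> e \<longrightarrow> t *\<^sub>R (0 :: rvec) \<in> P"
      using assms(1) unfolding absorbing_def by blast
    then have "0 *\<^sub>R (0 :: rvec) \<in> P" by (metis abs_zero less_imp_le)
    then show ?thesis by simp
  qed
  define r where "r = Min (insert 1 (e ` {..<d}))"
  have r: "r > 0" "\<And>i. i < d \<Longrightarrow> r \<le> e i" using e(1) by (auto simp: r_def)
  have "ball 0 r \<inter> coord_space d \<subseteq> P"
  proof
    fix x assume x: "x \<in> ball 0 r \<inter> coord_space d"
    define s where "s i = sgn (Poly_Mapping.lookup x i)" for i
    define u where "u i = \<bar>Poly_Mapping.lookup x i\<bar> / r" for i
    have nx: "(\<Sum>i<d. u i) < 1"
      using x norm_coord_space[of x d] r(1) by (simp add: u_def flip: sum_divide_distrib)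
    \<comment> \<open>Index \<open>d\<close> carries the leftover weight, placed on the point
      0.\<close>
    define w where "w i = (if i < d then u i else 1 - (\<Sum>i<d. u i))" for i
    define y where "y i = (if i < d then (s i * r) *\<^sub>R unit_vec i else 0)" for i
    have "(\<Sum>i<Suc d. w i *\<^sub>R y i) \<in> P"
    proof (rule convex_sum[OF _ \<open>convex P\<close>])
      show "sum w {..<Suc d} = 1" by (simp add: w_def)
      show "0 \<le> w i" if "i \<in> {..<Suc d}" for i using nx r(1) by (simp add: w_def u_def)
      show "y i \<in> P" if "i \<in> {..<Suc d}" for i
        using zero e(2)[of i "s i * r"] r by (auto simp: y_def s_def sgn_real_def)
    qed simp
    also have "(\<Sum>i<Suc d. w i *\<^sub>R y i) = (\<Sum>i<d. Poly_Mapping.lookup x i *\<^sub>R unit_vec i)"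
      using r(1) by (simp add: w_def y_def u_def s_def abs_mult_sgn mult.commute[of "\<bar>_\<bar>"] sgn_mult_abs)
    also have "\<dots> = x" using coord_expand[of x d] x by simp
    finally show "x \<in> P" .
  qed
  moreover have "openin (top_of_set (coord_space d)) (ball 0 r \<inter> coord_space d)"
    by (metis Int_commute open_ball openin_open_Int)
  moreover have "0 \<in> ball 0 r \<inter> coord_space d" using r(1) int_lattice_zero int_lattice_coord_space by auto
  ultimately show ?thesis unfolding interior_of_def by blast
qed

text \<open>Fix a basis of tight vertices and \<open>b0\<close> in it. A difference of two points of
  the face has coefficients summing to 0, so it lies in the span of the \<open>d - 1\<close> vectors
  \<open>b - b0\<close>; conversely, the differences and \<open>b0\<close> span the space.\<close>

lemma polytope_facet_tight:
  fixes f :: "rvec \<Rightarrow> real"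
  assumes f: "linear f" and fin: "finite V" "V \<subseteq> coord_space d" and d: "d > 0"
    and le: "\<And>v. v \<in> V \<Longrightarrow> f v \<le> 1" and span: "coord_space d \<subseteq> span {v\<in>V. f v = 1}"
  shows "polytope_facet d {x \<in> convex hull V. f x = 1} (convex hull V)"
proof -
  interpret f: linear f by fact
  define W where "W = {v\<in>V. f v = 1}"
  define F where "F = {x \<in> convex hull V. f x = 1}"
  define U where "U = {x - y |x y. x \<in> F \<and> y \<in> F}"
  have WF: "W \<subseteq> F" by (auto simp: W_def F_def hull_inc)
  have face: "F face_of convex hull V"
    unfolding F_def using linear_le_on_hull[OF f le] by (intro face_of_tight[OF f]) (auto simp: convex_convex_hull)
  have hullC: "convex hull V \<subseteq> coord_space d"
    using fin subspace_imp_convex[OF subspace_coord_space] by (intro hull_minimal) auto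
  obtain B where B: "B \<subseteq> W" "independent B" "W \<subseteq> span B"
    using maximal_independent_subset[of W] by blast
  have WC: "W \<subseteq> coord_space d" using fin by (auto simp: W_def)
  have "span B = span W" using B by (metis span_eq span_superset subset_trans)
  then have sB: "span B = coord_space d"
    using span WC span_minimal[OF WC subspace_coord_space] by (auto simp: W_def)
  have finB: "finite B" by (rule finite_subset[OF _ fin(1)]) (use B(1) in \<open>auto simp: W_def\<close>)
  have cB: "card B = d" using dim_span_eq_card_independent[OF B(2)] sB dim_coord_space by simp
  then obtain b0 where b0: "b0 \<in> B" using d by fastforce
  define D where "D = (\<lambda>b. b - b0) ` (B - {b0})"
  have cD: "card D \<le> d - 1"
    unfolding D_def using card_image_le[of "B - {b0}"] finB cB b0 by (metis card_Diff_singleton finite_Diff)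
  have finD: "finite D" using finB by (simp add: D_def)
  have fB: "f b = 1" if "b \<in> B" for b using that B(1) by (auto simp: W_def)
  have UD: "U \<subseteq> span D"
  proof
    fix z assume "z \<in> U"
    then obtain x y where z: "z = x - y" "x \<in> F" "y \<in> F" by (auto simp: U_def)
    then have "z \<in> span B" using hullC unfolding sB F_def by (auto intro!: subspace_diff[OF subspace_coord_space])
    then obtain r where r: "z = (\<Sum>b\<in>B. r b *\<^sub>R b)" unfolding span_finite[OF finB] by auto
    have "f z = 0" using z by (simp add: f.diff F_def)
    then have "(\<Sum>b\<in>B. r b) = 0" unfolding r by (simp add: f.sum f.scaleR fB)
    then have "z = (\<Sum>b\<in>B. r b *\<^sub>R (b - b0))"
      unfolding r by (simp add: scaleR_diff_right sum_subtractf flip: scaleR_sum_left)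
    also have "\<dots> = (\<Sum>b\<in>B - {b0}. r b *\<^sub>R (b - b0))"
      using finB by (intro sum.mono_neutral_right) auto
    also have "\<dots> \<in> span D" by (intro span_sum span_scale span_base) (auto simp: D_def)
    finally show "z \<in> span D" .
  qed
  have "dim U \<le> d - 1" using dim_le_card[OF UD finD] cD by linarith
  moreover have "d \<le> dim U + 1"
  proof -
    obtain C where C: "C \<subseteq> U" "independent C" "U \<subseteq> span C" "card C = dim U" by (rule basis_exists)
    have finC: "finite C" using independent_span_bound[OF finD C(2)] C(1) UD by auto
    have "B \<subseteq> span (insert b0 C)"
    proof
      fix b assume b: "b \<in> B"
      have "b - b0 \<in> U" using b b0 B(1) WF by (auto simp: U_def)
      then have "b - b0 \<in> span (insert b0 C)" using C(3) span_mono[of C "insert b0 C"] by auto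
      then have "b - b0 + b0 \<in> span (insert b0 C)" by (rule span_add) (simp add: span_base)
      then show "b \<in> span (insert b0 C)" by simp
    qed
    then have "dim B \<le> card (insert b0 C)" using finC by (intro dim_le_card) auto
    then show ?thesis using dim_eq_card_independent[OF B(2)] cB C(4) finC card_insert_if[OF finC, of b0]
      by (auto split: if_splits)
  qed
  moreover have "F \<noteq> {}" using b0 B(1) WF by auto
  ultimately show ?thesis using face d unfolding polytope_facet_def F_def U_def by simp
qed

lemma smooth_fano_vertices:
  assumes sf: "smooth_fano_polytope d P" and d: "d > 0"
  shows "finite (vertices P)" "P = convex hull (vertices P)" "vertices P \<subseteq> int_lattice d"
    "absorbing d P" "fano_vertices d (vertices P)"
proof -
  obtain V0 where V0: "finite V0" "V0 \<subseteq> int_lattice d" "P = convex hull V0"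
    using sf by (auto simp: smooth_fano_polytope_def lattice_polytope_def)
  note h = finite_convex_hull_vertices[OF V0(1), folded V0(3)]
  show fin: "finite (vertices P)" using h(1) V0(1) finite_subset by blast
  show P: "P = convex hull (vertices P)" by (rule h(2))
  show lat: "vertices P \<subseteq> int_lattice d" using h(1) V0(2) by blast
  show ab: "absorbing d P"
    using sf by (auto simp: smooth_fano_polytope_def intro: interior_absorbing)
  have facets: "\<And>F. polytope_facet d F P \<Longrightarrow> lattice_basis d (vertices F)"
    using sf by (auto simp: smooth_fano_polytope_def)
  show "fano_vertices d (vertices P)"
  proof
    show "0 \<notin> vertices P"
    proof
      assume "0 \<in> vertices P"
      then have ex: "0 extreme_point_of P" by (simp add: vertices_def)
      have "unit_vec 0 \<in> coord_space d" using unit_vec_in_lattice[OF d] int_lattice_coord_space by auto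
      then obtain e where e: "e > 0" "\<And>t. \<bar>t\<bar> \<le> e \<Longrightarrow> t *\<^sub>R unit_vec 0 \<in> P"
        using ab by (auto simp: absorbing_def)
      have "unit_vec 0 \<noteq> 0" by (metis lookup_single_eq lookup_zero unit_vec_def zero_neq_one)
      then have "0 \<in> open_segment ((- e) *\<^sub>R unit_vec 0) (e *\<^sub>R unit_vec 0)"
        using e(1) unfolding in_segment
        by (intro conjI exI[of _ "1/2"]) (auto simp: eq_neg_iff_add_eq_0 simp flip: scaleR_left_distrib)
      moreover have "(- e) *\<^sub>R unit_vec 0 \<in> P" "e *\<^sub>R unit_vec 0 \<in> P" using e by (auto simp del: scaleR_minus_left)
      ultimately show False using ex unfolding extreme_point_of_def by blast
    qed
    show "\<exists>v\<in>vertices P. f v > 0" if f: "linear f" "\<exists>x\<in>coord_space d. f x \<noteq> 0" for f :: "rvec \<Rightarrow> real"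
    proof (rule ccontr)
      assume "\<not> ?thesis"
      then have le: "f x \<le> 0" if "x \<in> P" for x
        using linear_le_on_hull[OF f(1), of "vertices P" 0 x] that P by force
      interpret f: linear f by (fact f(1))
      obtain x where x: "x \<in> coord_space d" "f x \<noteq> 0" using f by auto
      obtain e where e: "e > 0" "\<And>t. \<bar>t\<bar> \<le> e \<Longrightarrow> t *\<^sub>R x \<in> P"
        using ab x by (auto simp: absorbing_def)
      have "f (e *\<^sub>R x) \<le> 0" "f ((- e) *\<^sub>R x) \<le> 0" using le[OF e(2)] e(1) by (simp_all del: scaleR_minus_left)
      then show False using x(2) e(1) by (simp add: f.scaleR f.neg mult_le_0_iff zero_le_mult_iff)
    qed
    show "lattice_basis d {v\<in>vertices P. f v = 1}"
      if f: "linear f" "\<And>v. v \<in> vertices P \<Longrightarrow> f v \<le> 1" "coord_space d \<subseteq> span {v\<in>vertices P. f v = 1}"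
      for f :: "rvec \<Rightarrow> real"
    proof -
      define F where "F = {x\<in>P. f x = 1}"
      have "polytope_facet d F P"
        using polytope_facet_tight[OF f(1) fin _ d f(2,3)] lat int_lattice_coord_space
        unfolding F_def P[symmetric] by blast
      moreover from this have "F face_of P" by (simp add: polytope_facet_def)
      then have "vertices F = {v\<in>vertices P. f v = 1}"
        using extreme_point_of_face by (auto simp: vertices_def F_def extreme_point_of_def[of _ P])
      ultimately show ?thesis using facets by fastforce
    qed
  qed (use d fin lat in auto)
qed

text \<open>For convex \<open>G\<close> these multiples already form a subspace: averaging end
  points with weights proportional to \<open>t\<close> and \<open>s\<close> handles sums, and
  swapping \<open>a\<close> with \<open>b\<close> handles negation.\<close>

lemma span_differences:
  assumes "convex G" "G \<noteq> {}" "z \<in> span {x - y |x y. x \<in> G \<and> y \<in> G}"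
  shows "\<exists>t\<ge>0. \<exists>a\<in>G. \<exists>b\<in>G. z = t *\<^sub>R (a - b)"
proof -
  define S where "S = {t *\<^sub>R (a - b) | t a b. t \<ge> 0 \<and> a \<in> G \<and> b \<in> G}"
  have "subspace S"
  proof (rule subspaceI)
    obtain g where "g \<in> G" using assms(2) by auto
    then show "0 \<in> S" unfolding S_def by (auto intro!: exI[of _ 0] exI[of _ g])
  next
    fix x y assume "x \<in> S" "y \<in> S"
    then obtain t a b s a' b' where x: "x = t *\<^sub>R (a - b)" "t \<ge> 0" "a \<in> G" "b \<in> G"
      and y: "y = s *\<^sub>R (a' - b')" "s \<ge> 0" "a' \<in> G" "b' \<in> G" by (auto simp: S_def)
    show "x + y \<in> S"
    proof (cases "t + s = 0")
      case True
      then have "t = 0" "s = 0" using x y by auto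
      then show ?thesis using x y \<open>x \<in> S\<close> by simp
    next
      case False
      then have ts: "t + s > 0" using x y by auto
      define p where "p = (t / (t + s)) *\<^sub>R a + (s / (t + s)) *\<^sub>R a'"
      define q where "q = (t / (t + s)) *\<^sub>R b + (s / (t + s)) *\<^sub>R b'"
      have pq: "p \<in> G" "q \<in> G" unfolding p_def q_def
        using x y ts by (auto intro!: convexD[OF assms(1)] simp flip: add_divide_distrib)
      have "x + y = (t + s) *\<^sub>R (p - q)"
        using ts by (simp add: x y p_def q_def scaleR_right_distrib scaleR_diff_right)
      then show ?thesis using pq ts unfolding S_def by fastforce
    qed
  next
    fix c :: real and x assume "x \<in> S"
    then obtain t a b where x: "x = t *\<^sub>R (a - b)" "t \<ge> 0" "a \<in> G" "b \<in> G" by (auto simp: S_def)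
    show "c *\<^sub>R x \<in> S"
    proof (cases "c \<ge> 0")
      case True
      then have "c *\<^sub>R x = (c * t) *\<^sub>R (a - b)" "c * t \<ge> 0" using x by auto
      then show ?thesis using x unfolding S_def by blast
    next
      case False
      then have "c *\<^sub>R x = (- c * t) *\<^sub>R (b - a)" "- c * t \<ge> 0"
        using x by (auto simp: scaleR_diff_right mult_nonpos_nonneg)
      then show ?thesis using x unfolding S_def by blast
    qed
  qed
  moreover have "{x - y |x y. x \<in> G \<and> y \<in> G} \<subseteq> S"
  proof
    fix v assume "v \<in> {x - y |x y. x \<in> G \<and> y \<in> G}"
    then obtain x y where "v = 1 *\<^sub>R (x - y)" "x \<in> G" "y \<in> G" by auto
    then show "v \<in> S" unfolding S_def using zero_le_one by blast
  qed
  ultimately have "z \<in> S" using assms(3) span_minimal by blast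
  then show ?thesis by (auto simp: S_def)
qed

text \<open>The differences of \<open>G\<close> span a hyperplane, the kernel of some
  \<open>h\<close> on the coordinate space. By the face property \<open>Q\<close> meets the
  translate through \<open>G\<close> only in \<open>G\<close> and lies on one side of it. As 0 is
  interior, \<open>h\<close> is nonzero on \<open>G\<close> and can be scaled to 1.\<close>

lemma polytope_facet_functional:
  assumes Q: "convex Q" "Q \<subseteq> coord_space d" "absorbing d Q" and G: "polytope_facet d G Q"
  obtains f :: "rvec \<Rightarrow> real" where "linear f" "\<And>x. x \<in> Q \<Longrightarrow> f x \<le> 1" "G = {x\<in>Q. f x = 1}" "coord_space d \<subseteq> span G"
proof -
  define U where "U = {x - y |x y. x \<in> G \<and> y \<in> G}"
  have face: "G face_of Q" and ne: "G \<noteq> {}" and dU: "dim U + 1 = d"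
    using G by (auto simp: polytope_facet_def U_def)
  have GQ: "G \<subseteq> Q" and cG: "convex G" using face face_of_imp_subset face_of_imp_convex by auto
  obtain g where g: "g \<in> G" using ne by auto
  have UC: "U \<subseteq> coord_space d"
    using GQ Q(2) by (auto simp: U_def intro!: subspace_diff[OF subspace_coord_space])
  obtain C where C: "C \<subseteq> U" "independent C" "U \<subseteq> span C" "card C = dim U" by (rule basis_exists)
  have CC: "C \<subseteq> coord_space d" using C UC by auto
  have sCU: "span C = span U" using C by (metis span_eq span_superset subset_trans)
  have "\<not> coord_space d \<subseteq> span C"
    using dim_le_card[OF _ independent_coord_space(1)[OF C(2) CC], of "coord_space d"] C(4) dU dim_coord_space[of d] by auto
  then obtain w where w: "w \<in> coord_space d" "w \<notin> span C" by auto
  have ind: "independent (insert w C)" using C w by (simp add: independent_insertI)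
  have wC: "w \<notin> C" using w span_base by blast
  have sw: "span (insert w C) = coord_space d"
    using w CC wC independent_coord_space(1)[OF C(2) CC] C(4) dU
    by (intro independent_span_coord_space[OF ind]) auto
  obtain h :: "rvec \<Rightarrow> real" where h: "linear h" "\<forall>x\<in>insert w C. h x = (if x = w then 1 else 0)"
    using linear_independent_extend[OF ind, of "\<lambda>x. if x = w then 1 else 0"] by auto
  interpret h: linear h by (fact h(1))
  have hC: "h x = 0" if "x \<in> span C" for x
    by (rule linear_eq_0_on_span[OF h(1) _ that]) (use h(2) wC in auto)
  have hw: "h w = 1" using h(2) by simp
  have ker: "x \<in> span U" if x: "x \<in> coord_space d" "h x = 0" for x
  proof -
    obtain c where c: "x - c *\<^sub>R w \<in> span C" using x(1) sw span_breakdown_eq by blast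
    then have "c = 0" using hC[OF c] x(2) hw by (simp add: h.diff h.scaleR)
    then show ?thesis using c sCU by simp
  qed
  have hG: "h x = h g" if "x \<in> G" for x
  proof -
    have "x - g \<in> U" using that g unfolding U_def by blast
    then have "x - g \<in> span C" unfolding sCU by (rule span_base)
    from hC[OF this] show ?thesis by (simp add: h.diff)
  qed
  have inG: "x \<in> G" if x: "x \<in> Q" "h x = h g" for x
  proof -
    have "x - g \<in> coord_space d"
      by (rule subspace_diff[OF subspace_coord_space]) (use x g GQ Q(2) in auto)
    moreover have "h (x - g) = 0" using x by (simp add: h.diff)
    ultimately have "x - g \<in> span {x - y |x y. x \<in> G \<and> y \<in> G}" using ker by (simp add: U_def)
    from span_differences[OF cG ne this] obtain t a b
      where t: "t \<ge> 0" "a \<in> G" "b \<in> G" "x - g = t *\<^sub>R (a - b)" by auto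
    \<comment> \<open>If \<open>t > 0\<close>, the segment from \<open>x\<close> to \<open>b\<close> meets \<open>G\<close> in \<open>(x + t b) / (1 + t) = (g + t a) / (1 + t)\<close>.\<close>
    show ?thesis
    proof (cases "t = 0 \<or> x = b")
      case True
      then show ?thesis using t g by auto
    next
      case False
      then have tp: "t > 0" using t by simp
      define m where "m = (1 / (1 + t)) *\<^sub>R g + (t / (1 + t)) *\<^sub>R a"
      have mG: "m \<in> G" unfolding m_def
        using tp t g by (intro convexD[OF cG]) (auto simp flip: add_divide_distrib)
      have gx: "g = x - t *\<^sub>R (a - b)" using t(4) by (simp add: algebra_simps)
      have "m = (1 / (1 + t)) *\<^sub>R x + (t / (1 + t)) *\<^sub>R b"
        unfolding m_def by (subst gx) (simp add: scaleR_diff_right)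
      moreover have "1 / (1 + t) = 1 - t / (1 + t)" using tp by (simp add: field_simps)
      ultimately have "m = (1 - t / (1 + t)) *\<^sub>R x + (t / (1 + t)) *\<^sub>R b" by simp
      then have "m \<in> open_segment x b"
        unfolding in_segment using False tp by (intro conjI exI[of _ "t / (1 + t)"]) auto
      then show ?thesis using face_ofD[OF face _ x(1) _ mG] t(3) GQ by blast
    qed
  qed
  have side: "(\<forall>y\<in>Q. h y \<le> h g) \<or> (\<forall>y\<in>Q. h y \<ge> h g)"
  proof (rule ccontr)
    assume "\<not> ?thesis"
    then obtain y1 y2 where y: "y1 \<in> Q" "y2 \<in> Q" "h y1 > h g" "h y2 < h g" by force
    \<comment> \<open>Chosen so that the segment from \<open>y1\<close> to \<open>y2\<close> meets
      the hyperplane through \<open>G\<close> at \<open>z\<close>.\<close>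
    define u where "u = (h g - h y1) / (h y2 - h y1)"
    have u: "0 < u" "u < 1" using y by (auto simp: u_def divide_simps)
    define z where "z = (1 - u) *\<^sub>R y1 + u *\<^sub>R y2"
    have "h z = (1 - u) * h y1 + u * h y2" unfolding z_def by (simp only: h.add h.scaleR real_scaleR_def)
    also have "\<dots> = h y1 + u * (h y2 - h y1)" by (simp add: algebra_simps)
    also have "\<dots> = h g" using y by (simp add: u_def)
    finally have hz: "h z = h g" .
    have "z \<in> Q" unfolding z_def using u y by (intro convexD[OF Q(1)]) auto
    then have zG: "z \<in> G" using inG hz by blast
    have "y1 \<noteq> y2" using y by auto
    then have "z \<in> open_segment y1 y2" unfolding in_segment z_def using u by auto
    then have "y1 \<in> G" using face_ofD[OF face _ y(1,2) zG] by blast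
    then show False using hG y by force
  qed
  define c :: real where "c = (if \<forall>y\<in>Q. h y \<le> h g then 1 else -1)"
  have cle: "c * h y \<le> c * h g" if "y \<in> Q" for y using side that by (auto simp: c_def)
  have c0: "c \<noteq> 0" "c * c = 1" by (auto simp: c_def)
  obtain e where e: "e > 0" "\<And>t. \<bar>t\<bar> \<le> e \<Longrightarrow> t *\<^sub>R w \<in> Q" using Q(3) w(1) by (auto simp: absorbing_def)
  have "(c * e) *\<^sub>R w \<in> Q" using e by (auto simp: c_def)
  from cle[OF this] have "e \<le> c * h g" using c0 hw by (simp add: h.scaleR flip: mult.assoc)
  then have pos: "c * h g > 0" using e by linarith
  define f where "f x = c * h x / (c * h g)" for x
  have linf: "linear f"
    by (rule linearI) (simp_all add: f_def h.add h.scaleR algebra_simps add_divide_distrib)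
  interpret f: linear f by (fact linf)
  have hg0: "h g \<noteq> 0" using pos by auto
  have f1: "f x = 1 \<longleftrightarrow> h x = h g" for x using c0 hg0 by (auto simp: f_def)
  show thesis
  proof (rule that[OF linf])
    show "f x \<le> 1" if "x \<in> Q" for x using cle[OF that] unfolding f_def divide_le_eq_1_pos[OF pos] .
    show "G = {x\<in>Q. f x = 1}" using hG inG GQ by (auto simp: f1)
    show "coord_space d \<subseteq> span G"
    proof
      fix x assume x: "x \<in> coord_space d"
      have gC: "g \<in> coord_space d" using g GQ Q(2) by auto
      have "x - (h x / h g) *\<^sub>R g \<in> span U"
        using x gC hg0 by (intro ker) (auto simp: h.diff h.scaleR intro!: subspace_diff[OF subspace_coord_space] subspace_scale[OF subspace_coord_space])
      moreover have "span U \<subseteq> span G"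
        by (intro span_minimal subspace_span) (auto simp: U_def intro: span_diff[OF span_base span_base])
      ultimately have "x - (h x / h g) *\<^sub>R g \<in> span G" by blast
      from span_add[OF this span_scale[OF span_base[OF g]]]
      have "x - (h x / h g) *\<^sub>R g + (h x / h g) *\<^sub>R g \<in> span G" .
      then show "x \<in> span G" by simp
    qed
  qed
qed

section \<open>Splitting off a hexagon\<close>

definition drop_coords :: "nat \<Rightarrow> nat \<Rightarrow> rvec \<Rightarrow> rvec" where
  "drop_coords m d x = (\<Sum>n<d. Poly_Mapping.lookup x (m + n) *\<^sub>R unit_vec n)"

lemma lookup_unit_sum:
  "Poly_Mapping.lookup (\<Sum>i<d. c i *\<^sub>R unit_vec i) n = (if n < d then c n else 0)"
proof -
  have "Poly_Mapping.lookup (\<Sum>i<d. c i *\<^sub>R unit_vec i) n = (\<Sum>i<d. if i = n then c n else 0)"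
    unfolding lookup_sum by (intro sum.cong) (auto simp: lookup_scaleR_vec unit_vec_def lookup_single when_def)
  then show ?thesis by simp
qed

lemma lookup_unit_vec: "Poly_Mapping.lookup (unit_vec i) n = (if i = n then 1 else 0)"
  by (simp add: unit_vec_def lookup_single when_def)

lemma coord_spaceI: "(\<And>n. n \<ge> d \<Longrightarrow> Poly_Mapping.lookup x n = 0) \<Longrightarrow> x \<in> coord_space d"
  unfolding coord_space_def by (auto simp: in_keys_iff not_le[symmetric])

lemma lookup_drop_coords:
  "Poly_Mapping.lookup (drop_coords m d x) n = (if n < d then Poly_Mapping.lookup x (m + n) else 0)"
  unfolding drop_coords_def by (rule lookup_unit_sum)

lemma lookup_shift_coords:
  "Poly_Mapping.lookup (shift_coords m x) n = (if m \<le> n then Poly_Mapping.lookup x (n - m) else 0)"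
proof -
  have "Poly_Mapping.lookup (shift_coords m x) n = (\<Sum>i\<in>Poly_Mapping.keys x. if m + i = n then Poly_Mapping.lookup x i else 0)"
    unfolding shift_coords_def lookup_sum by (intro sum.cong) (auto simp: lookup_single when_def)
  also have "\<dots> = (if m \<le> n then Poly_Mapping.lookup x (n - m) else 0)"
  proof (cases "m \<le> n")
    case True
    then have "(\<Sum>i\<in>Poly_Mapping.keys x. if m + i = n then Poly_Mapping.lookup x i else 0)
        = (\<Sum>i\<in>Poly_Mapping.keys x. if i = n - m then Poly_Mapping.lookup x i else 0)"
      by (intro sum.cong) auto
    then show ?thesis using True by (simp add: in_keys_iff)
  qed (auto intro!: sum.neutral)
  finally show ?thesis .
qed

lemma linear_drop_coords: "linear (drop_coords m d)"
  by (intro linearI poly_mapping_eqI) (auto simp: lookup_drop_coords lookup_add lookup_scaleR_vec)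

lemma linear_shift_coords: "linear (shift_coords m)"
  by (intro linearI poly_mapping_eqI) (auto simp: lookup_shift_coords lookup_add lookup_scaleR_vec)

lemma drop_coords_lattice: "x \<in> int_lattice (m + d) \<Longrightarrow> drop_coords m d x \<in> int_lattice d"
  by (auto simp: int_lattice_def lookup_drop_coords intro: coord_spaceI)

lemma shift_coords_space:
  assumes "x \<in> coord_space d" shows "shift_coords m x \<in> coord_space (m + d)"
  using lookup_zero_outside[OF assms] by (intro coord_spaceI) (auto simp: lookup_shift_coords)

lemma shift_coords_lattice: "x \<in> int_lattice d \<Longrightarrow> shift_coords m x \<in> int_lattice (m + d)"
  using shift_coords_space by (auto simp: int_lattice_def lookup_shift_coords)

lemma drop_shift_coords:
  assumes "x \<in> coord_space d" shows "drop_coords m d (shift_coords m x) = x"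
  using lookup_zero_outside[OF assms] by (intro poly_mapping_eqI) (auto simp: lookup_drop_coords lookup_shift_coords)

text \<open>\<open>\<phi>\<close> takes coordinates in \<open>B\<close>, ordered by
  \<open>e\<close>. Beyond the coordinate space it is an arbitrary linear extension, so
  \<open>\<psi>\<close> inverts it only there.\<close>

lemma basis_chart:
  assumes B: "lattice_basis d B" and e: "bij_betw e {..<d} B"
  shows "\<exists>\<phi> \<psi>. linear \<phi> \<and> linear \<psi> \<and> bij_betw \<phi> (int_lattice d) (int_lattice d) \<and>
    (\<forall>y\<in>int_lattice d. \<psi> y \<in> int_lattice d) \<and>
    (\<forall>x\<in>coord_space d. \<phi> x \<in> coord_space d \<and> \<psi> (\<phi> x) = x) \<and>
    (\<forall>y\<in>coord_space d. \<psi> y \<in> coord_space d \<and> \<phi> (\<psi> y) = y) \<and>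
    (\<forall>x\<in>int_lattice d. \<forall>m<d. Poly_Mapping.lookup (\<phi> x) m = of_int (icoord B x (e m))) \<and>
    (\<forall>m<d. \<phi> (e m) = unit_vec m)"
proof -
  obtain \<phi> where \<phi>: "linear \<phi>" "\<forall>b\<in>B. \<phi> b = unit_vec (inv_into {..<d} e b)"
    using linear_independent_extend[OF lattice_basis_independent[OF B], of "\<lambda>b. unit_vec (inv_into {..<d} e b)"]
    by auto
  interpret \<phi>: linear \<phi> by (fact \<phi>(1))
  have eB: "e m \<in> B" if "m < d" for m using e that by (auto simp: bij_betw_def)
  have \<phi>e: "\<phi> (e m) = unit_vec m" if "m < d" for m
    using \<phi>(2) eB[OF that] e that by (simp add: bij_betw_def)
  define \<psi> where "\<psi> y = (\<Sum>m<d. Poly_Mapping.lookup y m *\<^sub>R e m)" for y :: rvec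
  have \<psi>: "linear \<psi>"
    by (rule linearI)
      (simp_all add: \<psi>_def lookup_add lookup_scaleR_vec scaleR_left_distrib sum.distrib scaleR_sum_right)
  interpret \<psi>: linear \<psi> by (fact \<psi>)
  have B_lat: "B \<subseteq> int_lattice d" by (rule lattice_basis_lattice[OF B])
  have e_lat: "e m \<in> int_lattice d" if "m < d" for m using eB[OF that] B_lat by auto
  have \<phi>x: "\<phi> x = (\<Sum>m<d. of_int (icoord B x (e m)) *\<^sub>R unit_vec m)" if "x \<in> int_lattice d" for x
    unfolding linear_icoord[OF B \<phi>(1) that] sum.reindex_bij_betw[OF e, symmetric]
    by (intro sum.cong) (auto simp: \<phi>e)
  have \<phi>_lat: "\<phi> x \<in> int_lattice d" if "x \<in> int_lattice d" for x
    unfolding \<phi>x[OF that] by (intro int_lattice_sum int_lattice_scale unit_vec_in_lattice) auto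
  have \<psi>_lat: "\<psi> y \<in> int_lattice d" if "y \<in> int_lattice d" for y
    unfolding \<psi>_def using that by (intro int_lattice_sum int_lattice_scale e_lat) (auto simp: int_lattice_def)
  have \<psi>u: "\<psi> (unit_vec m) = e m" if "m < d" for m
  proof -
    have "\<psi> (unit_vec m) = (\<Sum>n<d. if m = n then e n else 0)"
      unfolding \<psi>_def by (intro sum.cong) (auto simp: lookup_unit_vec)
    then show ?thesis using that by simp
  qed
  have \<phi>\<psi>: "\<phi> (\<psi> y) = y" if "y \<in> coord_space d" for y
  proof -
    have "\<phi> (\<psi> y) = (\<Sum>m<d. Poly_Mapping.lookup y m *\<^sub>R unit_vec m)"
      unfolding \<psi>_def \<phi>.sum \<phi>.scaleR by (intro sum.cong) (auto simp: \<phi>e)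
    then show ?thesis using coord_expand[OF that] by simp
  qed
  have span: "coord_space d = span B" using lattice_basis_span[OF B] by simp
  have \<phi>B: "\<phi> ` B \<subseteq> coord_space d" using \<phi>_lat B_lat int_lattice_coord_space by blast
  have \<phi>_sp: "\<phi> x \<in> coord_space d" if "x \<in> coord_space d" for x
  proof -
    have "\<phi> x \<in> span (\<phi> ` B)" using that linear_span_image[OF \<phi>(1), of B] unfolding span by blast
    then show ?thesis using span_minimal[OF \<phi>B subspace_coord_space] by blast
  qed
  have \<psi>\<phi>B: "\<psi> (\<phi> b) = b" if b: "b \<in> B" for b
  proof -
    obtain m where "m < d" "b = e m" using e b by (auto simp: bij_betw_def)
    then show ?thesis using \<phi>e \<psi>u by simp
  qed
  have \<psi>\<phi>: "\<psi> (\<phi> x) = x" if "x \<in> coord_space d" for x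
    using linear_eq_on_span[of "\<lambda>x. \<psi> (\<phi> x)" "\<lambda>x. x" B x] \<psi>\<phi>B that linear_compose[OF \<phi>(1) \<psi>]
    unfolding span by (auto simp: o_def linear_id[unfolded id_def])
  have \<psi>_sp: "\<psi> y \<in> coord_space d" for y
    unfolding \<psi>_def using e_lat int_lattice_coord_space
    by (intro subspace_sum[OF subspace_coord_space] subspace_scale[OF subspace_coord_space]) auto
  have bij: "bij_betw \<phi> (int_lattice d) (int_lattice d)"
    by (rule bij_betw_byWitness[of _ \<psi>]) (use \<phi>_lat \<psi>_lat \<phi>\<psi> \<psi>\<phi> int_lattice_coord_space in blast)+
  have "Poly_Mapping.lookup (\<phi> x) m = of_int (icoord B x (e m))" if "x \<in> int_lattice d" "m < d" for x m
    using that(2) unfolding \<phi>x[OF that(1)] lookup_unit_sum by simp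
  then show ?thesis
    using \<phi>(1) \<psi> bij \<psi>_lat \<phi>_sp \<psi>\<phi> \<psi>_sp \<phi>\<psi> \<phi>e by (intro exI[of _ \<phi>] exI[of _ \<psi>] conjI ballI allI impI; simp)
qed

text \<open>In coordinates from \<open>B\<close> the vertices off the hexagon lie in the last
  \<open>d - 2\<close> coordinates and become the vertices of \<open>Q\<close>. Smoothness passes to
  \<open>Q\<close> because a facet of \<open>Q\<close> joins with the edge from \<open>i\<close> to
  \<open>j\<close> to a facet of \<open>P\<close>.\<close>

lemma hexagon_split:
  assumes sf: "smooth_fano_polytope d P" and d: "d \<ge> 3"
  defines "V \<equiv> vertices P"
  assumes B: "lattice_basis d B" "B \<subseteq> V" and ij: "i \<in> B" "j \<in> B" "i \<noteq> j"
    and hex: "{- i, - j, i - j, j - i} \<subseteq> V"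
    and rest: "\<And>v. v \<in> V - {i, j, - i, - j, i - j, j - i} \<Longrightarrow> icoord B v i = 0 \<and> icoord B v j = 0"
  shows "\<exists>Q. smooth_fano_polytope (d - 2) Q \<and> lattice_equivalent d P (direct_sum 2 hexagon Q)"
proof -
  define h where "h = d - 2"
  have dh: "d = 2 + h" "h > 0" using d by (auto simp: h_def)
  have d0: "d > 0" using d by simp
  note sv = smooth_fano_vertices[OF sf d0, folded V_def]
  define H where "H = {i, j, - i, - j, i - j, j - i}"
  define V' where "V' = V - H"
  have HV: "H \<subseteq> V" using hex ij B(2) by (auto simp: H_def)
  have "card (B - {i, j}) = card {2..<d}"
    using ij lattice_basis_card[OF B(1)] lattice_basis_finite[OF B(1)] by (subst card_Diff_subset) auto
  then obtain e0 where e0: "bij_betw e0 {2..<d} (B - {i, j})"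
    using finite_same_card_bij[of "{2..<d}" "B - {i, j}"] lattice_basis_finite[OF B(1)] by auto
  define e where "e m = (if m = 0 then i else if m = 1 then j else e0 m)" for m :: nat
  have e: "bij_betw e {..<d} B"
  proof -
    have "bij_betw e {2..<d} (B - {i, j})"
      using e0 by (rule bij_betw_cong[THEN iffD1, rotated]) (auto simp: e_def)
    moreover have "bij_betw e {0, 1} {i, j}" using ij by (auto simp: bij_betw_def e_def)
    ultimately have "bij_betw e ({2..<d} \<union> {0, 1}) ((B - {i, j}) \<union> {i, j})"
      by (rule bij_betw_combine) auto
    moreover have "{2..<d} \<union> {0, 1} = {..<d}" using d by auto
    moreover have "(B - {i, j}) \<union> {i, j} = B" using ij by auto
    ultimately show ?thesis by simp
  qed
  obtain \<phi> \<psi> where \<phi>: "linear \<phi>" "linear \<psi>" "bij_betw \<phi> (int_lattice d) (int_lattice d)"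
    and \<psi>_lat: "\<And>y. y \<in> int_lattice d \<Longrightarrow> \<psi> y \<in> int_lattice d"
    and \<psi>\<phi>: "\<And>x. x \<in> coord_space d \<Longrightarrow> \<phi> x \<in> coord_space d \<and> \<psi> (\<phi> x) = x"
    and \<phi>\<psi>: "\<And>y. y \<in> coord_space d \<Longrightarrow> \<psi> y \<in> coord_space d \<and> \<phi> (\<psi> y) = y"
    and \<phi>_lookup: "\<And>x m. x \<in> int_lattice d \<Longrightarrow> m < d \<Longrightarrow> Poly_Mapping.lookup (\<phi> x) m = of_int (icoord B x (e m))"
    and \<phi>e: "\<And>m. m < d \<Longrightarrow> \<phi> (e m) = unit_vec m"
    using basis_chart[OF B(1) e] by auto
  interpret \<phi>: linear \<phi> by (fact \<phi>(1))
  have \<phi>_lat: "\<phi> x \<in> int_lattice d" if "x \<in> int_lattice d" for x using \<phi>(3) that by (auto simp: bij_betw_def)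
  have \<phi>ij: "\<phi> i = unit_vec 0" "\<phi> j = unit_vec 1" using \<phi>e[of 0] \<phi>e[of 1] d by (auto simp: e_def)
  have V_lat: "v \<in> int_lattice d" if "v \<in> V" for v using sv(3) that by auto
  have V_sp: "v \<in> coord_space d" if "v \<in> V" for v using V_lat[OF that] int_lattice_coord_space by auto
  define \<pi> where "\<pi> x = drop_coords 2 h (\<phi> x)" for x
  define \<iota> where "\<iota> y = \<psi> (shift_coords 2 y)" for y
  have lin\<pi>: "linear \<pi>" and lin\<iota>: "linear \<iota>"
    using linear_compose[OF \<phi>(1) linear_drop_coords] linear_compose[OF linear_shift_coords \<phi>(2)]
    unfolding \<pi>_def \<iota>_def o_def by blast+
  interpret \<pi>: linear \<pi> by (fact lin\<pi>)
  interpret \<iota>: linear \<iota> by (fact lin\<iota>)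
  have \<pi>_lat: "\<pi> x \<in> int_lattice h" if "x \<in> int_lattice d" for x
    unfolding \<pi>_def using \<phi>_lat[OF that] dh by (intro drop_coords_lattice) simp
  have \<iota>_lat: "\<iota> y \<in> int_lattice d" if "y \<in> int_lattice h" for y
    unfolding \<iota>_def using shift_coords_lattice[OF that, of 2] dh \<psi>_lat by simp
  have \<iota>_sp: "\<iota> y \<in> coord_space d" and \<pi>\<iota>: "\<pi> (\<iota> y) = y" if "y \<in> coord_space h" for y
    using shift_coords_space[OF that, of 2] \<phi>\<psi> drop_shift_coords[OF that] dh by (auto simp: \<pi>_def \<iota>_def)
  have \<pi>ij: "\<pi> i = 0" "\<pi> j = 0"
    by (auto intro!: poly_mapping_eqI simp: \<pi>_def \<phi>ij lookup_drop_coords lookup_unit_vec)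
  have \<pi>H: "\<pi> x = 0" if "x \<in> H" for x
    using that \<pi>ij by (auto simp: H_def \<pi>.neg \<pi>.diff)
  have split: "\<phi> x = Poly_Mapping.lookup (\<phi> x) 0 *\<^sub>R unit_vec 0 + Poly_Mapping.lookup (\<phi> x) 1 *\<^sub>R unit_vec 1 + shift_coords 2 (\<pi> x)"
    if "x \<in> coord_space d" for x
  proof (rule poly_mapping_eqI)
    fix n
    have "Poly_Mapping.lookup (\<phi> x) n = 0" if "n \<ge> d"
      using \<psi>\<phi> \<open>x \<in> coord_space d\<close> lookup_zero_outside that by blast
    moreover have "n = 0 \<or> n = 1 \<or> (\<exists>m. n = 2 + m)" by presburger
    ultimately show "Poly_Mapping.lookup (\<phi> x) n = Poly_Mapping.lookup (Poly_Mapping.lookup (\<phi> x) 0 *\<^sub>R unit_vec 0 + Poly_Mapping.lookup (\<phi> x) 1 *\<^sub>R unit_vec 1 + shift_coords 2 (\<pi> x)) n"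
      using dh by (auto simp: \<pi>_def lookup_add lookup_scaleR_vec lookup_unit_vec lookup_shift_coords lookup_drop_coords)
  qed
  have shift\<pi>: "shift_coords 2 (\<pi> v) = \<phi> v" if v: "v \<in> V'" for v
  proof -
    have vV: "v \<in> V" using v by (simp add: V'_def)
    have "Poly_Mapping.lookup (\<phi> v) 0 = 0" "Poly_Mapping.lookup (\<phi> v) 1 = 0"
      using \<phi>_lookup[OF V_lat[OF vV], of 0] \<phi>_lookup[OF V_lat[OF vV], of 1] rest[of v] v d
      by (auto simp: V'_def H_def e_def)
    then show ?thesis using split[OF V_sp[OF vV]] by simp
  qed
  have \<iota>\<pi>: "\<iota> (\<pi> v) = v" if "v \<in> V'" for v
    using shift\<pi>[OF that] \<psi>\<phi>[OF V_sp] that by (auto simp: \<iota>_def V'_def)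
  define W where "W = \<pi> ` V'"
  define Q where "Q = convex hull W"
  have finW: "finite W" using sv(1) by (simp add: W_def V'_def)
  have W_lat: "W \<subseteq> int_lattice h" using \<pi>_lat V_lat by (auto simp: W_def V'_def)
  have W_sp: "W \<subseteq> coord_space h" using W_lat int_lattice_coord_space by blast
  have \<iota>W: "\<iota> ` W = V'" using \<iota>\<pi> by (force simp: W_def)
  have lpQ: "lattice_polytope h Q" unfolding lattice_polytope_def Q_def using finW W_lat by blast
  have Q_sp: "Q \<subseteq> coord_space h" by (rule lattice_polytope_subset[OF lpQ])
  have cQ: "convex Q" by (simp add: Q_def convex_convex_hull)
  have \<iota>Q: "\<iota> ` Q \<subseteq> P"
    unfolding Q_def convex_hull_linear_image[OF lin\<iota>] \<iota>W using sv(2) hull_mono[of V' V convex] by (auto simp: V'_def)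
  have \<pi>P: "\<pi> ` P \<subseteq> convex hull (insert 0 W)"
  proof -
    have "\<pi> ` P = convex hull (\<pi> ` V)" using convex_hull_linear_image[OF lin\<pi>, of V] sv(2) by simp
    also have "\<dots> \<subseteq> convex hull (insert 0 W)"
      using \<pi>H by (intro hull_mono) (auto simp: W_def V'_def)
    finally show ?thesis .
  qed
  have absorb0: "\<exists>r>0. \<forall>t. \<bar>t\<bar> \<le> r \<longrightarrow> t *\<^sub>R x \<in> convex hull (insert 0 W)" if x: "x \<in> coord_space h" for x
  proof -
    obtain r where r: "r > 0" "\<And>t. \<bar>t\<bar> \<le> r \<Longrightarrow> t *\<^sub>R \<iota> x \<in> P"
      using sv(4) \<iota>_sp[OF x] by (auto simp: absorbing_def)
    have "t *\<^sub>R x \<in> convex hull (insert 0 W)" if "\<bar>t\<bar> \<le> r" for t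
      using \<pi>P r(2)[OF that] \<pi>\<iota>[OF x] \<pi>.scaleR[of t "\<iota> x"] by (metis image_subset_iff)
    then show ?thesis using r(1) by blast
  qed
  have "e 2 \<in> V'"
  proof -
    have "\<pi> (e 2) = drop_coords 2 h (unit_vec 2)" using \<phi>e[of 2] d by (simp add: \<pi>_def)
    then have "Poly_Mapping.lookup (\<pi> (e 2)) 0 = 1" using dh by (simp add: lookup_drop_coords lookup_unit_vec)
    then have "e 2 \<notin> H" using \<pi>H by fastforce
    moreover have "e 2 \<in> V" using e d B(2) by (auto simp: bij_betw_def)
    ultimately show ?thesis by (simp add: V'_def)
  qed
  then obtain w where w: "w \<in> W" by (auto simp: W_def)
  \<comment> \<open>Projecting \<open>P\<close> shows only that the hull of \<open>W\<close> and 0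
    is absorbing. A negative multiple of \<open>w\<close> in it is a nonnegative multiple of some
    \<open>q\<close> in \<open>Q\<close>, which makes 0 a convex combination of \<open>w\<close> and
    \<open>q\<close>.\<close>
  have zeroQ: "0 \<in> Q"
  proof -
    obtain r where r: "r > 0" "(- r) *\<^sub>R w \<in> convex hull (insert 0 W)"
      using absorb0[of w] W_sp w by (metis abs_minus_cancel abs_of_pos order_refl subsetD)
    have "W \<noteq> {}" using w by auto
    then obtain v q where vq: "v \<ge> 0" "q \<in> Q" "(- r) *\<^sub>R w = v *\<^sub>R q"
      using r(2) unfolding Q_def by (auto simp: convex_hull_insert)
    have wQ: "w \<in> Q" using w by (simp add: Q_def hull_inc)
    have rv: "r + v > 0" using r(1) vq(1) by simp
    have "(r / (r + v)) *\<^sub>R w + (v / (r + v)) *\<^sub>R q \<in> Q"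
      using wQ vq rv r(1) by (intro convexD[OF cQ]) (auto simp flip: add_divide_distrib)
    moreover have "(r / (r + v)) *\<^sub>R w + (v / (r + v)) *\<^sub>R q = (1 / (r + v)) *\<^sub>R (r *\<^sub>R w + v *\<^sub>R q)"
      by (simp add: scaleR_right_distrib)
    moreover have "r *\<^sub>R w + v *\<^sub>R q = 0" using vq(3) by (metis add.right_inverse scaleR_minus_left)
    ultimately show ?thesis by simp
  qed
  have hull0: "convex hull (insert 0 W) = Q" using zeroQ unfolding Q_def by (rule hull_redundant)
  have absQ: "absorbing h Q" using absorb0 unfolding hull0 absorbing_def by blast
  have intQ: "0 \<in> top_of_set (coord_space h) interior_of Q" by (rule absorbing_interior[OF absQ cQ Q_sp])
  have W_ext: "w \<in> vertices Q" if w: "w \<in> W" for w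
  proof -
    have wQ: "w \<in> Q" using w by (simp add: Q_def hull_inc)
    have "w \<notin> open_segment a b" if ab: "a \<in> Q" "b \<in> Q" for a b
    proof
      assume "w \<in> open_segment a b"
      then obtain u where u: "a \<noteq> b" "0 < u" "u < 1" "w = (1 - u) *\<^sub>R a + u *\<^sub>R b" by (auto simp: in_segment)
      have "\<iota> a \<noteq> \<iota> b" using u(1) \<pi>\<iota> ab Q_sp by (metis subsetD)
      then have "\<iota> w \<in> open_segment (\<iota> a) (\<iota> b)"
        using u unfolding in_segment by (auto simp: \<iota>.add \<iota>.scaleR)
      moreover have "\<iota> w \<in> V" using w \<iota>W by (auto simp: V'_def)
      ultimately show False using ab \<iota>Q by (auto simp: V_def vertices_def extreme_point_of_def)
    qed
    then show ?thesis using wQ by (auto simp: vertices_def extreme_point_of_def)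
  qed
  have vQ: "vertices Q = W"
    using W_ext by (auto simp: Q_def vertices_def extreme_point_of_convex_hull)
  have "lattice_basis h (vertices G)" if G: "polytope_facet h G Q" for G
  proof -
    obtain f :: "rvec \<Rightarrow> real" where f: "linear f" "\<And>x. x \<in> Q \<Longrightarrow> f x \<le> 1" "G = {x\<in>Q. f x = 1}" "coord_space h \<subseteq> span G"
      using polytope_facet_functional[OF cQ Q_sp absQ G] by blast
    interpret f: linear f by (fact f(1))
    define W1 where "W1 = {w\<in>W. f w = 1}"
    have vG: "vertices G = W1"
    proof -
      have "G face_of Q" using G by (simp add: polytope_facet_def)
      then have "vertices G = {v\<in>vertices Q. v \<in> G}"
        using extreme_point_of_face by (auto simp: vertices_def)
      then show ?thesis using vQ f(3) hull_inc by (auto simp: W1_def Q_def)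
    qed
    have "G \<subseteq> convex hull W1"
      using convex_hull_tight[OF f(1) finW] f(2,3) unfolding W1_def Q_def by (auto simp: hull_inc)
    then have "G \<subseteq> span W1" using convex_hull_subset_span by blast
    then have spW1: "coord_space h \<subseteq> span W1" using f(4) span_minimal[OF _ subspace_span] by blast
    \<comment> \<open>The supporting functional of the join: on the hexagon it is at most 1 with
      equality exactly at \<open>i\<close> and \<open>j\<close>, and on the other vertices it is
      \<open>f\<close> of the projection.\<close>
    define g where "g x = Poly_Mapping.lookup (\<phi> x) 0 + Poly_Mapping.lookup (\<phi> x) 1 + f (\<pi> x)" for x
    have ling: "linear g"
      by (rule linearI) (simp_all add: g_def \<phi>.add \<phi>.scaleR \<pi>.add \<pi>.scaleR f.add f.scaleR lookup_add lookup_scaleR_vec algebra_simps)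
    define T where "T = {v\<in>V. g v = 1}"
    define T' where "T' = \<iota> ` W1"
    have gV': "g v = f (\<pi> v)" if "v \<in> V'" for v
      using \<phi>_lookup[OF V_lat, of v 0] \<phi>_lookup[OF V_lat, of v 1] rest[of v] that d
      by (auto simp: g_def V'_def H_def e_def)
    have gij: "g i = 1" "g j = 1"
      by (simp_all add: g_def \<pi>ij \<phi>ij lookup_unit_vec)
    interpret g: linear g by (fact ling)
    have gH: "g x \<le> 1 \<and> (g x = 1 \<longrightarrow> x = i \<or> x = j)" if "x \<in> H" for x
      using that gij by (auto simp: H_def g.neg g.diff)
    have W1': "W1 = \<pi> ` {v\<in>V'. f (\<pi> v) = 1}" by (auto simp: W1_def W_def)
    have T': "T' = {v\<in>V'. f (\<pi> v) = 1}" unfolding T'_def W1' using \<iota>\<pi> by force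
    have T: "T = {i, j} \<union> T'"
    proof
      show "T \<subseteq> {i, j} \<union> T'"
      proof
        fix x assume x: "x \<in> T"
        then have "x \<in> H \<or> x \<in> V'" by (auto simp: T_def V'_def)
        then show "x \<in> {i, j} \<union> T'" using gH[of x] gV'[of x] x by (auto simp: T_def T')
      qed
      show "{i, j} \<union> T' \<subseteq> T" using gij gV' ij B(2) unfolding T_def T' V'_def by auto
    qed
    have gle: "g v \<le> 1" if "v \<in> V" for v
    proof (cases "v \<in> H")
      case False
      then have "v \<in> V'" using that by (simp add: V'_def)
      then show ?thesis using gV' f(2)[of "\<pi> v"] by (simp add: Q_def W_def hull_inc)
    qed (use gH in blast)
    have "coord_space d \<subseteq> span T"
    proof
      fix x assume x: "x \<in> coord_space d"
      have "\<pi> x \<in> coord_space h"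
        by (auto intro!: coord_spaceI simp: \<pi>_def lookup_drop_coords)
      then have "\<iota> (\<pi> x) \<in> span T'"
        using spW1 linear_span_image[OF lin\<iota>, of W1] unfolding T'_def by blast
      then have 1: "\<iota> (\<pi> x) \<in> span T" using span_mono[of T' T] T by auto
      have ij_sp: "i \<in> coord_space d" "j \<in> coord_space d" using ij B(2) V_sp by auto
      have \<psi>u: "\<psi> (unit_vec 0) = i" "\<psi> (unit_vec 1) = j"
        using \<psi>\<phi>[OF ij_sp(1)] \<psi>\<phi>[OF ij_sp(2)] unfolding \<phi>ij by blast+
      have "x = \<psi> (\<phi> x)" using \<psi>\<phi>[OF x] by simp
      also have "\<dots> = Poly_Mapping.lookup (\<phi> x) 0 *\<^sub>R i + Poly_Mapping.lookup (\<phi> x) 1 *\<^sub>R j + \<iota> (\<pi> x)"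
        by (subst split[OF x]) (simp only: linear_add[OF \<phi>(2)] linear_scale[OF \<phi>(2)] \<iota>_def \<psi>u)
      finally have "x = Poly_Mapping.lookup (\<phi> x) 0 *\<^sub>R i + Poly_Mapping.lookup (\<phi> x) 1 *\<^sub>R j + \<iota> (\<pi> x)" .
      moreover have "\<dots> \<in> span T"
        using 1 T by (intro span_add span_scale) (auto intro: span_base)
      ultimately show "x \<in> span T" by simp
    qed
    then have lbT: "lattice_basis d T"
      unfolding T_def using fano_vertices.smooth[OF sv(5) ling gle] by blast
    have finT: "finite T" by (rule lattice_basis_finite[OF lbT])
    have ijT': "i \<notin> T'" "j \<notin> T'" by (auto simp: T' V'_def H_def)
    have finT': "finite T'" using finT T by auto
    have inj: "inj_on \<pi> T'" by (rule inj_on_inverseI[of _ \<iota>]) (use \<iota>\<pi> T' in auto)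
    have \<pi>T': "\<pi> ` T' = W1" unfolding W1' T' ..
    \<comment> \<open>An expansion over \<open>T\<close> projects to one over \<open>W1\<close>, as
      \<open>\<pi>\<close> kills \<open>i\<close> and \<open>j\<close>; an expansion over
      \<open>W1\<close> lifts to one over \<open>T\<close> with coefficient 0 at \<open>i\<close>
      and \<open>j\<close>.\<close>
    have "\<exists>!c. c \<in> W1 \<rightarrow>\<^sub>E (UNIV :: int set) \<and> y = (\<Sum>b\<in>W1. of_int (c b) *\<^sub>R b)" if y: "y \<in> int_lattice h" for y
    proof -
      have y_sp: "y \<in> coord_space h" using y int_lattice_coord_space by auto
      have "y = \<pi> (\<Sum>b\<in>T. of_int (icoord T (\<iota> y) b) *\<^sub>R b)"
        using icoord_rep[OF lbT \<iota>_lat[OF y]] \<pi>\<iota>[OF y_sp] by simp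
      also have "\<dots> = (\<Sum>b\<in>T. of_int (icoord T (\<iota> y) b) *\<^sub>R \<pi> b)" by (simp add: \<pi>.sum \<pi>.scaleR)
      also have "\<dots> = (\<Sum>b\<in>T'. of_int (icoord T (\<iota> y) b) *\<^sub>R \<pi> b)"
        using finT \<pi>ij by (intro sum.mono_neutral_right) (auto simp: T)
      also have "\<dots> = (\<Sum>b\<in>T'. of_int (icoord T (\<iota> y) (\<iota> (\<pi> b))) *\<^sub>R \<pi> b)"
        using \<iota>\<pi> T' by (intro sum.cong) auto
      also have "\<dots> = (\<Sum>b\<in>W1. of_int (icoord T (\<iota> y) (\<iota> b)) *\<^sub>R b)"
        unfolding \<pi>T'[symmetric] sum.reindex[OF inj] by simp
      also have "\<dots> = (\<Sum>b\<in>W1. of_int (restrict (\<lambda>b. icoord T (\<iota> y) (\<iota> b)) W1 b) *\<^sub>R b)"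
        by (intro sum.cong) auto
      finally have ex: "y = (\<Sum>b\<in>W1. of_int (restrict (\<lambda>b. icoord T (\<iota> y) (\<iota> b)) W1 b) *\<^sub>R b)" .
      have un: "c = restrict (\<lambda>b. icoord T (\<iota> y) (\<iota> b)) W1"
        if c: "c \<in> W1 \<rightarrow>\<^sub>E (UNIV :: int set)" "y = (\<Sum>b\<in>W1. of_int (c b) *\<^sub>R b)" for c
      proof (rule PiE_ext[OF c(1)])
        fix b assume b: "b \<in> W1"
        define c' where "c' x = (if x = i \<or> x = j then 0 else c (\<pi> x))" for x
        have "\<iota> y = (\<Sum>b\<in>W1. of_int (c b) *\<^sub>R \<iota> b)"
          by (subst c(2)) (simp add: \<iota>.sum \<iota>.scaleR)
        also have "\<dots> = (\<Sum>b\<in>T'. of_int (c (\<pi> b)) *\<^sub>R \<iota> (\<pi> b))"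
          unfolding \<pi>T'[symmetric] sum.reindex[OF inj] by simp
        also have "\<dots> = (\<Sum>b\<in>T'. of_int (c' b) *\<^sub>R b)"
          using \<iota>\<pi> T' ijT' by (intro sum.cong) (auto simp: c'_def)
        also have "\<dots> = (\<Sum>b\<in>T. of_int (c' b) *\<^sub>R b)"
          using finT by (intro sum.mono_neutral_left) (auto simp: T c'_def)
        finally have eq: "\<iota> y = (\<Sum>b\<in>T. of_int (c' b) *\<^sub>R b)" .
        have \<iota>b: "\<iota> b \<in> T'" using b by (simp add: T'_def)
        then have "icoord T (\<iota> y) (\<iota> b) = c' (\<iota> b)" using icoord_unique[OF lbT eq] T by simp
        also have "\<dots> = c (\<pi> (\<iota> b))" using \<iota>b ijT' by (auto simp: c'_def)
        also have "\<pi> (\<iota> b) = b" using b W_sp by (intro \<pi>\<iota>) (auto simp: W1_def)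
        finally show "c b = restrict (\<lambda>b. icoord T (\<iota> y) (\<iota> b)) W1 b" using b by simp
      qed auto
      show ?thesis
        by (rule ex1I[of _ "restrict (\<lambda>b. icoord T (\<iota> y) (\<iota> b)) W1"]) (use ex un in auto)
    qed
    moreover have "finite W1" "W1 \<subseteq> int_lattice h" using finW W_lat by (auto simp: W1_def)
    ultimately show ?thesis unfolding vG lattice_basis_def by blast
  qed
  then have smooth: "smooth_fano_polytope h Q" using lpQ intQ by (simp add: smooth_fano_polytope_def)
  have "\<phi> ` P = convex hull (\<phi> ` V)" using convex_hull_linear_image[OF \<phi>(1), of V] sv(2) by simp
  also have "V = H \<union> V'" using HV by (auto simp: V'_def)
  also have "\<phi> ` (H \<union> V') = \<phi> ` H \<union> shift_coords 2 ` W"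
    unfolding W_def image_Un image_image
    by (intro arg_cong2[of _ _ _ _ "(\<union>)"] image_cong refl) (simp add: shift\<pi>)
  also have "\<phi> ` H = {unit_vec 0, - unit_vec 0, unit_vec 1, - unit_vec 1, unit_vec 0 - unit_vec 1, - (unit_vec 0 - unit_vec 1)}"
    by (simp add: H_def \<phi>.neg \<phi>.diff \<phi>ij insert_commute)
  also have "convex hull ({unit_vec 0, - unit_vec 0, unit_vec 1, - unit_vec 1, unit_vec 0 - unit_vec 1, - (unit_vec 0 - unit_vec 1)} \<union> shift_coords 2 ` W)
      = convex hull (hexagon \<union> shift_coords 2 ` Q)"
    unfolding Q_def hexagon_def convex_hull_linear_image[OF linear_shift_coords]
    by (simp only: hull_Un_left[symmetric] hull_Un_right[symmetric])
  finally have "\<phi> ` P = direct_sum 2 hexagon Q" by (simp add: direct_sum_def)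
  then have "lattice_equivalent d P (direct_sum 2 hexagon Q)"
    unfolding lattice_equivalent_def using \<phi>(1,3) by blast
  then show ?thesis using smooth by (auto simp: h_def)
qed

section \<open>Finiteness\<close>

definition lattice_box :: "nat \<Rightarrow> rvec set" where
  "lattice_box d = {x\<in>int_lattice d. \<forall>m<d. \<bar>Poly_Mapping.lookup x m\<bar> \<le> real ((d + 1)\<^sup>2)}"

lemma finite_lattice_box: "finite (lattice_box d)"
proof -
  define N where "N = {- int ((d + 1)\<^sup>2) .. int ((d + 1)\<^sup>2)}"
  have "lattice_box d \<subseteq> (\<lambda>c. \<Sum>m<d. of_int (c m) *\<^sub>R unit_vec m) ` ({..<d} \<rightarrow>\<^sub>E N)"
  proof
    fix x assume x: "x \<in> lattice_box d"
    define c where "c = restrict (\<lambda>m. \<lfloor>Poly_Mapping.lookup x m\<rfloor>) {..<d}"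
    have c: "of_int (c m) = Poly_Mapping.lookup x m" if "m < d" for m
      using x that by (auto simp: c_def lattice_box_def int_lattice_def elim: Ints_cases)
    have "c m \<in> N" if "m < d" for m
    proof -
      have "\<bar>real_of_int (c m)\<bar> \<le> real ((d + 1)\<^sup>2)" using x that c[OF that] by (simp add: lattice_box_def)
      then have "\<bar>c m\<bar> \<le> int ((d + 1)\<^sup>2)" by linarith
      then show ?thesis unfolding N_def by auto
    qed
    then have "c \<in> {..<d} \<rightarrow>\<^sub>E N" by (auto simp: c_def)
    moreover have "x = (\<Sum>m<d. of_int (c m) *\<^sub>R unit_vec m)"
      using coord_expand[of x d] x c by (auto simp: lattice_box_def int_lattice_def)
    ultimately show "x \<in> (\<lambda>c. \<Sum>m<d. of_int (c m) *\<^sub>R unit_vec m) ` ({..<d} \<rightarrow>\<^sub>E N)" by blast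
  qed
  moreover have "finite ({..<d} \<rightarrow>\<^sub>E N)" by (intro finite_PiE) (auto simp: N_def)
  ultimately show ?thesis using finite_surj by blast
qed

text \<open>Coordinates are at least \<open>- int d - 1\<close> by \<open>icoord_ge\<close> and
  \<open>level_ge\<close>. Since the \<open>d\<close> coordinates sum to at most 1, each is at most
  the square of \<open>d\<close>.\<close>

lemma (in fano_vertices) icoord_special_bound:
  assumes S: "special B" and v: "v \<in> V" and b: "b \<in> B"
  shows "\<bar>icoord B v b\<bar> \<le> int ((d + 1)\<^sup>2)"
proof -
  note B = special_facet[OF S]
  have ge: "icoord B v j \<ge> - int d - 1" if "j \<in> B" for j
    using icoord_ge[OF B v that] level_ge[OF S v] by linarith
  have fin: "finite B" by (rule facet_finite[OF B])
  have "level B v = icoord B v b + (\<Sum>j\<in>B - {b}. icoord B v j)"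
    unfolding level_def by (rule sum.remove[OF fin b])
  moreover have "(\<Sum>j\<in>B - {b}. icoord B v j) \<ge> (\<Sum>j\<in>B - {b}. - int d - 1)"
    using ge by (intro sum_mono) auto
  moreover have "(\<Sum>j\<in>B - {b}. - int d - 1) = - (int d - 1) * (int d + 1)"
    using facet_card[OF B] b fin dpos by (simp add: algebra_simps of_nat_diff)
  ultimately have "icoord B v b \<le> 1 + (int d - 1) * (int d + 1)"
    using level_le_1[OF B v] by linarith
  also have "\<dots> \<le> int ((d + 1)\<^sup>2)" by (simp add: power2_eq_square algebra_simps)
  finally have "icoord B v b \<le> int ((d + 1)\<^sup>2)" .
  moreover have "int d + 1 \<le> int ((d + 1)\<^sup>2)" by (simp add: power2_eq_square algebra_simps)
  ultimately show ?thesis using ge[OF b] by linarith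
qed

lemma box_representative:
  assumes sf: "smooth_fano_polytope d P"
  shows "\<exists>W \<subseteq> lattice_box d. lattice_equivalent d P (convex hull W)"
proof (cases "d = 0")
  case True
  obtain V where V: "finite V" "V \<subseteq> int_lattice d" "P = convex hull V"
    using sf by (auto simp: smooth_fano_polytope_def lattice_polytope_def)
  have "V \<subseteq> lattice_box d" using V(2) True by (auto simp: lattice_box_def)
  then show ?thesis using V(3) lattice_equivalent_refl by auto
next
  case False
  then have d: "d > 0" by simp
  note sv = smooth_fano_vertices[OF sf d]
  interpret fano_vertices d "vertices P" by (rule sv(5))
  obtain B where S: "special B" using special_exists by blast
  note B = special_facet[OF S]
  have "card {..<d} = card B" using facet_card[OF B] by simp
  then obtain e where e: "bij_betw e {..<d} B"
    using finite_same_card_bij[of "{..<d}" B] facet_finite[OF B] by auto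
  obtain \<phi> \<psi> where \<phi>: "linear (\<phi> :: rvec \<Rightarrow> rvec)" "bij_betw \<phi> (int_lattice d) (int_lattice d)"
    "\<forall>x\<in>int_lattice d. \<forall>m<d. Poly_Mapping.lookup (\<phi> x) m = of_int (icoord B x (e m))"
    using basis_chart[OF facet_basis[OF B] e] by auto
  have "\<phi> v \<in> lattice_box d" if v: "v \<in> vertices P" for v
  proof -
    have "\<bar>Poly_Mapping.lookup (\<phi> v) m\<bar> \<le> real ((d + 1)\<^sup>2)" if m: "m < d" for m
    proof -
      have "e m \<in> B" using e m by (auto simp: bij_betw_def)
      from icoord_special_bound[OF S v this]
      have "real_of_int \<bar>icoord B v (e m)\<bar> \<le> real_of_int (int ((d + 1)\<^sup>2))" by (simp only: of_int_le_iff)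
      then show ?thesis using \<phi>(3) V_lat[OF v] m by simp
    qed
    moreover have "\<phi> v \<in> int_lattice d" using \<phi>(2) V_lat[OF v] by (auto simp: bij_betw_def)
    ultimately show ?thesis by (simp add: lattice_box_def)
  qed
  moreover have "\<phi> ` P = convex hull (\<phi> ` vertices P)"
    using convex_hull_linear_image[OF \<phi>(1), of "vertices P"] sv(2) by simp
  then have "lattice_equivalent d P (convex hull (\<phi> ` vertices P))"
    unfolding lattice_equivalent_def using \<phi>(1,2) by blast
  ultimately show ?thesis by blast
qed

text \<open>The Picard condition is the vertex count of \<open>many_vertices\<close>. The summand 3
  supplies both the strict inequality of \<open>hexagon_exists\<close> and \<open>d \<ge> 3\<close>
  for \<open>hexagon_split\<close>.\<close>

lemma large_splittable:
  assumes X: "toric_fano X" and pic: "picard_number X \<ge> 2 * int (toric_dim X) - int k"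
    and large: "4 * many_vertices.total_loss k + 3 \<le> toric_dim X"
  shows "S3_splittable X"
proof -
  define d where "d = toric_dim X"
  define P where "P = fano_polytope_of X"
  have sf: "smooth_fano_polytope d P" using X by (simp add: toric_fano_def d_def P_def)
  have d: "d \<ge> 3" "d > 0" using large by (auto simp: d_def)
  note sv = smooth_fano_vertices[OF sf d(2)]
  interpret fano_vertices d "vertices P" by (rule sv(5))
  have "int (card (vertices P - {0})) - int d \<ge> 2 * int d - int k"
    using pic by (simp add: picard_number_def d_def P_def)
  then have many: "3 * d \<le> card (vertices P) + k" using zero_notin by simp
  interpret many_vertices d "vertices P" k by unfold_locales (rule many)
  have "4 * total_loss < d" using large by (simp add: d_def)
  then obtain B i j where B: "facet B" "i \<in> B" "j \<in> B" "i \<noteq> j" "{- i, - j, i - j, j - i} \<subseteq> vertices P"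
    "\<forall>v \<in> vertices P - {i, j, - i, - j, i - j, j - i}. icoord B v i = 0 \<and> icoord B v j = 0"
    using hexagon_exists by blast
  obtain Q where Q: "smooth_fano_polytope (d - 2) Q" "lattice_equivalent d P (direct_sum 2 hexagon Q)"
    using hexagon_split[OF sf d(1) facet_basis[OF B(1)] facet_subset[OF B(1)] B(2-5)] B(6) by blast
  have "toric_fano (d - 2, Q)" using Q(1) by (simp add: toric_fano_def toric_dim_def fano_polytope_of_def)
  moreover have "toric_isomorphic X (toric_product S3 (d - 2, Q))"
    using Q(2) d by (simp add: toric_isomorphic_def toric_product_def S3_def toric_dim_def fano_polytope_of_def d_def P_def)
  moreover have "toric_dim (d - 2, Q) < toric_dim X" using d by (simp add: toric_dim_def d_def)
  ultimately show ?thesis unfolding S3_splittable_def by blast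
qed

theorem corollary10:
  fixes k :: nat
  shows "finite ({X. toric_fano X \<and> \<not> S3_splittable X \<and>
                     picard_number X \<ge> 2 * int (toric_dim X) - int k} // toric_fano_iso_rel)"
proof -
  define A where "A = {X. toric_fano X \<and> \<not> S3_splittable X \<and>
                     picard_number X \<ge> 2 * int (toric_dim X) - int k}"
  define M where "M = 4 * many_vertices.total_loss k + 3"
  define Z where "Z = (\<Union>d\<in>{..<M}. (\<lambda>W. (d, convex hull W)) ` Pow (lattice_box d))"
  have finZ: "finite Z" by (auto simp: Z_def finite_lattice_box)
  have "A // toric_fano_iso_rel \<subseteq> (\<lambda>z. {Y. toric_fano Y \<and> toric_isomorphic Y z}) ` Z"
  proof
    fix c assume "c \<in> A // toric_fano_iso_rel"
    then obtain X where X: "X \<in> A" "c = toric_fano_iso_rel `` {X}" by (auto elim: quotientE)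
    have fX: "toric_fano X" using X by (simp add: A_def)
    have dim: "toric_dim X < M"
      using large_splittable[OF fX] X by (force simp: A_def M_def)
    obtain W where W: "W \<subseteq> lattice_box (toric_dim X)"
      "lattice_equivalent (toric_dim X) (fano_polytope_of X) (convex hull W)"
      using box_representative fX unfolding toric_fano_def by blast
    define z where "z = (toric_dim X, convex hull W)"
    have zZ: "z \<in> Z" using W(1) dim by (auto simp: Z_def z_def)
    have Xz: "toric_isomorphic X z"
      using W(2) by (simp add: toric_isomorphic_def z_def toric_dim_def fano_polytope_of_def)
    have sym: "toric_isomorphic X2 X1" if "toric_isomorphic X1 X2" "toric_fano X1" for X1 X2
      using that lattice_equivalent_sym lattice_polytope_subset
      by (auto simp: toric_isomorphic_def toric_fano_def smooth_fano_polytope_def)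
    have trans: "toric_isomorphic X1 X3" if "toric_isomorphic X1 X2" "toric_isomorphic X2 X3" for X1 X2 X3
      using that lattice_equivalent_trans by (auto simp: toric_isomorphic_def)
    \<comment> \<open>The class is recovered from \<open>z\<close> alone, so finitely many
      \<open>z\<close> leave finitely many classes.\<close>
    have "c = {Y. toric_fano Y \<and> toric_isomorphic Y z}"
      unfolding X(2) toric_fano_iso_rel_def using fX Xz sym trans by blast
    then show "c \<in> (\<lambda>z. {Y. toric_fano Y \<and> toric_isomorphic Y z}) ` Z" using zZ by blast
  qed
  then show ?thesis using finZ finite_surj unfolding A_def by blast
qed

end
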